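(* Let $1<p<\infty$, $q>0$ and let $u$ be a weak supersolution of $\partial_t(|u|^{q-1}u)+\mathcal{L}u=0$ in $\Omega\times(0,T)$. Then $u_*(x,t)=u(x,t)$ at every Lebesgue point $(x,t)\in\Omega\times(0,T)$ of $u$. In particular, $u_*$ is a lower semicontinuous representative of $u$ in $\Omega\times(0,T)$ (that is, $u_*$ is lower semicontinuous in $\Omega\times(0,T)$ and $u_*=u$ almost everywhere in $\Omega\times(0,T)$).
   Context: Setting. $\Omega\subset\mathbb{R}^n$ is a bounded domain, $T>0$, $1<p<\infty$, $q>0$, $s\in(0,1)$, $\Lambda\ge 1$. The kernel $K(x,y,t)$ is measurable, symmetric in $x$ and $y$, and satisfies $\frac{\Lambda^{-1}}{|x-y|^{n+ps}}\le K(x,y,t)\le\frac{\Lambda}{|x-y|^{n+ps}}$ for almost every $x,y\in\mathbb{R}^n$, uniformly in $t\in(0,T)$. The operator is $\mathcal{L}u(x,t)=\mathrm{P.V.}\int_{\mathbb{R}^n}|u(x,t)-u(y,t)|^{p-2}(u(x,t)-u(y,t))K(x,y,t)\,dy$. Write $\mathcal{A}(u(x,y,t))=|u(x,t)-u(y,t)|^{p-2}(u(x,t)-u(y,t))$ and $d\mu=K(x,y,t)\,dx\,dy$. Function spaces. For an open set $D\subset\mathbb{R}^n$, $W^{s,p}(D)$ is the space of $u\in L^p(D)$ with $\frac{|u(x)-u(y)|}{|x-y|^{n/p+s}}\in L^p(D\times D)$, with norm $\|u\|_{W^{s,p}(D)}=\big(\int_D|u|^p\,dx+\int_D\int_D\frac{|u(x)-u(y)|^p}{|x-y|^{n+ps}}\,dx\,dy\big)^{1/p}$,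 and $W_0^{s,p}(D)=\{u\in W^{s,p}(\mathbb{R}^n):u=0\text{ in }\mathbb{R}^n\setminus D\}$. $L^p(0,T;W^{s,p}(D))$ consists of measurable $u$ on $D\times(0,T)$ with $\int_0^T\|u(\cdot,t)\|_{W^{s,p}(D)}^p\,dt<\infty$; local versions require this on every $\Omega'\times[t_1,t_2]\Subset\Omega\times(0,T)$. Weak supersolution. A function $u:\mathbb{R}^n\times(0,T)\to\mathbb{R}$, $u\in L^\infty(0,T;L^\infty(\mathbb{R}^n))$, is a weak supersolution of $\partial_t(|u|^{q-1}u)+\mathcal{L}u=0$ in $\Omega\times(0,T)$ if $u\in L^{q+1}_{\mathrm{loc}}(0,T;L^{q+1}_{\mathrm{loc}}(\Omega))\cap L^p_{\mathrm{loc}}(0,T;W^{s,p}_{\mathrm{loc}}(\Omega))$ and for every $\Omega'\times[t_1,t_2]\Subset\Omega\times(0,T)$ and every nonnegative test function $\phi\in W^{1,q+1}_{\mathrm{loc}}(0,T;L^{q+1}(\Omega'))\cap L^p_{\mathrm{loc}}(0,T;W_0^{s,p}(\Omega'))$, $$\int_{t_1}^{t_2}\int_{\mathbb{R}^n}\int_{\mathbb{R}^n}\mathcal{A}(u(x,y,t))(\phi(x,t)-\phi(y,t))\,d\mu\,dt-\int_{t_1}^{t_2}\int_{\Omega'}|u|^{q-1}u\,\partial_t\phi\,dx\,dt+\int_{\Omega'}|u(x,t_2)|^{q-1}u(x,t_2)\phi(x,t_2)\,dx-\int_{\Omega'}|u(x,t_1)|^{q-1}u(x,t_1)\phi(x,t_1)\,dx\ge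 0.$$ The boundary terms at $t_1$ and $t_2$ are understood as $\lim_{h\to0}\frac1h\int_{t_1}^{t_1+h}\int_{\Omega'}|u|^{q-1}u\,\phi\,dx\,dt$ and $\lim_{h\to0}\frac1h\int_{t_2-h}^{t_2}\int_{\Omega'}|u|^{q-1}u\,\phi\,dx\,dt$, respectively. Cylinders and regularization. For $r,\theta>0$, $\mathcal{Q}_r(x_0,t_0;\theta)=B_r(x_0)\times(t_0-\theta r^{sp},t_0+\theta r^{sp})$, where $B_r(x_0)$ is the open ball. For $u$ locally essentially bounded below in $\Omega\times(0,T)$, the lower semicontinuous regularization is $u_*(x,t)=\operatorname{ess\,lim\,inf}_{(y,\hat t)\to(x,t)}u(y,\hat t)=\lim_{r\to0}\operatorname{ess\,inf}_{\mathcal{Q}_r(x,t;\theta)}u$ for every $(x,t)\in\Omega\times(0,T)$ (this does not depend on $\theta$). Lebesgue points. A point $(x,t)\in\Omega\times(0,T)$ is a Lebesgue point of $u$ if $|u(x,t)|<\infty$ and $\lim_{r\to0}\frac{1}{|\mathcal{Q}_r(x,t;\theta)|}\int_{\mathcal{Q}_r(x,t;\theta)}|u(x,t)-u(y,\hat t)|\,dy\,d\hat t=0$ (this does not depend on the fixed $\theta>0$). *)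

theory Defs
  imports "HOL-Analysis.Analysis"
begin

text \<open>
  The space \<open>\<real>\<^sup>n\<close> is a Euclidean space \<open>'a\<close> with \<open>n = DIM('a)\<close>. Space-time functions
  are total on \<open>'a \<times> real\<close>; their values at times outside \<open>(0, T)\<close> are never used.
  Measurability and ``almost everywhere'' refer to the (complete) Lebesgue measure. Elements of
  function spaces are understood up to null sets, except where pointwise values matter
  (Lebesgue points).
\<close>

section \<open>Function spaces\<close>

text \<open>
  The \<open>p\<close>-th power of the \<open>W\<^sup>s\<^sup>,\<^sup>p(D)\<close> norm. On the diagonal the quotient is \<open>0\<close> by the
  convention \<open>x / 0 = 0\<close>, which is harmless as the diagonal is a null set.
\<close>
definition Wsp_norm_pow :: "real \<Rightarrow> real \<Rightarrow> 'a::euclidean_space set \<Rightarrow> ('a \<Rightarrow> real) \<Rightarrow> ennreal" where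
  "Wsp_norm_pow s p D f =
     (\<integral>\<^sup>+x\<in>D. ennreal (\<bar>f x\<bar> powr p) \<partial>lebesgue) +
     (\<integral>\<^sup>+x\<in>D. (\<integral>\<^sup>+y\<in>D. ennreal (\<bar>f x - f y\<bar> powr p
                         / norm (x - y) powr (real DIM('a) + p * s)) \<partial>lebesgue) \<partial>lebesgue)"

definition Wsp :: "real \<Rightarrow> real \<Rightarrow> 'a::euclidean_space set \<Rightarrow> ('a \<Rightarrow> real) set" where
  "Wsp s p D = {f. f \<in> borel_measurable (lebesgue_on D) \<and> Wsp_norm_pow s p D f < \<infinity>}"

definition Wsp0 :: "real \<Rightarrow> real \<Rightarrow> 'a::euclidean_space set \<Rightarrow> ('a \<Rightarrow> real) set" where
  "Wsp0 s p D = {f \<in> Wsp s p UNIV. AE x in lebesgue. x \<notin> D \<longrightarrow> f x = 0}"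

text \<open>\<open>L\<^sup>r(I; L\<^sup>r(D))\<close>\<close>
definition Lr_Lr :: "real \<Rightarrow> 'a::euclidean_space set \<Rightarrow> real set \<Rightarrow> ('a \<times> real \<Rightarrow> real) set" where
  "Lr_Lr r D I = {f. f \<in> borel_measurable (lebesgue_on (D \<times> I)) \<and>
     (\<integral>\<^sup>+t\<in>I. (\<integral>\<^sup>+x\<in>D. ennreal (\<bar>f (x, t)\<bar> powr r) \<partial>lebesgue) \<partial>lebesgue) < \<infinity>}"

text \<open>\<open>L\<^sup>p(I; W\<^sup>s\<^sup>,\<^sup>p(D))\<close>\<close>
definition Lp_Wsp :: "real \<Rightarrow> real \<Rightarrow> 'a::euclidean_space set \<Rightarrow> real set \<Rightarrow> ('a \<times> real \<Rightarrow> real) set" where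
  "Lp_Wsp s p D I = {f. f \<in> borel_measurable (lebesgue_on (D \<times> I)) \<and>
     (\<integral>\<^sup>+t\<in>I. Wsp_norm_pow s p D (\<lambda>x. f (x, t)) \<partial>lebesgue) < \<infinity>}"

text \<open>\<open>L\<^sup>p(I; W\<^sub>0\<^sup>s\<^sup>,\<^sup>p(D))\<close>\<close>
definition Lp_Wsp0 :: "real \<Rightarrow> real \<Rightarrow> 'a::euclidean_space set \<Rightarrow> real set \<Rightarrow> ('a \<times> real \<Rightarrow> real) set" where
  "Lp_Wsp0 s p D I = {f \<in> Lp_Wsp s p UNIV I. AE t in lebesgue_on I. (\<lambda>x. f (x, t)) \<in> Wsp0 s p D}"

text \<open>\<open>L\<^sup>\<infinity>(0, T; L\<^sup>\<infinity>(\<real>\<^sup>n))\<close>\<close>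
definition Linf_Linf :: "real \<Rightarrow> ('a::euclidean_space \<times> real \<Rightarrow> real) set" where
  "Linf_Linf T = {f. f \<in> borel_measurable (lebesgue_on (UNIV \<times> {0<..<T})) \<and>
     (\<exists>M. AE t in lebesgue_on {0<..<T}. AE x in lebesgue. \<bar>f (x, t)\<bar> \<le> M)}"

text \<open>\<open>\<Omega>' \<times> [t1, t2]\<close> is compactly contained in \<open>\<Omega> \<times> (0, T)\<close>.\<close>
definition compact_subcylinder ::
    "'a::euclidean_space set \<Rightarrow> real \<Rightarrow> 'a set \<Rightarrow> real \<Rightarrow> real \<Rightarrow> bool" where
  "compact_subcylinder \<Omega> T \<Omega>' t1 t2 \<longleftrightarrow>
     open \<Omega>' \<and> compact (closure \<Omega>') \<and> closure \<Omega>' \<subseteq> \<Omega> \<and> 0 < t1 \<and> t1 < t2 \<and> t2 < T"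

text \<open>\<open>C\<^sub>c\<^sup>\<infinity>(0, T)\<close>\<close>
definition smooth_compact_support :: "real \<Rightarrow> (real \<Rightarrow> real) set" where
  "smooth_compact_support T = {\<eta>. (\<forall>k. (deriv ^^ k) \<eta> differentiable_on UNIV) \<and>
     compact (closure {t. \<eta> t \<noteq> 0}) \<and> closure {t. \<eta> t \<noteq> 0} \<subseteq> {0<..<T}}"

text \<open>
  \<open>\<psi> = \<partial>\<^sub>t \<phi>\<close> weakly on \<open>(0, T)\<close>, for functions of time with values in a Lebesgue space over
  \<open>D\<close>: the defining identity is one between elements of that space, hence holds for almost
  every \<open>x\<close> in \<open>D\<close>.
\<close>
definition weak_time_deriv ::
    "real \<Rightarrow> 'a::euclidean_space set \<Rightarrow> ('a \<times> real \<Rightarrow> real) \<Rightarrow> ('a \<times> real \<Rightarrow> real) \<Rightarrow> bool" where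
  "weak_time_deriv T D \<phi> \<psi> \<longleftrightarrow>
     (\<forall>\<eta>\<in>smooth_compact_support T. AE x in lebesgue_on D.
        (LINT t:{0<..<T}|lebesgue. \<phi> (x, t) * deriv \<eta> t)
          = - (LINT t:{0<..<T}|lebesgue. \<psi> (x, t) * \<eta> t))"

text \<open>
  Nonnegative \<open>\<phi>\<close> in \<open>W\<^sup>1\<^sup>,\<^sup>q\<^sup>+\<^sup>1\<^sub>l\<^sub>o\<^sub>c(0, T; L\<^sup>q\<^sup>+\<^sup>1(\<Omega>'))\<close> and in \<open>L\<^sup>p\<^sub>l\<^sub>o\<^sub>c(0, T; W\<^sub>0\<^sup>s\<^sup>,\<^sup>p(\<Omega>'))\<close>
  together with its weak time derivative \<open>\<psi>\<close>.
\<close>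
definition admissible_test ::
    "real \<Rightarrow> real \<Rightarrow> real \<Rightarrow> real \<Rightarrow> 'a::euclidean_space set \<Rightarrow>
     ('a \<times> real \<Rightarrow> real) \<Rightarrow> ('a \<times> real \<Rightarrow> real) \<Rightarrow> bool" where
  "admissible_test s p q T \<Omega>' \<phi> \<psi> \<longleftrightarrow>
     (\<forall>a b. 0 < a \<and> a < b \<and> b < T \<longrightarrow>
        \<phi> \<in> Lr_Lr (q + 1) \<Omega>' {a..b} \<and> \<psi> \<in> Lr_Lr (q + 1) \<Omega>' {a..b} \<and>
        \<phi> \<in> Lp_Wsp0 s p \<Omega>' {a..b}) \<and>
     weak_time_deriv T \<Omega>' \<phi> \<psi> \<and>
     (AE z in lebesgue_on (UNIV \<times> {0<..<T}). 0 \<le> \<phi> z)"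

section \<open>The equation\<close>

definition admissible_kernel ::
    "real \<Rightarrow> real \<Rightarrow> real \<Rightarrow> real \<Rightarrow> ('a::euclidean_space \<Rightarrow> 'a \<Rightarrow> real \<Rightarrow> real) \<Rightarrow> bool" where
  "admissible_kernel s p \<Lambda> T K \<longleftrightarrow>
     (\<lambda>(x, y, t). K x y t) \<in> borel_measurable (lebesgue_on (UNIV \<times> UNIV \<times> {0<..<T})) \<and>
     (\<forall>t\<in>{0<..<T}. \<forall>x y. K x y t = K y x t) \<and>
     (\<forall>t\<in>{0<..<T}. AE (x, y) in lebesgue.
        inverse \<Lambda> / norm (x - y) powr (real DIM('a) + p * s) \<le> K x y t \<and>
        K x y t \<le> \<Lambda> / norm (x - y) powr (real DIM('a) + p * s))"

text \<open>
  \<open>signed_pow r v = |v|\<^sup>r\<^sup>-\<^sup>1 v\<close>, which is \<open>0\<close> at \<open>v = 0\<close> also when \<open>r < 1\<close>. With \<open>r = q\<close> it is the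
  nonlinearity under the time derivative, with \<open>r = p - 1\<close> the one in the nonlocal operator.
\<close>
definition signed_pow :: "real \<Rightarrow> real \<Rightarrow> real" where
  "signed_pow r v = \<bar>v\<bar> powr (r - 1) * v"

definition nonlocal_energy ::
    "real \<Rightarrow> ('a::euclidean_space \<Rightarrow> 'a \<Rightarrow> real \<Rightarrow> real) \<Rightarrow> real \<Rightarrow> real \<Rightarrow>
     ('a \<times> real \<Rightarrow> real) \<Rightarrow> ('a \<times> real \<Rightarrow> real) \<Rightarrow> real" where
  "nonlocal_energy p K t1 t2 u \<phi> =
     (LINT t:{t1..t2}|lebesgue. (LINT x|lebesgue. (LINT y|lebesgue.
        signed_pow (p - 1) (u (x, t) - u (y, t)) * (\<phi> (x, t) - \<phi> (y, t)) * K x y t)))"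

text \<open>
  The boundary terms at \<open>t1\<close> and \<open>t2\<close> are limits of one-sided time averages; the existence of
  these limits is part of the definition.
\<close>
definition weak_supersolution ::
    "real \<Rightarrow> real \<Rightarrow> real \<Rightarrow> ('a::euclidean_space \<Rightarrow> 'a \<Rightarrow> real \<Rightarrow> real) \<Rightarrow> 'a set \<Rightarrow> real \<Rightarrow>
     ('a \<times> real \<Rightarrow> real) \<Rightarrow> bool" where
  "weak_supersolution s p q K \<Omega> T u \<longleftrightarrow>
     u \<in> Linf_Linf T \<and>
     (\<forall>\<Omega>' t1 t2. compact_subcylinder \<Omega> T \<Omega>' t1 t2 \<longrightarrow>
        u \<in> Lr_Lr (q + 1) \<Omega>' {t1..t2} \<and> u \<in> Lp_Wsp s p \<Omega>' {t1..t2}) \<and>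
     (\<forall>\<Omega>' t1 t2 \<phi> \<psi>. compact_subcylinder \<Omega> T \<Omega>' t1 t2 \<and> admissible_test s p q T \<Omega>' \<phi> \<psi> \<longrightarrow>
        (\<exists>b1 b2.
           ((\<lambda>h. 1 / h * (LINT t:{t1..t1 + h}|lebesgue. (LINT x:\<Omega>'|lebesgue.
                signed_pow q (u (x, t)) * \<phi> (x, t)))) \<longlongrightarrow> b1) (at_right 0) \<and>
           ((\<lambda>h. 1 / h * (LINT t:{t2 - h..t2}|lebesgue. (LINT x:\<Omega>'|lebesgue.
                signed_pow q (u (x, t)) * \<phi> (x, t)))) \<longlongrightarrow> b2) (at_right 0) \<and>
           nonlocal_energy p K t1 t2 u \<phi>
           - (LINT t:{t1..t2}|lebesgue. (LINT x:\<Omega>'|lebesgue. signed_pow q (u (x, t)) * \<psi> (x, t)))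
           + b2 - b1 \<ge> 0))"

section \<open>Regularization and Lebesgue points\<close>

definition cyl :: "real \<Rightarrow> real \<Rightarrow> real \<Rightarrow> real \<Rightarrow> 'a::euclidean_space \<times> real \<Rightarrow> ('a \<times> real) set" where
  "cyl s p \<theta> r z =
     ball (fst z) r \<times> {snd z - \<theta> * r powr (s * p) <..< snd z + \<theta> * r powr (s * p)}"

text \<open>The dual of the essential supremum (\<open>esssup\<close>) of HOL-Probability.\<close>
definition essinf :: "'b measure \<Rightarrow> ('b \<Rightarrow> ereal) \<Rightarrow> ereal" where
  "essinf M f = Liminf (ae_filter M) f"

text \<open>The limit exists in the extended reals, since the essential infimum is antimonotone in \<open>r\<close>.\<close>
definition lsc_regularization ::
    "real \<Rightarrow> real \<Rightarrow> real \<Rightarrow> ('a::euclidean_space \<times> real \<Rightarrow> real) \<Rightarrow> 'a \<times> real \<Rightarrow> ereal" where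
  "lsc_regularization s p \<theta> u z =
     Lim (at_right 0) (\<lambda>r. essinf (lebesgue_on (cyl s p \<theta> r z)) (\<lambda>w. ereal (u w)))"

text \<open>The requirement \<open>|u(z)| < \<infinity>\<close> is void, as \<open>u\<close> is real-valued.\<close>
definition lebesgue_point ::
    "real \<Rightarrow> real \<Rightarrow> real \<Rightarrow> ('a::euclidean_space \<times> real \<Rightarrow> real) \<Rightarrow> 'a \<times> real \<Rightarrow> bool" where
  "lebesgue_point s p \<theta> u z \<longleftrightarrow>
     ((\<lambda>r. (\<integral>\<^sup>+w\<in>cyl s p \<theta> r z. ennreal \<bar>u z - u w\<bar> \<partial>lebesgue) / emeasure lebesgue (cyl s p \<theta> r z))
        \<longlongrightarrow> 0) (at_right 0)"

definition lower_semicontinuous_on :: "'b::topological_space set \<Rightarrow> ('b \<Rightarrow> ereal) \<Rightarrow> bool" where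
  "lower_semicontinuous_on S f \<longleftrightarrow> (\<forall>z\<in>S. f z \<le> Liminf (at z within S) f)"

end

theory Submission
  imports Defs
begin

text \<open>
  The core is a De Giorgi lemma: if \<open>{u < c}\<close> occupies a sufficiently small fraction of a cylinder,
  then \<open>u \<ge> c - \<epsilon>\<close> almost everywhere near its centre. The test functions are \<open>(b - u(\<tau>))\<^sub>+\<close>, frozen at a
  time \<open>\<tau>\<close>, with a Lipschitz barrier \<open>b\<close> that is below \<open>u\<close> outside a ball. Being constant in time they
  need no mollification: convexity of the Bregman distance turns the increments of \<open>|u|\<^sup>q\<^sup>-\<^sup>1 u\<close> over
  time steps \<open>h\<close> into those of \<open>\<integral> \<integral>\<^sub>u\<^sup>b (b - a) d(|a|\<^sup>q\<^sup>-\<^sup>1 a)\<close>, and Young's inequality with Fatou's lemma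
  lets \<open>h\<close> tend to \<open>0\<close> in the nonlocal term. No Sobolev embedding is needed: a point deep inside a
  sublevel set of small measure \<open>m\<close> sees its complement at distance of order \<open>m\<^sup>1\<^sup>/\<^sup>n\<close>, which makes the
  nonlocal term coercive with a constant of order \<open>m\<^sup>-\<^sup>s\<^sup>p\<^sup>/\<^sup>n\<close>, and that gain drives the iteration over
  levels. At a Lebesgue point, and at almost every point, small sublevel sets are available at
  arbitrarily small scales.
\<close>

section \<open>One-sided time averages\<close>

text \<open>Nothing is assumed on the time derivative of u, so a truncation of u need not be an
  admissible test function. Freezing it at a time \<tau> makes it one, but then u at time t is
  paired with the truncation at time \<tau>. Only an upper bound for the limit of this pairing is
  needed: Young's inequality exhibits it as part of a nonnegative defect, to which Fatou's lemma
  applies. As the test function varies with \<tau>, the null set of bad times must be chosen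
  independently of it. The iteration advances by two indices. The space-time measure of a sublevel
  set bounds its time slices, through the Bregman term; slices of measure m give the coercivity
  constant m \<rho>^(-n - p s) with \<rho> of order m^(1/n), that is m^(-p s / n), and this bounds
  the space-time measure at the index after. The cylinders have size r in space and r^(p s) in time,
  so they degenerate in shape as r tends to 0 unless p s = 1. The density statement is therefore
  proved for them directly, as a statement on lower densities: the lower bound consumes one small
  scale only.\<close>

lemma LIMSEQ_iff_nat:
  fixes X :: "nat \<Rightarrow> real"
  shows "X \<longlonglongrightarrow> L \<longleftrightarrow> (\<forall>i::nat. \<exists>no. \<forall>n\<ge>no. \<bar>X n - L\<bar> < 1 / real (Suc i))"
proof
  assume "X \<longlonglongrightarrow> L"
  then show "\<forall>i::nat. \<exists>no. \<forall>n\<ge>no. \<bar>X n - L\<bar> < 1 / real (Suc i)"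
    by (auto simp: LIMSEQ_iff)
next
  assume R: "\<forall>i::nat. \<exists>no. \<forall>n\<ge>no. \<bar>X n - L\<bar> < 1 / real (Suc i)"
  show "X \<longlonglongrightarrow> L"
  proof (rule LIMSEQ_I)
    fix r :: real assume "0 < r"
    then obtain i where "1 / real (Suc i) < r" using nat_approx_posE by blast
    with R show "\<exists>no. \<forall>n\<ge>no. norm (X n - L) < r"
      by (metis less_trans real_norm_def)
  qed
qed

text \<open>One-sided Lebesgue differentiation, matching the boundary terms of a weak supersolution.
  The scales 1 / (m + 1) suffice there, since the limits over all h exist by definition.\<close>

lemma AE_average_tendsto_right:
  fixes f :: "real \<Rightarrow> real"
  assumes "\<And>a b. set_integrable lborel {a..b} f"
  shows "AE t in lborel.
    (\<lambda>m. real (Suc m) * (LINT \<sigma>:{0..1 / real (Suc m)}|lborel. f (t + \<sigma>))) \<longlonglongrightarrow> f t"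
proof -
  have int: "f integrable_on cbox a b" for a b
    using set_borel_integral_eq_integral(1)[OF assms[of a b]] by simp
  obtain N where N: "negligible N"
    and lim: "\<And>x e. \<lbrakk>x \<notin> N; 0 < e\<rbrakk> \<Longrightarrow> \<exists>d>0. \<forall>h. 0 < h \<and> h < d \<longrightarrow>
        norm (integral (cbox x (x + h *\<^sub>R One)) f /\<^sub>R h ^ DIM(real) - f x) < e"
    using integrable_ccontinuous_explicit[of f] int by blast
  have "AE t in lebesgue. t \<notin> N"
    using N by (simp add: negligible_iff_null_sets AE_not_in)
  then have "AE t in lborel. t \<notin> N"
    by (simp add: AE_completion_iff)
  then show ?thesis
  proof eventually_elim
    case (elim t)
    have avg: "(LINT \<sigma>:{0..h}|lborel. f (t + \<sigma>)) = integral (cbox t (t + h)) f" if "h > 0" for h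
    proof -
      have "(LINT \<sigma>:{0..h}|lborel. f (t + \<sigma>)) = (LINT x:{t..t+h}|lborel. f x)"
        unfolding set_lebesgue_integral_def
        by (subst (2) lborel_integral_real_affine[where c=1 and t=t])
           (auto intro!: Bochner_Integration.integral_cong simp: indicator_def)
      then show ?thesis
        using set_borel_integral_eq_integral(2)[OF assms[of t "t+h"]] by simp
    qed
    show ?case
    proof (rule LIMSEQ_I)
      fix e :: real assume "0 < e"
      from lim[OF elim this] obtain d where d: "d > 0"
        "\<And>h. 0 < h \<Longrightarrow> h < d \<Longrightarrow> norm (integral (cbox t (t + h)) f / h - f t) < e"
        by (auto simp: divide_inverse mult.commute)
      obtain n where n: "1 / real (Suc n) < d"
        using nat_approx_posE[OF d(1)] by auto
      have "norm (real (Suc m) * (LINT \<sigma>:{0..1 / real (Suc m)}|lborel. f (t + \<sigma>)) - f t) < e"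
        if "m \<ge> n" for m
      proof -
        have "1 / real (Suc m) \<le> 1 / real (Suc n)"
          using that by (simp add: frac_le)
        with n have "1 / real (Suc m) < d" by linarith
        from d(2)[OF _ this] show ?thesis
          by (simp add: avg mult.commute)
      qed
      then show "\<exists>no. \<forall>m\<ge>no. norm (real (Suc m) *
          (LINT \<sigma>:{0..1 / real (Suc m)}|lborel. f (t + \<sigma>)) - f t) < e" by blast
    qed
  qed
qed

lemma AE_lborel_uminus:
  assumes "AE t in lborel. P (t::real)"
  shows "AE t in lborel. P (- t)"
proof -
  have "AE t in distr lborel borel uminus. P (t::real)"
    unfolding lborel_distr_uminus by (rule assms)
  then show ?thesis by (rule AE_distrD[rotated]) simp
qed

lemma AE_lborel_shift:
  assumes "AE t in lborel. P (t::real)"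
  shows "AE t in lborel. P (c + t)"
proof -
  have "AE t in distr lborel borel ((+) c). P (t::real)"
    unfolding lborel_distr_plus by (rule assms)
  then show ?thesis by (rule AE_distrD[rotated]) simp
qed

lemma AE_average_tendsto_left:
  fixes f :: "real \<Rightarrow> real"
  assumes "\<And>a b. set_integrable lborel {a..b} f"
  shows "AE t in lborel.
    (\<lambda>m. real (Suc m) * (LINT \<sigma>:{0..1 / real (Suc m)}|lborel. f (t - \<sigma>))) \<longlonglongrightarrow> f t"
proof -
  have "set_integrable lborel {a..b} (\<lambda>x. f (- x))" for a b
    using lborel_integrable_real_affine[OF assms[of "-b" "-a", unfolded set_integrable_def], of "-1" 0]
    by (simp add: set_integrable_def indicator_def cong: conj_cong)
       (smt (verit, best) Bochner_Integration.integrable_cong)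
  from AE_lborel_uminus[OF AE_average_tendsto_right[OF this]] show ?thesis
    by simp
qed

text \<open>For fixed z this is differentiation in t. The content is the exchange of the two
  quantifiers, after which a single time is good for almost every z. The factor c selects right
  averages (1) or left averages (-1).\<close>

lemma AE_average_tendsto_product:
  fixes f :: "real \<times> 'c \<Rightarrow> real"
  assumes "sigma_finite_measure M" and [measurable]: "f \<in> borel_measurable (lborel \<Otimes>\<^sub>M M)"
    and c: "c = 1 \<or> c = - 1"
    and int: "AE z in M. \<forall>a b. set_integrable lborel {a..b} (\<lambda>t. f (t, z))"
  shows "AE t in lborel. AE z in M.
    (\<lambda>m. real (Suc m) * (LINT \<sigma>:{0..1 / real (Suc m)}|lborel. f (t + c * \<sigma>, z))) \<longlonglongrightarrow> f (t, z)"
proof -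
  interpret sigma_finite_measure M by fact
  interpret pair_sigma_finite lborel M ..
  have "AE z in M. AE t in lborel.
    (\<lambda>m. real (Suc m) * (LINT \<sigma>:{0..1 / real (Suc m)}|lborel. f (t + c * \<sigma>, z))) \<longlonglongrightarrow> f (t, z)"
    using int
  proof eventually_elim
    case (elim z)
    then show ?case
      using AE_average_tendsto_right[of "\<lambda>t. f (t, z)"] AE_average_tendsto_left[of "\<lambda>t. f (t, z)"] c
      by auto
  qed
  then show ?thesis
    \<comment> \<open>With countable quantifiers over the tolerances 1 / (i + 1), convergence
      becomes a measurable predicate, which exchanging the quantifiers requires.\<close>
    unfolding LIMSEQ_iff_nat set_lebesgue_integral_def
    by (rule AE_commute[THEN iffD2, rotated]) measurable
qed

lemma abs_le_one_plus_powr: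
  fixes x r :: real
  assumes "r > 1"
  shows "\<bar>x\<bar> \<le> 1 + \<bar>x\<bar> powr r"
proof (cases "\<bar>x\<bar> \<le> 1")
  case False
  then have "\<bar>x\<bar> powr 1 \<le> \<bar>x\<bar> powr r" using assms by (intro powr_mono) auto
  then show ?thesis using False by simp
qed (use powr_ge_zero[of "\<bar>x\<bar>" r] in linarith)

lemma Young_signed:
  fixes r r' x y :: real
  assumes "r > 1" "r' > 1" "1 / r + 1 / r' = 1"
  shows "\<bar>x * y\<bar> \<le> \<bar>x\<bar> powr r / r + \<bar>y\<bar> powr r' / r'"
  using Youngs_inequality[OF assms, of "\<bar>x\<bar>" "\<bar>y\<bar>"] by (simp add: abs_mult)

text \<open>Put W = |f|^r / r and V = |g|^r' / r'. By Young's inequality W(\<tau> - \<sigma>) +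
  V(\<tau>) - f(\<tau> - \<sigma>) g(\<tau>) is nonnegative. The integrals of its first two parts do
  not change with the shift, and its averages over \<sigma> converge almost everywhere by
  differentiation in time. Fatou's lemma then bounds the pairing from above.\<close>

lemma
  fixes f g :: "real \<times> 'c \<Rightarrow> real" and r r' :: real and m :: nat
  assumes M: "sigma_finite_measure M"
    and mf[measurable]: "f \<in> borel_measurable (lborel \<Otimes>\<^sub>M M)"
    and mg[measurable]: "g \<in> borel_measurable (lborel \<Otimes>\<^sub>M M)"
    and r: "r > 1" "r' > 1" "1 / r + 1 / r' = 1"
    and fint: "integrable (lborel \<Otimes>\<^sub>M M) (\<lambda>z. \<bar>f z\<bar> powr r)"
    and gint: "integrable (lborel \<Otimes>\<^sub>M M) (\<lambda>z. \<bar>g z\<bar> powr r')"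
  shows integrable_pairing: "integrable (lborel \<Otimes>\<^sub>M M) (\<lambda>z. f z * g z)"
    and integrable_shifted_pairing:
      "integrable lborel (\<lambda>\<tau>. LINT \<sigma>:{0..1 / real (Suc m)}|lborel. (LINT z|M. f (\<tau> - \<sigma>, z) * g (\<tau>, z)))"
    and eventually_shifted_pairing_le:
      "e > 0 \<Longrightarrow> \<forall>\<^sub>F m in sequentially. real (Suc m) *
          (LINT \<tau>|lborel. (LINT \<sigma>:{0..1 / real (Suc m)}|lborel. (LINT z|M. f (\<tau> - \<sigma>, z) * g (\<tau>, z))))
        \<le> (LINT z|(lborel \<Otimes>\<^sub>M M). f z * g z) + e"
proof -
  interpret M: sigma_finite_measure M by fact
  interpret LM: pair_sigma_finite lborel M ..
  interpret Q: pair_sigma_finite lborel "lborel \<Otimes>\<^sub>M M" ..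
  let ?P = "lborel \<Otimes>\<^sub>M M"
  let ?Q = "lborel \<Otimes>\<^sub>M (lborel \<Otimes>\<^sub>M M) :: (real \<times> real \<times> 'c) measure"
  define I where "I m \<sigma> = indicat_real {0..1 / real (Suc m)} \<sigma>" for m \<sigma>
  have I[measurable]: "I m \<in> borel_measurable borel" for m unfolding I_def by measurable
  have Inn: "I m \<sigma> \<ge> 0" for m \<sigma> unfolding I_def by simp
  have Iint: "(\<integral>\<^sup>+\<sigma>. ennreal (I m \<sigma>) \<partial>lborel) = ennreal (1 / real (Suc m))" for m
    unfolding I_def by (simp add: ennreal_indicator)
  define W where "W z = \<bar>f z\<bar> powr r / r" for z
  define V where "V z = \<bar>g z\<bar> powr r' / r'" for z
  have [measurable]: "W \<in> borel_measurable ?P" "V \<in> borel_measurable ?P"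
    unfolding W_def V_def by measurable
  have Wnn: "W z \<ge> 0" "V z \<ge> 0" for z using r by (auto simp: W_def V_def)
  have Wint: "integrable ?P W" and Vint: "integrable ?P V"
    unfolding W_def V_def using fint gint by auto
  have young: "\<bar>f z * g z'\<bar> \<le> W z + V z'" for z z'
    unfolding W_def V_def by (rule Young_signed[OF r])
  show int0: "integrable ?P (\<lambda>z. f z * g z)"
    by (rule Bochner_Integration.integrable_bound[OF Bochner_Integration.integrable_add[OF Wint Vint]])
       (use young Wnn in auto)
  \<comment> \<open>The three parts of Young's inequality are lifted to triples (\<tau>, \<sigma>,
    z), where Tonelli's theorem applies; \<open>I m\<close> restricts \<sigma> to
    [0, 1 / (m + 1)].\<close>
  define WQ where "WQ m = (\<lambda>(\<tau>, \<sigma>, z). I m \<sigma> * W (\<tau> - \<sigma>, z))" for m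
  define VQ where "VQ m = (\<lambda>(\<tau>, \<sigma> :: real, z). I m \<sigma> * V (\<tau>, z))" for m
  define HQ where "HQ m = (\<lambda>(\<tau>, \<sigma>, z). I m \<sigma> * (f (\<tau> - \<sigma>, z) * g (\<tau>, z)))" for m
  have [measurable]: "WQ m \<in> borel_measurable ?Q" "VQ m \<in> borel_measurable ?Q"
      "HQ m \<in> borel_measurable ?Q" for m
    unfolding WQ_def VQ_def HQ_def by measurable
  have nnQ: "(\<integral>\<^sup>+x. F x \<partial>?Q) = (\<integral>\<^sup>+\<tau>. \<integral>\<^sup>+\<sigma>. \<integral>\<^sup>+z. F (\<tau>, \<sigma>, z) \<partial>M \<partial>lborel \<partial>lborel)"
    if [measurable]: "F \<in> borel_measurable ?Q" for F
    by (simp add: LM.P.nn_integral_fst[symmetric] M.nn_integral_fst[symmetric])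
  have nnP: "(\<integral>\<^sup>+x. F x \<partial>?P) = (\<integral>\<^sup>+\<tau>. \<integral>\<^sup>+z. F (\<tau>, z) \<partial>M \<partial>lborel)"
    if [measurable]: "F \<in> borel_measurable ?P" for F
    by (simp add: M.nn_integral_fst[symmetric])
  have WQnn: "(\<integral>\<^sup>+x. ennreal (WQ m x) \<partial>?Q) = ennreal (1 / real (Suc m) * (LINT z|?P. W z))" for m
  proof -
    have "(\<integral>\<^sup>+x. ennreal (WQ m x) \<partial>?Q)
        = (\<integral>\<^sup>+\<tau>. \<integral>\<^sup>+\<sigma>. ennreal (I m \<sigma>) * (\<integral>\<^sup>+z. ennreal (W (\<tau> - \<sigma>, z)) \<partial>M) \<partial>lborel \<partial>lborel)"
      by (subst nnQ) (auto simp: WQ_def ennreal_mult Inn Wnn nn_integral_cmult intro!: nn_integral_cong)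
    also have "\<dots> = (\<integral>\<^sup>+\<sigma>. \<integral>\<^sup>+\<tau>. ennreal (I m \<sigma>) * (\<integral>\<^sup>+z. ennreal (W (\<tau> - \<sigma>, z)) \<partial>M) \<partial>lborel \<partial>lborel)"
      by (rule lborel_pair.Fubini') measurable
    also have "\<dots> = (\<integral>\<^sup>+\<sigma>. ennreal (I m \<sigma>) * (\<integral>\<^sup>+\<tau>. \<integral>\<^sup>+z. ennreal (W (\<tau> - \<sigma>, z)) \<partial>M \<partial>lborel) \<partial>lborel)"
      by (intro nn_integral_cong nn_integral_cmult) measurable
    also have "\<dots> = (\<integral>\<^sup>+\<sigma>. ennreal (I m \<sigma>) * (\<integral>\<^sup>+\<tau>. \<integral>\<^sup>+z. ennreal (W (\<tau>, z)) \<partial>M \<partial>lborel) \<partial>lborel)"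
    proof -
      have "(\<integral>\<^sup>+\<tau>. \<integral>\<^sup>+z. ennreal (W (\<tau> - \<sigma>, z)) \<partial>M \<partial>lborel) = (\<integral>\<^sup>+\<tau>. \<integral>\<^sup>+z. ennreal (W (\<tau>, z)) \<partial>M \<partial>lborel)"
        for \<sigma> :: real
        by (subst nn_integral_real_affine[where c=1 and t=\<sigma>]) auto
      then show ?thesis by simp
    qed
    also have "\<dots> = ennreal (1 / real (Suc m)) * (\<integral>\<^sup>+z. ennreal (W z) \<partial>?P)"
      by (simp add: nn_integral_multc Iint nnP)
    also have "(\<integral>\<^sup>+z. ennreal (W z) \<partial>?P) = ennreal (LINT z|?P. W z)"
      by (rule nn_integral_eq_integral[OF Wint]) (simp add: Wnn)
    finally show ?thesis
      by (subst ennreal_mult'') (auto intro!: Bochner_Integration.integral_nonneg simp: Wnn)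
  qed
  have VQnn: "(\<integral>\<^sup>+x. ennreal (VQ m x) \<partial>?Q) = ennreal (1 / real (Suc m) * (LINT z|?P. V z))" for m
  proof -
    have "(\<integral>\<^sup>+x. ennreal (VQ m x) \<partial>?Q)
        = (\<integral>\<^sup>+\<tau>. \<integral>\<^sup>+\<sigma>. ennreal (I m \<sigma>) * (\<integral>\<^sup>+z. ennreal (V (\<tau>, z)) \<partial>M) \<partial>lborel \<partial>lborel)"
      by (subst nnQ) (auto simp: VQ_def ennreal_mult Inn Wnn nn_integral_cmult intro!: nn_integral_cong)
    also have "\<dots> = ennreal (1 / real (Suc m)) * (\<integral>\<^sup>+z. ennreal (V z) \<partial>?P)"
      by (simp add: nn_integral_multc nn_integral_cmult Iint nnP)
    also have "(\<integral>\<^sup>+z. ennreal (V z) \<partial>?P) = ennreal (LINT z|?P. V z)"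
      by (rule nn_integral_eq_integral[OF Vint]) (simp add: Wnn)
    finally show ?thesis
      by (subst ennreal_mult'') (auto intro!: Bochner_Integration.integral_nonneg simp: Wnn)
  qed
  have WQ0: "WQ m x \<ge> 0" "VQ m x \<ge> 0" for m x
    by (auto simp: WQ_def VQ_def Inn Wnn split: prod.splits)
  have WQint: "integrable ?Q (WQ m)" and VQint: "integrable ?Q (VQ m)" for m
    by (rule integrableI_nonneg; simp add: WQ0 WQnn VQnn)+
  have HQle: "\<bar>HQ m x\<bar> \<le> WQ m x + VQ m x" for m x
    using young by (auto simp: HQ_def WQ_def VQ_def abs_mult Inn ring_distribs[symmetric]
      simp del: abs_mult intro!: mult_left_mono split: prod.splits)
       (metis Inn abs_mult abs_of_nonneg mult_left_mono)
  have HQint: "integrable ?Q (HQ m)" for m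
    by (rule Bochner_Integration.integrable_bound[OF Bochner_Integration.integrable_add[OF WQint[of m] VQint[of m]]])
       (use HQle WQ0 in \<open>auto intro: order_trans\<close>)
  have inner: "AE \<tau> in lborel. (LINT y|?P. HQ m (\<tau>, y))
      = (LINT \<sigma>:{0..1 / real (Suc m)}|lborel. (LINT z|M. f (\<tau> - \<sigma>, z) * g (\<tau>, z)))" for m
    using Q.AE_integrable_fst'[OF HQint[of m]]
  proof eventually_elim
    case (elim \<tau>)
    have "(LINT y|?P. HQ m (\<tau>, y)) = (LINT \<sigma>|lborel. (LINT z|M. HQ m (\<tau>, \<sigma>, z)))"
      by (rule LM.integral_fst'[symmetric, OF elim])
    then show ?case by (simp add: HQ_def I_def set_lebesgue_integral_def)
  qed
  have minner[measurable]: "(\<lambda>\<tau>. LINT \<sigma>:{0..1 / real (Suc m)}|lborel. (LINT z|M. f (\<tau> - \<sigma>, z) * g (\<tau>, z)))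
      \<in> borel_measurable lborel" for m
    unfolding set_lebesgue_integral_def by measurable
  show "integrable lborel (\<lambda>\<tau>. LINT \<sigma>:{0..1 / real (Suc m)}|lborel. (LINT z|M. f (\<tau> - \<sigma>, z) * g (\<tau>, z)))"
    by (rule integrable_cong_AE_imp[OF Q.integrable_fst'[OF HQint[of m]] minner])
       (use inner in \<open>auto elim: AE_mp\<close>)
  have val: "(LINT \<tau>|lborel. (LINT \<sigma>:{0..1 / real (Suc m)}|lborel. (LINT z|M. f (\<tau> - \<sigma>, z) * g (\<tau>, z))))
      = (LINT x|?Q. HQ m x)" for m
    by (subst Q.integral_fst'[symmetric, OF HQint], rule integral_cong_AE)
       (use inner[of m] minner[of m] Q.integrable_fst'[OF HQint[of m]] in \<open>auto elim!: eventually_mono simp del: of_nat_Suc\<close>)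
  show "\<forall>\<^sub>F m in sequentially. real (Suc m) *
          (LINT \<tau>|lborel. (LINT \<sigma>:{0..1 / real (Suc m)}|lborel. (LINT z|M. f (\<tau> - \<sigma>, z) * g (\<tau>, z))))
        \<le> (LINT z|?P. f z * g z) + e" if "e > 0"
  proof -
    \<comment> \<open>The defect in Young's inequality. Below, Y averages it over \<sigma>; the
      factor \<open>Suc m\<close> is the inverse of the step length.\<close>
    define YQ where "YQ m x = WQ m x + VQ m x - HQ m x" for m x
    have YQ0: "YQ m x \<ge> 0" for m x using HQle[of m x] by (simp add: YQ_def)
    have YQint: "integrable ?Q (YQ m)" for m
      unfolding YQ_def using WQint VQint HQint by auto
    have [measurable]: "YQ m \<in> borel_measurable ?Q" for m using YQint by auto
    define Y where "Y m = (\<lambda>(\<tau>, z). ennreal (real (Suc m)) * (\<integral>\<^sup>+\<sigma>. ennreal (YQ m (\<tau>, \<sigma>, z)) \<partial>lborel))" for m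
    have [measurable]: "Y m \<in> borel_measurable ?P" for m unfolding Y_def by measurable
    let ?w = "LINT z|?P. W z" and ?v = "LINT z|?P. V z" and ?fg = "LINT z|?P. f z * g z"
    have intWQ: "(LINT x|?Q. WQ m x) = 1 / real (Suc m) * ?w" for m
      by (rule integral_eq_nn_integral[THEN trans])
         (auto simp: WQ0 WQnn Wnn intro!: Bochner_Integration.integral_nonneg)
    have intVQ: "(LINT x|?Q. VQ m x) = 1 / real (Suc m) * ?v" for m
      by (rule integral_eq_nn_integral[THEN trans])
         (auto simp: WQ0 VQnn Wnn intro!: Bochner_Integration.integral_nonneg)
    define J where "J m = real (Suc m) * (LINT x|?Q. HQ m x)" for m
    \<comment> \<open>Only J depends on m, so a lower bound for the liminf of these integrals is an
      upper bound for J.\<close>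
    have Yint: "(\<integral>\<^sup>+x. Y m x \<partial>?P) = ennreal (?w + ?v - J m)" for m
    proof -
      have "(\<integral>\<^sup>+x. Y m x \<partial>?P)
          = (\<integral>\<^sup>+\<tau>. \<integral>\<^sup>+z. ennreal (real (Suc m)) * (\<integral>\<^sup>+\<sigma>. ennreal (YQ m (\<tau>, \<sigma>, z)) \<partial>lborel) \<partial>M \<partial>lborel)"
        by (subst nnP) (auto simp: Y_def)
      also have "\<dots> = ennreal (real (Suc m)) * (\<integral>\<^sup>+\<tau>. \<integral>\<^sup>+z. (\<integral>\<^sup>+\<sigma>. ennreal (YQ m (\<tau>, \<sigma>, z)) \<partial>lborel) \<partial>M \<partial>lborel)"
        by (simp add: nn_integral_cmult)
      also have "(\<integral>\<^sup>+\<tau>. \<integral>\<^sup>+z. (\<integral>\<^sup>+\<sigma>. ennreal (YQ m (\<tau>, \<sigma>, z)) \<partial>lborel) \<partial>M \<partial>lborel)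
          = (\<integral>\<^sup>+\<tau>. \<integral>\<^sup>+\<sigma>. \<integral>\<^sup>+z. ennreal (YQ m (\<tau>, \<sigma>, z)) \<partial>M \<partial>lborel \<partial>lborel)"
        by (intro nn_integral_cong LM.Fubini') measurable
      also have "\<dots> = (\<integral>\<^sup>+x. ennreal (YQ m x) \<partial>?Q)"
        by (subst nnQ) auto
      also have "\<dots> = ennreal (LINT x|?Q. YQ m x)"
        by (rule nn_integral_eq_integral[OF YQint]) (simp add: YQ0)
      also have "(LINT x|?Q. YQ m x) = 1 / real (Suc m) * (?w + ?v - J m)"
        unfolding YQ_def using WQint[of m] VQint[of m] HQint[of m]
        by (simp add: intWQ intVQ J_def field_simps del: of_nat_Suc)
      also have "ennreal (real (Suc m)) * ennreal \<dots> = ennreal (?w + ?v - J m)"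
        by (subst ennreal_mult'[symmetric]) (simp_all del: of_nat_Suc)
      finally show ?thesis .
    qed
    \<comment> \<open>Joint integrability of the r-th power yields local integrability of almost
      every time fibre: |f| is at most 1 + |f|^r, and 1 is integrable over bounded
      intervals.\<close>
    have locint: "AE z in M. \<forall>a b. set_integrable lborel {a..b} (\<lambda>t. h (t, z))"
      if [measurable]: "h \<in> borel_measurable ?P" and hi: "integrable ?P H"
        and le: "\<And>z. \<bar>h z\<bar> \<le> 1 + H z" for h H :: "real \<times> 'c \<Rightarrow> real"
    proof -
      have "integrable ?P (\<lambda>(t, z). H (t, z))" using hi by simp
      from LM.AE_integrable_snd[OF this] AE_space show ?thesis
      proof eventually_elim
        case (elim z)
        have hz[measurable]: "(\<lambda>t. h (t, z)) \<in> borel_measurable lborel"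
          by (rule measurable_compose[OF measurable_Pair2'[OF elim(2)]]) measurable
        show ?case
        proof (intro allI)
          fix a b :: real
          have "set_integrable lborel {a..b} (\<lambda>t. 1 + H (t, z))"
            using integrable_real_indicator[of "{a..b}" lborel] integrable_mult_indicator[OF _ elim(1), of "{a..b}"]
            by (intro set_integral_add(1)) (simp_all add: set_integrable_def emeasure_lborel_Icc_eq)
          then show "set_integrable lborel {a..b} (\<lambda>t. h (t, z))"
            by (rule set_integrable_bound) (auto simp: set_borel_measurable_def intro!: AE_I2 order_trans[OF le abs_ge_self])
        qed
      qed
    qed
    have lf: "AE z in M. \<forall>a b. set_integrable lborel {a..b} (\<lambda>t. f (t, z))"
      by (rule locint[OF mf fint]) (simp add: abs_le_one_plus_powr[OF r(1)])
    have lW: "AE z in M. \<forall>a b. set_integrable lborel {a..b} (\<lambda>t. W (t, z))"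
      by (rule locint[OF _ Wint]) (simp_all add: Wnn)
    have shift: "set_integrable lborel {0..c} (\<lambda>\<sigma>. h (t - \<sigma>))"
      if "\<forall>a b. set_integrable lborel {a..b} h" for h :: "real \<Rightarrow> real" and t c
    proof -
      have "integrable lborel (\<lambda>x. indicat_real {t - c..t} (t + (-1) * x) *\<^sub>R h (t + (-1) * x))"
        using that by (intro lborel_integrable_real_affine) (auto simp: set_integrable_def)
      also have "(\<lambda>x. indicat_real {t - c..t} (t + (-1) * x) *\<^sub>R h (t + (-1) * x)) = (\<lambda>x. indicat_real {0..c} x *\<^sub>R h (t - x))"
        by (auto simp: indicator_def)
      finally show ?thesis by (simp add: set_integrable_def)
    qed
    have lfW: "AE \<tau> in lborel. AE z in M. (\<forall>a b. set_integrable lborel {a..b} (\<lambda>t. f (t, z)))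
        \<and> (\<forall>a b. set_integrable lborel {a..b} (\<lambda>t. W (t, z)))"
      using lf lW by auto
    have avg: "AE \<tau> in lborel. AE z in M.
        (\<lambda>m. real (Suc m) * (LINT \<sigma>:{0..1 / real (Suc m)}|lborel. h (\<tau> - \<sigma>, z))) \<longlonglongrightarrow> h (\<tau>, z)"
      if "h \<in> borel_measurable ?P" "AE z in M. \<forall>a b. set_integrable lborel {a..b} (\<lambda>t. h (t, z))" for h
      using AE_average_tendsto_product[OF M that(1) _ that(2), of "-1"] by simp
    have "AE \<tau> in lborel. AE z in M. (\<lambda>m. Y m (\<tau>, z)) \<longlonglongrightarrow> ennreal (W (\<tau>, z) + V (\<tau>, z) - f (\<tau>, z) * g (\<tau>, z))"
      using avg[OF mf lf] avg[OF _ lW, simplified] lfW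
    proof eventually_elim
      case (elim \<tau>)
      show ?case using elim
      proof eventually_elim
        case (elim z)
        have sf: "set_integrable lborel {0..1 / real (Suc m)} (\<lambda>\<sigma>. f (\<tau> - \<sigma>, z))"
          and sW: "set_integrable lborel {0..1 / real (Suc m)} (\<lambda>\<sigma>. W (\<tau> - \<sigma>, z))" for m
          using shift elim(3) by auto
        let ?af = "\<lambda>m. real (Suc m) * (LINT \<sigma>:{0..1 / real (Suc m)}|lborel. f (\<tau> - \<sigma>, z))"
        let ?aW = "\<lambda>m. real (Suc m) * (LINT \<sigma>:{0..1 / real (Suc m)}|lborel. W (\<tau> - \<sigma>, z))"
        have Ie: "integrable lborel (I m)" "(LINT \<sigma>|lborel. I m \<sigma>) = 1 / real (Suc m)" for m
          unfolding I_def using integrable_real_indicator[of "{0..1 / real (Suc m)}" lborel] by auto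
        have "Y m (\<tau>, z) = ennreal (?aW m + V (\<tau>, z) - ?af m * g (\<tau>, z))" for m
        proof -
          have eq: "YQ m (\<tau>, \<sigma>, z) = I m \<sigma> * W (\<tau> - \<sigma>, z) + I m \<sigma> * V (\<tau>, z) - I m \<sigma> * f (\<tau> - \<sigma>, z) * g (\<tau>, z)" for \<sigma>
            by (simp add: YQ_def WQ_def VQ_def HQ_def)
          have i1: "integrable lborel (\<lambda>\<sigma>. I m \<sigma> * W (\<tau> - \<sigma>, z))" "integrable lborel (\<lambda>\<sigma>. I m \<sigma> * f (\<tau> - \<sigma>, z))"
            using sf sW by (auto simp: set_integrable_def I_def)
          have i2: "integrable lborel (\<lambda>\<sigma>. YQ m (\<tau>, \<sigma>, z))"
            unfolding eq using i1 Ie by auto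
          have "(\<integral>\<^sup>+\<sigma>. ennreal (YQ m (\<tau>, \<sigma>, z)) \<partial>lborel) = ennreal (LINT \<sigma>|lborel. YQ m (\<tau>, \<sigma>, z))"
            by (rule nn_integral_eq_integral[OF i2]) (simp add: YQ0)
          also have "(LINT \<sigma>|lborel. YQ m (\<tau>, \<sigma>, z)) = (LINT \<sigma>|lborel. I m \<sigma> * W (\<tau> - \<sigma>, z))
              + 1 / real (Suc m) * V (\<tau>, z) - (LINT \<sigma>|lborel. I m \<sigma> * f (\<tau> - \<sigma>, z)) * g (\<tau>, z)"
            unfolding eq using i1 Ie by simp
          finally show ?thesis
            unfolding Y_def prod.case
            by (simp only:, subst ennreal_mult'[symmetric])
               (simp_all add: set_lebesgue_integral_def I_def algebra_simps del: of_nat_Suc)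
        qed
        moreover have "(\<lambda>m. ennreal (?aW m + V (\<tau>, z) - ?af m * g (\<tau>, z)))
            \<longlonglongrightarrow> ennreal (W (\<tau>, z) + V (\<tau>, z) - f (\<tau>, z) * g (\<tau>, z))"
          using elim(1,2) by (intro tendsto_ennrealI tendsto_intros) simp_all
        ultimately show ?case by simp
      qed
    qed
    then have lim: "AE \<tau> in lborel. AE z in M.
        ennreal (W (\<tau>, z) + V (\<tau>, z) - f (\<tau>, z) * g (\<tau>, z)) \<le> liminf (\<lambda>m. Y m (\<tau>, z))"
      by (elim eventually_mono) (simp add: lim_imp_Liminf)
    have "ennreal (?w + ?v - ?fg) = ennreal (LINT z|?P. W z + V z - f z * g z)"
      using Wint Vint int0 by simp
    also have "\<dots> = (\<integral>\<^sup>+z. ennreal (W z + V z - f z * g z) \<partial>?P)"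
      by (rule nn_integral_eq_integral[symmetric])
         (use Wint Vint int0 young in \<open>auto simp: abs_le_iff\<close>)
    also have "\<dots> = (\<integral>\<^sup>+\<tau>. \<integral>\<^sup>+z. ennreal (W (\<tau>, z) + V (\<tau>, z) - f (\<tau>, z) * g (\<tau>, z)) \<partial>M \<partial>lborel)"
      by (rule nnP) measurable
    also have "\<dots> \<le> (\<integral>\<^sup>+\<tau>. \<integral>\<^sup>+z. liminf (\<lambda>m. Y m (\<tau>, z)) \<partial>M \<partial>lborel)"
      by (rule nn_integral_mono_AE) (use lim in \<open>auto elim!: eventually_mono intro!: nn_integral_mono_AE\<close>)
    also have "\<dots> = (\<integral>\<^sup>+x. liminf (\<lambda>m. Y m x) \<partial>?P)"
      by (rule nnP[symmetric]) measurable
    also have "\<dots> \<le> liminf (\<lambda>m. \<integral>\<^sup>+x. Y m x \<partial>?P)"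
      by (rule nn_integral_liminf) measurable
    finally have fatou: "ennreal (?w + ?v - ?fg) \<le> liminf (\<lambda>m. ennreal (?w + ?v - J m))"
      by (simp only: Yint)
    have pos: "?w + ?v - ?fg \<ge> 0"
    proof -
      have "0 \<le> (LINT z|?P. W z + V z - f z * g z)"
        by (rule Bochner_Integration.integral_nonneg) (use young in \<open>auto simp: abs_le_iff\<close>)
      then show ?thesis using Wint Vint int0 by simp
    qed
    show ?thesis
    \<comment> \<open>\<open>ennreal\<close> sends negative numbers to 0, so the bound can be read
      off \<open>fatou\<close> only if this number is nonnegative. Otherwise
      \<open>J m \<le> ?w + ?v\<close> is already enough.\<close>
    proof (cases "?w + ?v - ?fg - e < 0")
      case True
      have "J m \<le> ?w + ?v" for m
      proof -
        have "0 \<le> (LINT x|?Q. YQ m x)" by (rule Bochner_Integration.integral_nonneg) (simp add: YQ0)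
        also have "(LINT x|?Q. YQ m x) = 1 / real (Suc m) * (?w + ?v - J m)"
          unfolding YQ_def using WQint[of m] VQint[of m] HQint[of m]
          by (simp add: intWQ intVQ J_def field_simps del: of_nat_Suc)
        finally show ?thesis by (simp add: zero_le_mult_iff zero_le_divide_iff del: of_nat_Suc)
      qed
      then have "J m \<le> ?fg + e" for m using True by (smt (verit))
      then show ?thesis by (simp add: val J_def del: of_nat_Suc)
    next
      case False
      then have "ennreal (?w + ?v - ?fg - e) < ennreal (?w + ?v - ?fg)"
        using that by (intro ennreal_lessI) auto
      also note fatou
      finally have "\<forall>\<^sub>F m in sequentially. ennreal (?w + ?v - ?fg - e) < ennreal (?w + ?v - J m)"
        by (rule less_LiminfD)
      then show ?thesis
      proof eventually_elim
        case (elim m)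
        then have "?w + ?v - ?fg - e < ?w + ?v - J m"
          using False by (simp add: ennreal_less_iff)
        then show ?case by (simp add: val J_def del: of_nat_Suc)
      qed
    qed
  qed
qed

section \<open>The singular kernel and pointwise inequalities\<close>

lemma two_power_bracket:
  fixes x :: real
  assumes "1 \<le> x"
  obtains j where "2 ^ j \<le> x" "x < 2 ^ Suc j"
proof -
  have "\<exists>j. x < 2 ^ Suc j"
    using real_arch_pow[of 2 x] by (metis one_less_numeral_iff power_strict_increasing_iff
        less_trans lessI semiring_norm(76))
  define j where "j = (LEAST j. x < 2 ^ Suc j)"
  have j: "x < 2 ^ Suc j" unfolding j_def by (rule LeastI_ex) fact
  have "2 ^ j \<le> x"
  proof (cases j)
    case (Suc i)
    then have "\<not> x < 2 ^ Suc i" unfolding j_def by (metis lessI not_less_Least)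
    then show ?thesis using Suc by simp
  qed (use assms in simp)
  with j show ?thesis using that by blast
qed

text \<open>Dyadic annuli around the radius \<open>N / L\<close> at which the minimum changes.\<close>
lemma truncated_kernel_bound:
  fixes p s :: real
  assumes "0 < s" "s < 1" "1 < p"
  obtains C where "C > 0"
    "\<And>L N. L > 0 \<Longrightarrow> N > 0 \<Longrightarrow>
      (\<integral>\<^sup>+w. ennreal (min (L * norm w) N powr p / norm (w :: 'a::euclidean_space) powr (real DIM('a) + p * s)) \<partial>lborel)
      \<le> ennreal (C * L powr (p * s) * N powr (p - p * s))"
proof -
  define n where "n = real DIM('a)"
  define a where "a = n + p * s"
  define \<omega> where "\<omega> = unit_ball_vol n"
  \<comment> \<open>y and y' are the ratios of the geometric series over the annuli outside and
    inside the radius N / L. The first is below 1 since p s > 0, the second since p s < p.\<close>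
  define y where "y = 2 powr (- (p * s))"
  define y' where "y' = 2 powr (- (p - p * s))"
  have ps: "0 < p * s" "p * s < p" using assms by (auto simp: mult_less_cancel_left2)
  have y: "0 < y" "y < 1" "0 < y'" "y' < 1"
    using ps by (auto simp: y_def y'_def powr_less_one)
  have npos: "n > 0" "\<omega> > 0" "a > 0" using ps by (auto simp: n_def \<omega>_def a_def add_pos_pos)
  define C where "C = \<omega> * 2 powr n / (1 - y) + \<omega> * 2 powr (n + a) / (1 - y')"
  have Cpos: "C > 0" using y npos by (auto simp: C_def intro!: add_pos_pos divide_pos_pos)
  have "(\<integral>\<^sup>+w. ennreal (min (L * norm w) N powr p / norm (w :: 'a) powr a) \<partial>lborel)
      \<le> ennreal (C * L powr (p * s) * N powr (p - p * s))" if LN: "L > 0" "N > 0" for L N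
  proof -
    define \<rho> where "\<rho> = N / L"
    have lam: "\<rho> > 0" using LN by (simp add: \<rho>_def)
    \<comment> \<open>A j bounds the integrand on the annulus from \<rho> 2^j to \<rho> 2^(j + 1), B
      j on the one from \<rho> 2^(-j - 1) to \<rho> 2^(-j). Enlarging the annuli to the balls
      \<open>?bA\<close> and \<open>?bB\<close> costs only a constant.\<close>
    define A where "A j = N powr p * (\<rho> * 2 powr real j) powr (- a)" for j
    define B where "B j = (N * 2 powr (- real j)) powr p * (\<rho> * 2 powr (- real j - 1)) powr (- a)" for j
    have AB0: "A j \<ge> 0" "B j \<ge> 0" for j by (auto simp: A_def B_def)
    let ?bA = "\<lambda>j. ball (0::'a) (\<rho> * 2 powr (real j + 1))"
    let ?bB = "\<lambda>j. ball (0::'a) (\<rho> * 2 powr (1 - real j))"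
    have term_le: "g j \<le> (\<Sum>j. g j)" for g :: "nat \<Rightarrow> ennreal" and j
      using sum_le_suminf[of g "{j}"] by simp
    have pw: "ennreal (min (L * norm w) N powr p / norm w powr a) \<le>
        (\<Sum>j. ennreal (A j) * indicator (?bA j) w) + (\<Sum>j. ennreal (B j) * indicator (?bB j) w)" for w :: 'a
    proof (cases "w = 0")
      case False
      then have w: "norm w > 0" by simp
      show ?thesis
      proof (cases "norm w \<ge> \<rho>")
        case True
        then have "1 \<le> norm w / \<rho>" using lam by simp
        from two_power_bracket[OF this] obtain j where j: "2 ^ j \<le> norm w / \<rho>" "norm w / \<rho> < 2 ^ Suc j" .
        have j1: "\<rho> * 2 powr real j \<le> norm w" and j2: "norm w < \<rho> * 2 powr (real j + 1)"
          using j lam by (auto simp: powr_realpow powr_add field_simps)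
        have "min (L * norm w) N powr p / norm w powr a \<le> A j"
        proof -
          have "min (L * norm w) N powr p \<le> N powr p"
            using LN w ps by (intro powr_mono2) auto
          moreover have "norm w powr (- a) \<le> (\<rho> * 2 powr real j) powr (- a)"
            using j1 npos lam by (intro powr_mono2') auto
          ultimately show ?thesis unfolding A_def
            by (simp add: powr_minus divide_inverse mult_mono)
        qed
        then have "ennreal (min (L * norm w) N powr p / norm w powr a) \<le> ennreal (A j) * indicator (?bA j) w"
          using j2 by (auto intro: ennreal_leI)
        also have "\<dots> \<le> (\<Sum>j. ennreal (A j) * indicator (?bA j) w)"
          by (rule term_le)
        finally show ?thesis by (simp add: add_increasing2)
      next
        case False
        then have "1 \<le> \<rho> / norm w" using w by simp
        from two_power_bracket[OF this] obtain j where j: "2 ^ j \<le> \<rho> / norm w" "\<rho> / norm w < 2 ^ Suc j" .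
        have j1: "norm w \<le> \<rho> * 2 powr (- real j)" and j2: "\<rho> * 2 powr (- real j - 1) \<le> norm w"
          using j w by (auto simp: powr_realpow powr_minus powr_diff field_simps)
        have j3: "norm w < \<rho> * 2 powr (1 - real j)"
          using j1 lam w by (auto simp: powr_diff powr_minus field_simps)
        have "min (L * norm w) N powr p / norm w powr a \<le> B j"
        proof -
          have "L * norm w \<le> N * 2 powr (- real j)"
            using j1 LN by (simp add: \<rho>_def field_simps)
          then have "min (L * norm w) N powr p \<le> (N * 2 powr (- real j)) powr p"
            using LN w ps by (intro powr_mono2) auto
          moreover have "norm w powr (- a) \<le> (\<rho> * 2 powr (- real j - 1)) powr (- a)"
            using j2 npos lam by (intro powr_mono2') auto
          ultimately show ?thesis unfolding B_def
            by (simp add: powr_minus divide_inverse mult_mono)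
        qed
        then have "ennreal (min (L * norm w) N powr p / norm w powr a) \<le> ennreal (B j) * indicator (?bB j) w"
          using j3 by (auto intro: ennreal_leI)
        also have "\<dots> \<le> (\<Sum>j. ennreal (B j) * indicator (?bB j) w)"
          by (rule term_le)
        finally show ?thesis by (simp add: add_increasing)
      qed
    qed (use assms in auto)
    have em: "emeasure lborel (ball (0::'a) r) = ennreal (\<omega> * r powr n)" if "r > 0" for r
      using that by (simp add: emeasure_ball \<omega>_def n_def powr_realpow)
    define c where "c = L powr (p * s) * N powr (p - p * s)"
    \<comment> \<open>By scaling, all dependence on L and N sits in this common factor of both
      series.\<close>
    have cc: "N powr p * \<rho> powr (- a) * \<rho> powr n = c"
    proof -
      have "N powr p * \<rho> powr (- a) * \<rho> powr n = N powr p * \<rho> powr (- (p * s))"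
        by (simp add: a_def mult.assoc flip: powr_add)
      also have "\<dots> = c" unfolding c_def \<rho>_def using LN
        by (simp add: powr_divide powr_minus powr_diff field_simps)
      finally show ?thesis .
    qed
    have Aint: "A j * (\<omega> * (\<rho> * 2 powr (real j + 1)) powr n) = (c * \<omega> * 2 powr n) * y ^ j" for j
    proof -
      have "A j * (\<omega> * (\<rho> * 2 powr (real j + 1)) powr n)
          = (N powr p * \<rho> powr (- a) * \<rho> powr n) * \<omega> * (2 powr (- (real j * a)) * 2 powr ((real j + 1) * n))"
        unfolding A_def using lam by (simp add: powr_mult powr_powr)
      also have "2 powr (- (real j * a)) * 2 powr ((real j + 1) * n) = 2 powr n * y ^ j"
        by (simp add: y_def a_def powr_powr algebra_simps flip: powr_add powr_realpow)
      finally show ?thesis by (simp add: cc)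
    qed
    have Bint: "B j * (\<omega> * (\<rho> * 2 powr (1 - real j)) powr n) = (c * \<omega> * 2 powr (n + a)) * y' ^ j" for j
    proof -
      have "B j * (\<omega> * (\<rho> * 2 powr (1 - real j)) powr n)
          = (N powr p * \<rho> powr (- a) * \<rho> powr n) * \<omega> * (2 powr (- (real j * p)) * 2 powr ((real j + 1) * a) * 2 powr ((1 - real j) * n))"
        unfolding B_def using lam LN by (simp add: powr_mult powr_powr algebra_simps)
      also have "2 powr (- (real j * p)) * 2 powr ((real j + 1) * a) * 2 powr ((1 - real j) * n) = 2 powr (n + a) * y' ^ j"
        by (simp add: y'_def a_def powr_powr algebra_simps flip: powr_add powr_realpow)
      finally show ?thesis by (simp add: cc)
    qed
    have geo: "(\<Sum>j. ennreal (d * z ^ j)) = ennreal (d / (1 - z))" if "d \<ge> 0" "0 < z" "z < 1" for d z :: real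
    proof -
      have "(\<lambda>j. d * z ^ j) sums (d * (1 / (1 - z)))"
        using that by (intro sums_mult geometric_sums) auto
      then show ?thesis using that by (intro suminf_ennreal_eq) simp_all
    qed
    have c0: "c \<ge> 0" by (simp add: c_def)
    have "(\<integral>\<^sup>+w. ennreal (min (L * norm w) N powr p / norm (w :: 'a) powr a) \<partial>lborel)
        \<le> (\<integral>\<^sup>+w. (\<Sum>j. ennreal (A j) * indicator (?bA j) w) + (\<Sum>j. ennreal (B j) * indicator (?bB j) w) \<partial>lborel)"
      by (intro nn_integral_mono pw)
    also have "\<dots> = (\<Sum>j. ennreal (A j) * emeasure lborel (?bA j)) + (\<Sum>j. ennreal (B j) * emeasure lborel (?bB j))"
    proof -
      have ball_sets[measurable]: "ball (0::'a) r \<in> sets lborel" for r by simp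
      have "(\<integral>\<^sup>+w. (\<Sum>j. ennreal (D j) * indicator (ball (0::'a) (r j)) w) \<partial>lborel)
          = (\<Sum>j. ennreal (D j) * emeasure lborel (ball (0::'a) (r j)))" for D r :: "nat \<Rightarrow> real"
        by (subst nn_integral_suminf) (simp_all add: nn_integral_cmult_indicator)
      then show ?thesis by (subst nn_integral_add) simp_all
    qed
    also have "\<dots> = (\<Sum>j. ennreal ((c * \<omega> * 2 powr n) * y ^ j)) + (\<Sum>j. ennreal ((c * \<omega> * 2 powr (n + a)) * y' ^ j))"
      using lam by (simp add: em AB0 Aint Bint flip: ennreal_mult')
    also have "\<dots> = ennreal (c * \<omega> * 2 powr n / (1 - y)) + ennreal (c * \<omega> * 2 powr (n + a) / (1 - y'))"
      by (subst (1 2) geo) (use y c0 npos in auto)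
    also have "\<dots> = ennreal (C * c)"
      using y c0 npos by (subst ennreal_plus[symmetric]) (auto simp: C_def field_simps intro!: divide_nonneg_pos)
    finally show ?thesis by (simp add: c_def mult.assoc)
  qed
  then show ?thesis using that[OF Cpos] unfolding a_def n_def by blast
qed

section \<open>Signed powers and increments of truncations\<close>

lemma abs_signed_pow: "\<bar>signed_pow r v\<bar> = \<bar>v\<bar> powr r"
  by (cases "v = 0") (auto simp: signed_pow_def abs_mult powr_diff)

lemma signed_pow_pos: "v \<ge> 0 \<Longrightarrow> signed_pow r v = v powr r"
  using abs_signed_pow[of r v] by (simp add: signed_pow_def)

lemma signed_pow_minus: "signed_pow r (- v) = - signed_pow r v"
  by (simp add: signed_pow_def)

lemma signed_pow_neg: "v \<le> 0 \<Longrightarrow> signed_pow r v = - ((- v) powr r)"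
  using signed_pow_pos[of "- v" r] by (simp add: signed_pow_minus)

lemma borel_measurable_signed_pow[measurable]: "signed_pow r \<in> borel_measurable borel"
  unfolding signed_pow_def by measurable

lemma signed_pow_mono:
  assumes "r > 0" "u \<le> v"
  shows "signed_pow r u \<le> signed_pow r v"
proof -
  consider "0 \<le> u" | "u \<le> 0" "0 \<le> v" | "v \<le> 0" by linarith
  then show ?thesis
  proof cases
    case 1
    then show ?thesis using assms by (simp add: signed_pow_pos powr_mono2)
  next
    case 2
    then show ?thesis by (simp add: signed_pow_pos signed_pow_neg order_trans[of _ 0])
  next
    case 3
    then show ?thesis using assms by (simp add: signed_pow_neg powr_mono2)
  qed
qed

text \<open>Testing the energy with the truncation \<open>(b - u)\<^sub>+\<close> costs at most the energy of the barrier \<open>b\<close>.\<close>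
lemma truncation_energy_le:
  fixes p b1 b2 u1 u2 :: real
  assumes p: "p > 1"
  shows "signed_pow (p - 1) (u1 - u2) * (max 0 (b1 - u1) - max 0 (b2 - u2)) \<le> \<bar>b1 - b2\<bar> powr p"
proof -
  \<comment> \<open>It suffices to treat the case in which the first truncation is the larger one:
    exchanging the two points changes the sign of both factors.\<close>
  have main: "signed_pow (p - 1) (u1 - u2) * (max 0 (b1 - u1) - max 0 (b2 - u2)) \<le> \<bar>b1 - b2\<bar> powr p"
    if less: "max 0 (b2 - u2) < max 0 (b1 - u1)" for b1 b2 u1 u2 :: real
  proof (cases "u1 - u2 \<le> 0")
    case True
    then have "signed_pow (p - 1) (u1 - u2) * (max 0 (b1 - u1) - max 0 (b2 - u2)) \<le> 0"
      using less by (intro mult_nonpos_nonneg) (auto simp: signed_pow_neg)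
    then show ?thesis by (rule order_trans) simp
  next
    case False
    \<comment> \<open>The larger truncation is positive, hence b1 - u1 exceeds b2 - u2. Together
      with u1 > u2 this bounds both the increment of u and that of the truncation by b1 -
      b2.\<close>
    have le: "max 0 (b1 - u1) - max 0 (b2 - u2) \<le> b1 - b2" "u1 - u2 \<le> b1 - b2"
      using less False by (auto simp: max_def split: if_splits)
    have pos: "b1 - b2 > 0" using False le by linarith
    have "signed_pow (p - 1) (u1 - u2) * (max 0 (b1 - u1) - max 0 (b2 - u2))
        \<le> (b1 - b2) powr (p - 1) * (b1 - b2)"
      using False le less p by (intro mult_mono) (auto simp: signed_pow_pos intro!: powr_mono2)
    also have "\<dots> = \<bar>b1 - b2\<bar> powr p"
      using pos by (simp add: powr_diff)
    finally show ?thesis .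
  qed
  consider "max 0 (b2 - u2) < max 0 (b1 - u1)" | "max 0 (b1 - u1) < max 0 (b2 - u2)"
    | "max 0 (b2 - u2) = max 0 (b1 - u1)" by linarith
  then show ?thesis
  proof cases
    case 2
    from main[OF 2] show ?thesis
      using signed_pow_minus[of "p - 1" "u1 - u2"] by (simp add: abs_minus_commute algebra_simps)
  qed (use main in auto)
qed

text \<open>With u2 at or above l the second truncation vanishes. The product is minus
  \<open>(u2 - u1) powr (p - 1)\<close> times \<open>l - u1\<close>, and both bases are at least the
  gap l - l'. All coercivity of the nonlocal term that is used later comes from here.\<close>

lemma truncation_energy_coercive:
  fixes p l l' u1 u2 :: real
  assumes p: "p > 1" and "u1 \<le> l'" "l' \<le> l" "l \<le> u2"
  shows "signed_pow (p - 1) (u1 - u2) * (max 0 (l - u1) - max 0 (l - u2)) \<le> - ((l - l') powr p)"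
proof (cases "l = l'")
  case True
  have "signed_pow (p - 1) (u1 - u2) * (max 0 (l - u1) - max 0 (l - u2)) \<le> 0"
    using assms by (intro mult_nonpos_nonneg) (auto simp: signed_pow_neg)
  with True show ?thesis by simp
next
  case False
  have "(l - l') powr p = (l - l') powr (p - 1) * (l - l')"
    using False assms by (simp add: powr_diff)
  also have "\<dots> \<le> (u2 - u1) powr (p - 1) * (l - u1)"
    using assms by (intro mult_mono powr_mono2) auto
  finally show ?thesis
    using assms by (cases "u2 = l") (auto simp: signed_pow_neg max_def)
qed

section \<open>The Bregman distance of the power primitive\<close>

definition pow_primitive :: "real \<Rightarrow> real \<Rightarrow> real" where
  "pow_primitive q v = \<bar>v\<bar> powr (q + 1) / (q + 1)"

text \<open>The Bregman distance of \<open>|v|\<^sup>q\<^sup>+\<^sup>1 / (q + 1)\<close>, i.e. \<open>\<integral> (b - a)\<^sub>+ d(|a|\<^sup>q\<^sup>-\<^sup>1 a)\<close> over \<open>a \<ge> u\<close>.\<close>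
definition bregman :: "real \<Rightarrow> real \<Rightarrow> real \<Rightarrow> real" where
  "bregman q b u = (if u < b
     then pow_primitive q b - pow_primitive q u - signed_pow q u * (b - u) else 0)"

text \<open>This is convexity of \<open>pow_primitive q\<close>, read off Young's inequality with
  exponents (q + 1) / q and q + 1 rather than from derivatives, so that the origin is no special
  case.\<close>

lemma pow_primitive_gradient:
  assumes q: "q > 0"
  shows "pow_primitive q x - pow_primitive q y \<le> signed_pow q x * (x - y)"
proof -
  have xx: "signed_pow q x * x = \<bar>x\<bar> powr (q + 1)"
    by (cases "x = 0") (auto simp: signed_pow_def powr_diff powr_add abs_if)
  have "signed_pow q x * y \<le> \<bar>x\<bar> powr q * \<bar>y\<bar>"
    by (metis abs_ge_self abs_mult abs_signed_pow)
  also have "\<dots> \<le> (\<bar>x\<bar> powr q) powr ((q + 1) / q) / ((q + 1) / q) + \<bar>y\<bar> powr (q + 1) / (q + 1)"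
    using q by (intro Youngs_inequality) (auto simp: field_simps)
  also have "\<dots> = q * \<bar>x\<bar> powr (q + 1) / (q + 1) + \<bar>y\<bar> powr (q + 1) / (q + 1)"
    using q by (simp add: powr_powr)
  finally have "signed_pow q x * y \<le> q * \<bar>x\<bar> powr (q + 1) / (q + 1) + \<bar>y\<bar> powr (q + 1) / (q + 1)" .
  moreover have "\<bar>x\<bar> powr (q + 1) / (q + 1) = \<bar>x\<bar> powr (q + 1) - q * \<bar>x\<bar> powr (q + 1) / (q + 1)"
    using q by (simp add: field_simps)
  ultimately show ?thesis
    unfolding pow_primitive_def right_diff_distrib xx by linarith
qed

lemma bregman_nonneg: "q > 0 \<Longrightarrow> 0 \<le> bregman q b u"
  using pow_primitive_gradient[of q u b] by (auto simp: bregman_def algebra_simps)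

text \<open>Replacing u by min u b leaves the Bregman distance unchanged, and the gradient
  inequality at min u1 b applies. Undoing the replacement is free for u2, since the factor b - min
  u2 b is 0 where u2 > b, and it has the right sign for u1, since that factor is nonnegative. The
  truncation is taken at u2, the later of the two values in the application.\<close>

lemma bregman_convex:
  assumes q: "q > 0"
  shows "bregman q b u2 - bregman q b u1 \<le> - (max 0 (b - u2) * (signed_pow q u2 - signed_pow q u1))"
proof -
  define c1 c2 where "c1 = min u1 b" and "c2 = min u2 b"
  have B: "bregman q b u = pow_primitive q b - pow_primitive q (min u b) - signed_pow q (min u b) * (b - min u b)" for u
    by (auto simp: bregman_def min_def)
  have m: "max 0 (b - u2) = b - c2" by (auto simp: c2_def)
  have "pow_primitive q c1 - pow_primitive q c2 \<le> signed_pow q c1 * (c1 - c2)"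
    by (rule pow_primitive_gradient[OF q])
  moreover have "(b - c2) * signed_pow q u2 = (b - c2) * signed_pow q c2"
    by (auto simp: c2_def min_def)
  moreover have "(b - c2) * signed_pow q c1 \<le> (b - c2) * signed_pow q u1"
    using q by (intro mult_left_mono signed_pow_mono) (auto simp: c1_def c2_def)
  ultimately show ?thesis
    unfolding B m c1_def[symmetric] c2_def[symmetric] by (simp add: algebra_simps)
qed

lemma bregman_le:
  assumes "q > 0" "\<bar>b\<bar> \<le> M" "\<bar>u\<bar> \<le> M"
  shows "bregman q b u \<le> 3 * M powr (q + 1)"
proof (cases "u < b")
  case True
  have "M \<ge> 0" using assms by linarith
  have "pow_primitive q b \<le> \<bar>b\<bar> powr (q + 1)"
    using assms mult_left_mono[of 1 "q + 1" "\<bar>b\<bar> powr (q + 1)"] by (simp add: pow_primitive_def divide_le_eq)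
  also have "\<dots> \<le> M powr (q + 1)" using assms by (intro powr_mono2) auto
  finally have 1: "pow_primitive q b \<le> M powr (q + 1)" .
  have "- (signed_pow q u * (b - u)) \<le> \<bar>signed_pow q u\<bar> * \<bar>b - u\<bar>"
    by (metis abs_ge_minus_self abs_mult)
  also have "\<dots> \<le> M powr q * (2 * M)"
    using assms by (intro mult_mono) (auto simp: abs_signed_pow intro!: powr_mono2)
  also have "\<dots> = 2 * M powr (q + 1)"
    using \<open>M \<ge> 0\<close> by (simp add: powr_add)
  finally have 2: "- (signed_pow q u * (b - u)) \<le> 2 * M powr (q + 1)" .
  have "pow_primitive q u \<ge> 0" using assms by (simp add: pow_primitive_def)
  then show ?thesis using 1 2 True by (simp add: bregman_def)
qed (simp add: bregman_def)

lemma borel_measurable_bregman[measurable]: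
  assumes [measurable]: "f \<in> borel_measurable M" "g \<in> borel_measurable M"
  shows "(\<lambda>x. bregman q (f x) (g x)) \<in> borel_measurable M"
  unfolding bregman_def pow_primitive_def by measurable

lemma has_derivative_abs_powr:
  fixes x r :: real
  assumes "x \<noteq> 0"
  shows "((\<lambda>x. \<bar>x\<bar> powr r) has_real_derivative r * (\<bar>x\<bar> powr (r - 1) * sgn x)) (at x)"
proof (cases "x > 0")
  case True
  have "((\<lambda>x. x powr r) has_real_derivative r * (\<bar>x\<bar> powr (r - 1) * sgn x)) (at x)"
    using True by (auto intro!: derivative_eq_intros simp: powr_diff field_simps)
  then show ?thesis
    by (rule has_field_derivative_transform_within_open[where S="{0<..}"]) (use True in auto)
next
  case False
  then have "x < 0" using assms by simp
  have "((\<lambda>x. (- x) powr r) has_real_derivative r * (\<bar>x\<bar> powr (r - 1) * sgn x)) (at x)"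
    using \<open>x < 0\<close> by (auto intro!: derivative_eq_intros simp: powr_diff field_simps)
  then show ?thesis
    by (rule has_field_derivative_transform_within_open[where S="{..<0}"]) (use \<open>x < 0\<close> in auto)
qed

text \<open>On a level interval avoiding 0 the derivative q |x|^(q - 1) of
  \<open>signed_pow q\<close> is bounded below by a positive number; integrating twice from l' gives
  the square of the gap. Lowering u below l' only increases the Bregman distance.\<close>

lemma bregman_quadratic:
  assumes q: "q > 0" and ab: "0 < \<alpha> \<or> \<beta> < 0"
  obtains c where "c > 0" "\<And>l l' u. \<lbrakk>\<alpha> \<le> l'; l' \<le> l; l \<le> \<beta>; u \<le> l'\<rbrakk> \<Longrightarrow> c * (l - l')\<^sup>2 \<le> bregman q l u"
proof -
  \<comment> \<open>On one side of 0 the function |x|^(q - 1) is monotone, so its minimum over the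
    interval is attained at an end point. The factor 1 / 2 comes from the second
    integration.\<close>
  define c where "c = q * min (\<bar>\<alpha>\<bar> powr (q - 1)) (\<bar>\<beta>\<bar> powr (q - 1)) / 2"
  have nz: "x \<noteq> 0" if "\<alpha> \<le> x" "x \<le> \<beta>" for x using ab that by auto
  have der_ge: "2 * c \<le> q * \<bar>x\<bar> powr (q - 1)" if "\<alpha> \<le> x" "x \<le> \<beta>" for x
  proof -
    have "min (\<bar>\<alpha>\<bar> powr (q - 1)) (\<bar>\<beta>\<bar> powr (q - 1)) \<le> \<bar>x\<bar> powr (q - 1)"
    proof (cases "q \<ge> 1")
      case True
      have "min \<bar>\<alpha>\<bar> \<bar>\<beta>\<bar> \<le> \<bar>x\<bar>" using ab that by auto
      then consider "\<bar>\<alpha>\<bar> \<le> \<bar>x\<bar>" | "\<bar>\<beta>\<bar> \<le> \<bar>x\<bar>" by linarith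
      then show ?thesis using True
        by cases (auto simp: min_le_iff_disj intro!: powr_mono2)
    next
      case False
      have "\<bar>x\<bar> \<le> max \<bar>\<alpha>\<bar> \<bar>\<beta>\<bar>" using ab that by auto
      then consider "\<bar>x\<bar> \<le> \<bar>\<alpha>\<bar>" | "\<bar>x\<bar> \<le> \<bar>\<beta>\<bar>" by linarith
      then show ?thesis using False nz[OF that]
        by cases (auto simp: min_le_iff_disj intro!: powr_mono2')
    qed
    then show ?thesis using q by (simp add: c_def)
  qed
  have "c * (l - l')\<^sup>2 \<le> bregman q l u" if l: "\<alpha> \<le> l'" "l' \<le> l" "l \<le> \<beta>" "u \<le> l'" for l l' u
  proof -
    have dj: "(signed_pow q has_real_derivative q * \<bar>x\<bar> powr (q - 1)) (at x)" if "x \<noteq> 0" for x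
    proof -
      have "(q - 1) * (\<bar>x\<bar> powr (q - 1 - 1) * sgn x) * x + 1 * \<bar>x\<bar> powr (q - 1) = q * \<bar>x\<bar> powr (q - 1)"
        using that by (simp add: powr_diff abs_if sgn_if field_simps power2_eq_square)
      with DERIV_mult[OF has_derivative_abs_powr[OF that, of "q - 1"] DERIV_ident]
      have "((\<lambda>x. \<bar>x\<bar> powr (q - 1) * x) has_real_derivative q * \<bar>x\<bar> powr (q - 1)) (at x)"
        by simp
      then show ?thesis unfolding signed_pow_def[abs_def] .
    qed
    have dJ: "(pow_primitive q has_real_derivative signed_pow q x) (at x)" if "x \<noteq> 0" for x
    proof -
      have "(q + 1) * (\<bar>x\<bar> powr (q + 1 - 1) * sgn x) / (q + 1) = signed_pow q x"
        using that q by (simp add: signed_pow_def powr_diff abs_if sgn_if)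
      with DERIV_cdivide[OF has_derivative_abs_powr[OF that, of "q + 1"], of "q + 1"]
      have "((\<lambda>x. \<bar>x\<bar> powr (q + 1) / (q + 1)) has_real_derivative signed_pow q x) (at x)"
        by simp
      then show ?thesis unfolding pow_primitive_def[abs_def] .
    qed
    have mono_j: "2 * c * (x - l') \<le> signed_pow q x - signed_pow q l'" if "l' \<le> x" "x \<le> l" for x
    proof -
      have "signed_pow q l' - 2 * c * l' \<le> signed_pow q x - 2 * c * x"
      proof (rule DERIV_nonneg_imp_nondecreasing[OF that(1)])
        fix y assume y: "l' \<le> y" "y \<le> x"
        then have "((\<lambda>x. signed_pow q x - 2 * c * x) has_real_derivative q * \<bar>y\<bar> powr (q - 1) - 2 * c) (at y)"
          using nz[of y] l that by (auto intro!: derivative_eq_intros dj)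
        then show "\<exists>d. ((\<lambda>x. signed_pow q x - 2 * c * x) has_real_derivative d) (at y) \<and> 0 \<le> d"
          using der_ge[of y] y l that by auto
      qed
      then show ?thesis by (simp add: algebra_simps)
    qed
    let ?f = "\<lambda>x. pow_primitive q x - signed_pow q l' * x - c * (x - l')\<^sup>2"
    have "?f l' \<le> ?f l"
    proof (rule DERIV_nonneg_imp_nondecreasing[OF l(2)])
      fix y assume y: "l' \<le> y" "y \<le> l"
      then have "(?f has_real_derivative signed_pow q y - signed_pow q l' - 2 * c * (y - l')) (at y)"
        using nz[of y] l by (auto intro!: derivative_eq_intros dJ)
      then show "\<exists>d. (?f has_real_derivative d) (at y) \<and> 0 \<le> d"
        using mono_j[OF y] by auto
    qed
    then have 1: "c * (l - l')\<^sup>2 \<le> bregman q l l'"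
      using l(2) by (auto simp: bregman_def algebra_simps)
    have "bregman q l l' - bregman q l u \<le> - (max 0 (l - l') * (signed_pow q l' - signed_pow q u))"
      by (rule bregman_convex[OF q])
    also have "\<dots> \<le> 0" using signed_pow_mono[OF q l(4)] by simp
    finally show ?thesis using 1 by linarith
  qed
  moreover have "c > 0"
    if "\<alpha> \<noteq> 0" "\<beta> \<noteq> 0" using that q by (simp add: c_def)
  ultimately show ?thesis
  \<comment> \<open>An end point 0 would make c vanish, but then \<open>ab\<close> forces the
    interval to be empty and any positive constant will do.\<close>
  proof (cases "\<alpha> = 0 \<or> \<beta> = 0")
    case True
    then have "\<beta> < \<alpha>" using ab by auto
    then show ?thesis using that[of 1] by auto
  qed (use that in auto)
qed

section \<open>Energy inequality for truncations\<close>

lemma borel_measurable_fst_snd[measurable]: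
  "fst \<in> borel \<rightarrow>\<^sub>M (borel :: 'a::euclidean_space measure)"
  "snd \<in> borel \<rightarrow>\<^sub>M (borel :: 'b::euclidean_space measure)"
  by (auto intro!: borel_measurable_continuous_onI continuous_intros)

lemma borel_measurable_indicator_fst_snd:
  assumes [measurable]: "P \<in> sets borel"
  shows "(\<lambda>z :: 'a::euclidean_space \<times> 'b::euclidean_space. indicator P (fst z) :: ennreal) \<in> borel_measurable borel"
    and "(\<lambda>z :: 'b::euclidean_space \<times> 'a::euclidean_space. indicator P (snd z) :: ennreal) \<in> borel_measurable borel"
  by (rule measurable_compose[OF borel_measurable_fst_snd(1)] measurable_compose[OF borel_measurable_fst_snd(2)]; measurable)+

lemma nn_integral_lborel_prod:
  fixes f :: "'a::euclidean_space \<times> 'b::euclidean_space \<Rightarrow> ennreal"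
  assumes "f \<in> borel_measurable borel"
  shows "(\<integral>\<^sup>+z. f z \<partial>lborel) = (\<integral>\<^sup>+x. \<integral>\<^sup>+y. f (x, y) \<partial>lborel \<partial>lborel)"
proof -
  have "f \<in> borel_measurable (lborel \<Otimes>\<^sub>M lborel)" using assms by (simp add: lborel_prod)
  from lborel.nn_integral_fst[OF this] show ?thesis by (simp add: lborel_prod)
qed

lemma nn_integral_lborel_prod_swap:
  fixes f :: "'a::euclidean_space \<times> 'b::euclidean_space \<Rightarrow> ennreal"
  assumes "f \<in> borel_measurable borel"
  shows "(\<integral>\<^sup>+z. f z \<partial>lborel) = (\<integral>\<^sup>+y. \<integral>\<^sup>+x. f (x, y) \<partial>lborel \<partial>lborel)"
proof -
  have "f \<in> borel_measurable (lborel \<Otimes>\<^sub>M lborel)" using assms by (simp add: lborel_prod)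
  from lborel_pair.nn_integral_snd[of f] this show ?thesis by (simp add: lborel_prod)
qed

lemma nn_integral_lborel_translation:
  fixes f :: "'a::euclidean_space \<Rightarrow> ennreal"
  assumes [measurable]: "f \<in> borel_measurable borel"
  shows "(\<integral>\<^sup>+x. f (c + x) \<partial>lborel) = (\<integral>\<^sup>+x. f x \<partial>lborel)"
proof -
  have "(\<integral>\<^sup>+x. f x \<partial>lborel) = (\<integral>\<^sup>+x. f x \<partial>distr lborel borel ((+) c))"
    by (simp add: lborel_distr_plus)
  also have "\<dots> = (\<integral>\<^sup>+x. f (c + x) \<partial>lborel)"
    by (subst nn_integral_distr) auto
  finally show ?thesis ..
qed

text \<open>The variable not restricted by the indicator is integrated out first; translation
  invariance makes the result independent of the other point.\<close>

lemma nn_integral_radial_pairs: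
  fixes F :: "real \<Rightarrow> ennreal" and P :: "'a::euclidean_space set"
  assumes [measurable]: "F \<in> borel_measurable borel" "P \<in> sets borel"
  shows "(\<integral>\<^sup>+z. indicator P (fst z) * F (norm (fst z - snd z)) \<partial>lborel)
      = emeasure lborel P * (\<integral>\<^sup>+w. F (norm (w :: 'a)) \<partial>lborel)"
    and "(\<integral>\<^sup>+z. indicator P (snd z) * F (norm (fst z - snd z)) \<partial>lborel)
      = emeasure lborel P * (\<integral>\<^sup>+w. F (norm (w :: 'a)) \<partial>lborel)"
proof -
  have 1: "(\<integral>\<^sup>+y. F (norm (x - y)) \<partial>lborel) = (\<integral>\<^sup>+w. F (norm (w :: 'a)) \<partial>lborel)" for x :: 'a
  proof -
    have eq: "norm (x - y) = norm (- x + y)" for y by (simp add: norm_minus_commute)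
    show ?thesis unfolding eq by (rule nn_integral_lborel_translation[of "\<lambda>w. F (norm w)"]) measurable
  qed
  have 2: "(\<integral>\<^sup>+x. F (norm (x - y)) \<partial>lborel) = (\<integral>\<^sup>+w. F (norm (w :: 'a)) \<partial>lborel)" for y :: 'a
    using nn_integral_lborel_translation[of "\<lambda>w. F (norm w)" "- y"] by simp
  note [measurable] = borel_measurable_indicator_fst_snd[OF assms(2)]
  have "(\<integral>\<^sup>+z. indicator P (fst z) * F (norm (fst z - snd z)) \<partial>lborel)
      = (\<integral>\<^sup>+x. \<integral>\<^sup>+y. indicator P x * F (norm (x - y :: 'a)) \<partial>lborel \<partial>lborel)"
    by (subst nn_integral_lborel_prod) simp_all
  also have "\<dots> = (\<integral>\<^sup>+x. indicator P x * (\<integral>\<^sup>+y. F (norm (x - y :: 'a)) \<partial>lborel) \<partial>lborel)"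
    by (intro nn_integral_cong nn_integral_cmult) measurable
  also have "\<dots> = emeasure lborel P * (\<integral>\<^sup>+w. F (norm (w :: 'a)) \<partial>lborel)"
    unfolding 1 by (subst nn_integral_multc) simp_all
  finally show "(\<integral>\<^sup>+z. indicator P (fst z) * F (norm (fst z - snd z)) \<partial>lborel)
      = emeasure lborel P * (\<integral>\<^sup>+w. F (norm (w :: 'a)) \<partial>lborel)" .
  have "(\<integral>\<^sup>+z. indicator P (snd z) * F (norm (fst z - snd z)) \<partial>lborel)
      = (\<integral>\<^sup>+y. \<integral>\<^sup>+x. indicator P y * F (norm (x - y :: 'a)) \<partial>lborel \<partial>lborel)"
    by (subst nn_integral_lborel_prod_swap) simp_all
  also have "\<dots> = (\<integral>\<^sup>+y. indicator P y * (\<integral>\<^sup>+x. F (norm (x - y :: 'a)) \<partial>lborel) \<partial>lborel)"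
    by (intro nn_integral_cong nn_integral_cmult) measurable
  also have "\<dots> = emeasure lborel P * (\<integral>\<^sup>+w. F (norm (w :: 'a)) \<partial>lborel)"
    unfolding 2 by (subst nn_integral_multc) simp_all
  finally show "(\<integral>\<^sup>+z. indicator P (snd z) * F (norm (fst z - snd z)) \<partial>lborel)
      = emeasure lborel P * (\<integral>\<^sup>+w. F (norm (w :: 'a)) \<partial>lborel)" .
qed

lemma powr_add_le:
  fixes x y p :: real
  assumes "0 \<le> x" "0 \<le> y" "0 \<le> p"
  shows "(x + y) powr p \<le> 2 powr p * (x powr p + y powr p)"
proof -
  have "(x + y) powr p \<le> (2 * max x y) powr p" using assms by (intro powr_mono2) auto
  also have "\<dots> = 2 powr p * max x y powr p" using assms by (simp add: powr_mult)
  also have "max x y powr p \<le> x powr p + y powr p" by (simp add: max_def)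
  finally show ?thesis by simp
qed

text \<open>U and k are Borel versions of u and K whose bounds hold everywhere. The constant C of
  the truncated kernel is a parameter, so that thresholds can be chosen before U, k and the
  cylinder. The weak inequality is added only in \<open>nonlocal_problem\<close>, because its
  verification already uses integrability results of this locale.\<close>

locale nonlocal_kernel =
  fixes p q s \<Lambda> M C :: real
    and U :: "'a::euclidean_space \<times> real \<Rightarrow> real"
    and k :: "real \<Rightarrow> 'a \<Rightarrow> 'a \<Rightarrow> real"
    and x0 :: 'a and R a b :: real
  assumes p: "1 < p" and q: "0 < q" and s: "0 < s" "s < 1" and Lam: "1 \<le> \<Lambda>"
    and M: "0 < M" and R: "0 < R" and C: "0 < C"
    and U_meas[measurable]: "U \<in> borel_measurable borel"
    and U_le: "\<And>z. \<bar>U z\<bar> \<le> M"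
    and k_meas[measurable]: "(\<lambda>(t, x, y). k t x y) \<in> borel_measurable borel"
    and k_lower: "\<And>t x y. inverse \<Lambda> / norm (x - y) powr (real DIM('a) + p * s) \<le> k t x y"
    and k_upper: "\<And>t x y. k t x y \<le> \<Lambda> / norm (x - y) powr (real DIM('a) + p * s)"
    and truncated_kernel: "\<And>L N. L > 0 \<Longrightarrow> N > 0 \<Longrightarrow>
      (\<integral>\<^sup>+w. ennreal (min (L * norm w) N powr p / norm (w :: 'a) powr (real DIM('a) + p * s)) \<partial>lborel)
      \<le> ennreal (C * L powr (p * s) * N powr (p - p * s))"
    and local_energy: "(\<integral>\<^sup>+t\<in>{a..b}. (\<integral>\<^sup>+z\<in>ball x0 (2 * R) \<times> ball x0 (2 * R).
        ennreal (\<bar>U (fst z, t) - U (snd z, t)\<bar> powr p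
          / norm (fst z - snd z) powr (real DIM('a) + p * s)) \<partial>lborel) \<partial>lborel) < \<infinity>"
begin

abbreviation kap :: "'a \<times> 'a \<Rightarrow> real" where "kap z \<equiv> norm (fst z - snd z) powr (real DIM('a) + p * s)"

abbreviation dU :: "real \<Rightarrow> 'a \<times> 'a \<Rightarrow> real" where "dU t z \<equiv> U (fst z, t) - U (snd z, t)"

lemma k_nonneg: "0 \<le> k t x y"
proof -
  have "0 \<le> inverse \<Lambda> / norm (x - y) powr (real DIM('a) + p * s)" using Lam by simp
  then show ?thesis using k_lower order_trans by blast
qed

lemma k_measurable[measurable (raw)]:
  assumes [measurable]: "f \<in> borel_measurable N" "g \<in> borel_measurable N" "h \<in> borel_measurable N"
  shows "(\<lambda>w. k (f w) (g w) (h w)) \<in> borel_measurable N"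
proof -
  have "(\<lambda>w. (f w, g w, h w)) \<in> N \<rightarrow>\<^sub>M borel"
    by measurable
  from measurable_compose[OF this k_meas] show ?thesis by simp
qed

lemma U_measurable[measurable (raw)]:
  assumes [measurable]: "f \<in> borel_measurable N" "g \<in> borel_measurable N"
  shows "(\<lambda>w. U (f w, g w)) \<in> borel_measurable N"
proof -
  have "(\<lambda>w. (f w, g w)) \<in> N \<rightarrow>\<^sub>M borel"
    by measurable
  from measurable_compose[OF this U_meas] show ?thesis by simp
qed

lemma dU_le: "\<bar>dU t z\<bar> \<le> 2 * M"
  using U_le[of "(fst z, t)"] U_le[of "(snd z, t)"] by linarith

text \<open>A function vanishing outside the ball has zero increment on all other pairs, so the
  energy of U is needed on S only.\<close>

abbreviation S :: "('a \<times> 'a) set" where "S \<equiv> {z. fst z \<in> ball x0 R \<or> snd z \<in> ball x0 R}"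

lemma S_measurable[measurable]: "S \<in> sets borel"
proof -
  have "S = ball x0 R \<times> UNIV \<union> UNIV \<times> ball x0 R" by auto
  moreover have "open \<dots>" by (intro open_Un open_Times) auto
  ultimately show ?thesis by simp
qed

lemma truncated_kernel_pairs:
  assumes LN: "L > 0" "N > 0" and P[measurable]: "P \<in> sets borel"
  shows "(\<integral>\<^sup>+z. (indicator P (fst z) + indicator P (snd z)) *
      ennreal (min (L * norm (fst z - snd z)) N powr p / kap z) \<partial>lborel)
    \<le> 2 * emeasure lborel P * ennreal (C * L powr (p * s) * N powr (p - p * s))"
proof -
  let ?F = "\<lambda>r. ennreal (min (L * r) N powr p / r powr (real DIM('a) + p * s))"
  note [measurable] = borel_measurable_indicator_fst_snd[OF P]
  have "(\<integral>\<^sup>+z. (indicator P (fst z) + indicator P (snd z)) * ?F (norm (fst z - snd z)) \<partial>lborel)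
      = (\<integral>\<^sup>+z. indicator P (fst z) * ?F (norm (fst z - snd z)) \<partial>lborel)
        + (\<integral>\<^sup>+z. indicator P (snd z) * ?F (norm (fst z - snd z)) \<partial>lborel)"
    by (subst nn_integral_add[symmetric]) (auto simp: ring_distribs)
  also have "\<dots> = 2 * emeasure lborel P * (\<integral>\<^sup>+w. ?F (norm (w :: 'a)) \<partial>lborel)"
    using nn_integral_radial_pairs[of ?F P] by (simp add: mult_2 distrib_right)
  also have "\<dots> \<le> 2 * emeasure lborel P * ennreal (C * L powr (p * s) * N powr (p - p * s))"
    by (intro mult_left_mono truncated_kernel LN) auto
  finally show ?thesis .
qed

lemma truncated_kernel_pairs_finite:
  assumes LN: "L > 0" "N > 0"
  shows "(\<integral>\<^sup>+z. (indicator (ball x0 R) (fst z) + indicator (ball x0 R) (snd z)) *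
      ennreal (min (L * norm (fst z - snd z)) N powr p / kap z) \<partial>lborel) < \<infinity>"
proof -
  have "emeasure lborel (ball x0 R) < \<infinity>" using emeasure_bounded_finite[OF bounded_ball] by simp
  then have "2 * emeasure lborel (ball x0 R) * ennreal (C * L powr (p * s) * N powr (p - p * s)) < \<infinity>"
    by (simp add: ennreal_mult_less_top)
  with truncated_kernel_pairs[OF LN, of "ball x0 R"] show ?thesis by (simp add: order.strict_trans1)
qed

text \<open>Pairs with both points in the doubled ball are controlled by the local energy; in all other
  pairs of \<open>S\<close> the points are at distance at least \<open>R\<close>.\<close>
lemma energy_S_finite:
  "(\<integral>\<^sup>+t\<in>{a..b}. (\<integral>\<^sup>+z\<in>S. ennreal (\<bar>dU t z\<bar> powr p / kap z) \<partial>lborel) \<partial>lborel) < \<infinity>"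
proof -
  define B2 where "B2 = ball x0 (2 * R) \<times> ball x0 (2 * R)"
  have "open B2" unfolding B2_def by (rule open_Times[OF open_ball open_ball])
  then have [measurable]: "B2 \<in> sets borel" by simp
  \<comment> \<open>The Lipschitz constant 2 M / R is chosen so that the minimum equals 2 M, the
    bound for |dU|, at all distances from R on.\<close>
  let ?T = "\<lambda>z. (indicator (ball x0 R) (fst z) + indicator (ball x0 R) (snd z)) *
      ennreal (min (2 * M / R * norm (fst z - snd z)) (2 * M) powr p / kap z)"
  have ball[measurable]: "ball x0 R \<in> sets borel" by simp
  note [measurable] = borel_measurable_indicator_fst_snd[OF ball]
  have pw: "ennreal (\<bar>dU t z\<bar> powr p / kap z) * indicator S z \<le>
      ennreal (\<bar>dU t z\<bar> powr p / kap z) * indicator B2 z + ?T z" for t z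
  proof (cases "z \<in> S - B2")
    case True
    have far: "R \<le> norm (fst z - snd z)"
    proof -
      have tri: "dist x0 (fst z) \<le> dist x0 (snd z) + norm (fst z - snd z)"
        "dist x0 (snd z) \<le> dist x0 (fst z) + norm (fst z - snd z)"
        using dist_triangle[of x0 "fst z" "snd z"] dist_triangle[of x0 "snd z" "fst z"]
        by (simp_all add: dist_commute[of "snd z"] flip: dist_norm)
      show ?thesis using True tri R by (cases z) (auto simp: B2_def)
    qed
    then have "2 * M \<le> 2 * M / R * norm (fst z - snd z)"
      using R M by (simp add: field_simps)
    then have "\<bar>dU t z\<bar> powr p \<le> min (2 * M / R * norm (fst z - snd z)) (2 * M) powr p"
      using dU_le[of z t] p by (intro powr_mono2) auto
    then have "ennreal (\<bar>dU t z\<bar> powr p / kap z)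
        \<le> ennreal (min (2 * M / R * norm (fst z - snd z)) (2 * M) powr p / kap z)"
      by (intro ennreal_leI divide_right_mono) auto
    also have "\<dots> \<le> ?T z"
    proof -
      have "1 * E \<le> (indicator (ball x0 R) (fst z) + indicator (ball x0 R) (snd z)) * E" for E :: ennreal
        using True by (intro mult_right_mono) (auto simp: indicator_def)
      then show ?thesis by simp
    qed
    finally show ?thesis using True by (simp add: add_increasing)
  next
    case False
    then have "indicator S z \<le> (indicator B2 z :: ennreal)" by (simp add: indicator_def) blast
    then show ?thesis by (intro add_increasing2 mult_left_mono) auto
  qed
  have "(\<integral>\<^sup>+t\<in>{a..b}. (\<integral>\<^sup>+z\<in>S. ennreal (\<bar>dU t z\<bar> powr p / kap z) \<partial>lborel) \<partial>lborel)
      \<le> (\<integral>\<^sup>+t\<in>{a..b}. ((\<integral>\<^sup>+z\<in>B2. ennreal (\<bar>dU t z\<bar> powr p / kap z) \<partial>lborel) + (\<integral>\<^sup>+z. ?T z \<partial>lborel)) \<partial>lborel)"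
  proof (intro nn_integral_mono mult_right_mono)
    fix t
    have "(\<integral>\<^sup>+z\<in>S. ennreal (\<bar>dU t z\<bar> powr p / kap z) \<partial>lborel)
        \<le> (\<integral>\<^sup>+z. ennreal (\<bar>dU t z\<bar> powr p / kap z) * indicator B2 z + ?T z \<partial>lborel)"
      by (intro nn_integral_mono pw)
    also have "\<dots> = (\<integral>\<^sup>+z\<in>B2. ennreal (\<bar>dU t z\<bar> powr p / kap z) \<partial>lborel) + (\<integral>\<^sup>+z. ?T z \<partial>lborel)"
      by (rule nn_integral_add) measurable
    finally show "(\<integral>\<^sup>+z\<in>S. ennreal (\<bar>dU t z\<bar> powr p / kap z) \<partial>lborel) \<le> \<dots>" .
  qed simp
  also have "\<dots> = (\<integral>\<^sup>+t\<in>{a..b}. (\<integral>\<^sup>+z\<in>B2. ennreal (\<bar>dU t z\<bar> powr p / kap z) \<partial>lborel) \<partial>lborel)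
      + (\<integral>\<^sup>+t\<in>{a..b}. (\<integral>\<^sup>+z. ?T z \<partial>lborel) \<partial>lborel)"
    unfolding distrib_right by (rule nn_integral_add) measurable
  also have "\<dots> < \<infinity>"
    using local_energy[folded B2_def] truncated_kernel_pairs_finite[of "2 * M / R" "2 * M"] M R
    by (simp add: nn_integral_cmult ennreal_mult_less_top emeasure_lborel_Icc_eq)
  finally show ?thesis .
qed

end

text \<open>The test functions are constant in time with values in [0, 2 M], the range of a
  truncation by a barrier bounded by M. G stands for the times at which the boundary averages tend
  to the slice integrals. It is fixed before g, because g will be a truncation frozen at one of
  these times.\<close>

locale nonlocal_problem = nonlocal_kernel p q s \<Lambda> M C U k x0 R a b
  for p q s \<Lambda> M C :: real
    and U :: "'a::euclidean_space \<times> real \<Rightarrow> real"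
    and k :: "real \<Rightarrow> 'a \<Rightarrow> 'a \<Rightarrow> real"
    and x0 :: 'a and R a b :: real +
  fixes G :: "real set"
  assumes G: "AE t in lborel. a < t \<and> t < b \<longrightarrow> t \<in> G"
    and supersolution: "\<And>g t1 t2. \<lbrakk>g \<in> borel_measurable borel; \<And>x. 0 \<le> g x; \<And>x. g x \<le> 2 * M;
        \<And>x. x \<notin> ball x0 R \<Longrightarrow> g x = 0;
        (\<integral>\<^sup>+z. ennreal (\<bar>g (fst z) - g (snd z)\<bar> powr p
          / norm (fst z - snd z) powr (real DIM('a) + p * s)) \<partial>lborel) < \<infinity>;
        a < t1; t1 < t2; t2 < b; t1 \<in> G; t2 \<in> G\<rbrakk> \<Longrightarrow>
        - (LINT t:{t1..t2}|lborel. (LINT z|lborel. signed_pow (p - 1) (U (fst z, t) - U (snd z, t))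
              * (g (fst z) - g (snd z)) * k t (fst z) (snd z)))
          \<le> (LINT x|lborel. (signed_pow q (U (x, t2)) - signed_pow q (U (x, t1))) * g x)"

context nonlocal_problem begin

definition energy :: "real \<Rightarrow> ('a \<Rightarrow> real) \<Rightarrow> real" where
  "energy t g = (LINT z|lborel. signed_pow (p - 1) (dU t z) * (g (fst z) - g (snd z)) * k t (fst z) (snd z))"

text \<open>The weight is split between the two factors of the energy density. As k is comparable to
  1 / kap, multiplying by \<open>kap z powr (1 / p)\<close> puts \<open>flux\<close> into L^(p / (p
  - 1)) over space-time, and dividing by it puts \<open>trunc_quotient\<close> into L^p, so that the
  two can be paired.\<close>

definition flux :: "real \<times> 'a \<times> 'a \<Rightarrow> real" where
  "flux = (\<lambda>(t, z). indicator {a..b} t * indicator S z *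
     (signed_pow (p - 1) (dU t z) * k t (fst z) (snd z) * kap z powr (1 / p)))"

text \<open>The value - M outside the ball is a lower bound of U, hence the truncation vanishes
  there. The Lipschitz bound makes the energy of the barrier finite, by the truncated kernel
  estimate.\<close>

definition barrier :: "real \<Rightarrow> ('a \<Rightarrow> real) \<Rightarrow> bool" where
  "barrier L \<beta> \<longleftrightarrow> 0 < L \<and> \<beta> \<in> borel_measurable borel \<and> (\<forall>x. \<bar>\<beta> x\<bar> \<le> M) \<and>
     (\<forall>x y. \<bar>\<beta> x - \<beta> y\<bar> \<le> L * norm (x - y)) \<and> (\<forall>x. x \<notin> ball x0 R \<longrightarrow> \<beta> x = - M)"

definition trunc :: "('a \<Rightarrow> real) \<Rightarrow> real \<Rightarrow> 'a \<Rightarrow> real" where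
  "trunc \<beta> t x = max 0 (\<beta> x - U (x, t))"

definition trunc_quotient :: "('a \<Rightarrow> real) \<Rightarrow> real \<times> 'a \<times> 'a \<Rightarrow> real" where
  "trunc_quotient \<beta> = (\<lambda>(t, z). indicator {a..b} t *
     ((trunc \<beta> t (fst z) - trunc \<beta> t (snd z)) / kap z powr (1 / p)))"

definition bregman_int :: "('a \<Rightarrow> real) \<Rightarrow> real \<Rightarrow> real" where
  "bregman_int \<beta> t = (LINT x|lborel. bregman q (\<beta> x) (U (x, t)))"

lemma indicator_S_measurable[measurable]:
  "(\<lambda>w :: real \<times> 'a \<times> 'a. indicat_real S (snd w)) \<in> borel_measurable borel"
  by (rule measurable_compose[OF borel_measurable_fst_snd(2)]) measurable

lemma flux_measurable[measurable]: "flux \<in> borel_measurable borel"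
proof -
  have "(\<lambda>w. indicator {a..b} (fst w) * indicat_real S (snd w) *
     (signed_pow (p - 1) (dU (fst w) (snd w)) * k (fst w) (fst (snd w)) (snd (snd w)) * kap (snd w) powr (1 / p)))
     \<in> borel_measurable borel"
    by measurable
  then show ?thesis by (simp add: flux_def case_prod_beta)
qed

lemma flux_integrable:
  "integrable (lborel \<Otimes>\<^sub>M lborel) (\<lambda>w. \<bar>flux w\<bar> powr (p / (p - 1)))"
proof -
  let ?p' = "p / (p - 1)"
  have pw: "\<bar>flux (t, z)\<bar> powr ?p' \<le> \<Lambda> powr ?p' * (\<bar>dU t z\<bar> powr p / kap z) * indicator {a..b} t * indicator S z" for t z
  proof (cases "t \<in> {a..b} \<and> z \<in> S \<and> fst z \<noteq> snd z")
    case True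
    then have kp: "kap z > 0" by simp
    have e1: "kap z powr (1 / p) / kap z = kap z powr (1 / p - 1)"
      using kp by (simp add: powr_diff)
    have "\<bar>flux (t, z)\<bar> = \<bar>dU t z\<bar> powr (p - 1) * k t (fst z) (snd z) * kap z powr (1 / p)"
      using True k_nonneg[of t "fst z" "snd z"] by (simp add: flux_def abs_mult abs_signed_pow)
    also have "\<dots> \<le> \<bar>dU t z\<bar> powr (p - 1) * (\<Lambda> / kap z) * kap z powr (1 / p)"
      by (intro mult_right_mono mult_left_mono k_upper) auto
    also have "\<dots> = \<Lambda> * \<bar>dU t z\<bar> powr (p - 1) * kap z powr (1 / p - 1)"
      by (simp flip: e1)
    finally have "\<bar>flux (t, z)\<bar> powr ?p' \<le> (\<Lambda> * \<bar>dU t z\<bar> powr (p - 1) * kap z powr (1 / p - 1)) powr ?p'"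
      using p by (intro powr_mono2) auto
    also have "\<dots> = \<Lambda> powr ?p' * \<bar>dU t z\<bar> powr p * kap z powr (- 1)"
    proof -
      have "(1 / p - 1) * ?p' = - 1" "(p - 1) * ?p' = p" using p by (auto simp: field_simps)
      then have "(kap z powr (1 / p - 1)) powr ?p' = kap z powr (- 1)"
        "(\<bar>dU t z\<bar> powr (p - 1)) powr ?p' = \<bar>dU t z\<bar> powr p"
        by (simp_all only: powr_powr mult.assoc)
      then show ?thesis by (simp only: powr_mult)
    qed
    also have "\<dots> = \<Lambda> powr ?p' * (\<bar>dU t z\<bar> powr p / kap z)"
      using kp by (simp add: powr_minus divide_inverse)
    finally show ?thesis using True by simp
  next
    case False
    then have "flux (t, z) = 0" by (auto simp: flux_def)
    then show ?thesis using Lam by simp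
  qed
  have "(\<integral>\<^sup>+w. ennreal (\<bar>flux w\<bar> powr ?p') \<partial>(lborel \<Otimes>\<^sub>M lborel))
      = (\<integral>\<^sup>+t. \<integral>\<^sup>+z. ennreal (\<bar>flux (t, z)\<bar> powr ?p') \<partial>lborel \<partial>lborel)"
    unfolding lborel_prod by (rule nn_integral_lborel_prod) measurable
  also have "\<dots> \<le> (\<integral>\<^sup>+t. \<integral>\<^sup>+z. ennreal (\<Lambda> powr ?p') *
      (ennreal (\<bar>dU t z\<bar> powr p / kap z) * indicator S z * indicator {a..b} t) \<partial>lborel \<partial>lborel)"
  proof (intro nn_integral_mono)
    fix t z
    have "ennreal (\<bar>flux (t, z)\<bar> powr ?p') \<le> ennreal (\<Lambda> powr ?p' * (\<bar>dU t z\<bar> powr p / kap z) * indicator {a..b} t * indicator S z)"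
      by (rule ennreal_leI[OF pw])
    also have "\<dots> = ennreal (\<Lambda> powr ?p') * (ennreal (\<bar>dU t z\<bar> powr p / kap z) * indicator S z * indicator {a..b} t)"
      by (auto simp: ennreal_mult'[symmetric] indicator_def)
    finally show "ennreal (\<bar>flux (t, z)\<bar> powr ?p') \<le> \<dots>" .
  qed
  also have "\<dots> = ennreal (\<Lambda> powr ?p') *
      (\<integral>\<^sup>+t\<in>{a..b}. (\<integral>\<^sup>+z\<in>S. ennreal (\<bar>dU t z\<bar> powr p / kap z) \<partial>lborel) \<partial>lborel)"
    by (subst nn_integral_cmult[symmetric], measurable) (simp add: nn_integral_cmult nn_integral_multc)
  also have "\<dots> < \<infinity>"
    using energy_S_finite by (simp add: ennreal_mult_less_top)
  finally show ?thesis
    by (intro integrableI_bounded) (simp_all add: lborel_prod)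
qed

lemma trunc_bounds: "0 \<le> trunc \<beta> t x" "barrier L \<beta> \<Longrightarrow> trunc \<beta> t x \<le> 2 * M"
  using U_le[of "(x, t)"] unfolding barrier_def trunc_def by (auto simp: abs_le_iff max_def) (smt (verit))

lemma trunc_zero: "barrier L \<beta> \<Longrightarrow> x \<notin> ball x0 R \<Longrightarrow> trunc \<beta> t x = 0"
  using U_le[of "(x, t)"] unfolding barrier_def trunc_def by auto

lemma trunc_measurable:
  assumes "barrier L \<beta>" and [measurable]: "f \<in> borel_measurable N" "g \<in> borel_measurable N"
  shows "(\<lambda>w. trunc \<beta> (f w) (g w)) \<in> borel_measurable N"
proof -
  have [measurable]: "\<beta> \<in> borel_measurable borel" using assms by (simp add: barrier_def)
  show ?thesis unfolding trunc_def by measurable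
qed

lemma trunc_diff_le:
  assumes "barrier L \<beta>"
  shows "\<bar>trunc \<beta> t (fst z) - trunc \<beta> t (snd z)\<bar> \<le> \<bar>\<beta> (fst z) - \<beta> (snd z)\<bar> + \<bar>dU t z\<bar>"
  unfolding trunc_def by (auto simp: max_def)

lemma trunc_diff_zero:
  assumes "barrier L \<beta>" "z \<notin> S"
  shows "trunc \<beta> t (fst z) - trunc \<beta> t (snd z) = 0"
  using assms by (simp add: trunc_zero)

lemma barrier_diff_le:
  assumes "barrier L \<beta>"
  shows "\<bar>\<beta> (fst z) - \<beta> (snd z)\<bar> \<le> min (L * norm (fst z - snd z)) (2 * M)"
proof -
  have "\<bar>\<beta> (fst z)\<bar> \<le> M" "\<bar>\<beta> (snd z)\<bar> \<le> M" "\<bar>\<beta> (fst z) - \<beta> (snd z)\<bar> \<le> L * norm (fst z - snd z)"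
    using assms by (auto simp: barrier_def)
  then show ?thesis by linarith
qed

lemma trunc_energy_finite:
  assumes bar: "barrier L \<beta>"
  shows "(\<integral>\<^sup>+t\<in>{a..b}. (\<integral>\<^sup>+z. ennreal (\<bar>trunc \<beta> t (fst z) - trunc \<beta> t (snd z)\<bar> powr p / kap z) \<partial>lborel) \<partial>lborel) < \<infinity>"
proof -
  have L: "0 < L" using bar by (simp add: barrier_def)
  note [measurable] = trunc_measurable[OF bar]
  have ball[measurable]: "ball x0 R \<in> sets borel" by simp
  note [measurable] = borel_measurable_indicator_fst_snd[OF ball]
  let ?T = "\<lambda>z. (indicator (ball x0 R) (fst z) + indicator (ball x0 R) (snd z)) *
      ennreal (min (L * norm (fst z - snd z)) (2 * M) powr p / kap z)"
  let ?E = "\<lambda>t z. ennreal (\<bar>dU t z\<bar> powr p / kap z) * indicator S z"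
  have pw: "ennreal (\<bar>trunc \<beta> t (fst z) - trunc \<beta> t (snd z)\<bar> powr p / kap z)
      \<le> ennreal (2 powr p) * (?T z + ?E t z)" for t z
  proof (cases "z \<in> S")
    case True
    let ?m = "min (L * norm (fst z - snd z)) (2 * M)"
    have m0: "0 \<le> ?m" using L M by simp
    have "\<bar>trunc \<beta> t (fst z) - trunc \<beta> t (snd z)\<bar> \<le> ?m + \<bar>dU t z\<bar>"
      using trunc_diff_le[OF bar, of t z] barrier_diff_le[OF bar, of z] by linarith
    then have "\<bar>trunc \<beta> t (fst z) - trunc \<beta> t (snd z)\<bar> powr p \<le> (?m + \<bar>dU t z\<bar>) powr p"
      using p by (intro powr_mono2) auto
    also have "\<dots> \<le> 2 powr p * (?m powr p + \<bar>dU t z\<bar> powr p)"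
      using p m0 by (intro powr_add_le) auto
    finally have "\<bar>trunc \<beta> t (fst z) - trunc \<beta> t (snd z)\<bar> powr p / kap z
        \<le> 2 powr p * (?m powr p + \<bar>dU t z\<bar> powr p) / kap z"
      by (rule divide_right_mono) simp
    also have "\<dots> = 2 powr p * (?m powr p / kap z + \<bar>dU t z\<bar> powr p / kap z)"
      by (simp only: times_divide_eq_right[symmetric] add_divide_distrib)
    finally have "ennreal (\<bar>trunc \<beta> t (fst z) - trunc \<beta> t (snd z)\<bar> powr p / kap z)
        \<le> ennreal (2 powr p * (?m powr p / kap z + \<bar>dU t z\<bar> powr p / kap z))"
      by (rule ennreal_leI)
    also have "\<dots> = ennreal (2 powr p) * (ennreal (?m powr p / kap z) + ennreal (\<bar>dU t z\<bar> powr p / kap z))"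
      by (subst ennreal_mult) auto
    also have "\<dots> \<le> ennreal (2 powr p) * (?T z + ?E t z)"
    proof (intro mult_left_mono add_mono)
      have "1 * E \<le> (indicator (ball x0 R) (fst z) + indicator (ball x0 R) (snd z)) * E" for E :: ennreal
        using True by (intro mult_right_mono) (auto simp: indicator_def)
      then show "ennreal (?m powr p / kap z) \<le> ?T z" by simp
    qed (use True in auto)
    finally show ?thesis .
  next
    case False
    then show ?thesis using trunc_diff_zero[OF bar, of z t] p by simp
  qed
  have "(\<integral>\<^sup>+t\<in>{a..b}. (\<integral>\<^sup>+z. ennreal (\<bar>trunc \<beta> t (fst z) - trunc \<beta> t (snd z)\<bar> powr p / kap z) \<partial>lborel) \<partial>lborel)
      \<le> (\<integral>\<^sup>+t\<in>{a..b}. (ennreal (2 powr p) * ((\<integral>\<^sup>+z. ?T z \<partial>lborel) + (\<integral>\<^sup>+z. ?E t z \<partial>lborel))) \<partial>lborel)"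
  proof (intro nn_integral_mono mult_right_mono)
    fix t
    have "(\<integral>\<^sup>+z. ennreal (\<bar>trunc \<beta> t (fst z) - trunc \<beta> t (snd z)\<bar> powr p / kap z) \<partial>lborel)
        \<le> (\<integral>\<^sup>+z. ennreal (2 powr p) * (?T z + ?E t z) \<partial>lborel)"
      by (intro nn_integral_mono pw)
    also have "\<dots> = ennreal (2 powr p) * (\<integral>\<^sup>+z. (?T z + ?E t z) \<partial>lborel)"
      by (rule nn_integral_cmult) measurable
    also have "(\<integral>\<^sup>+z. (?T z + ?E t z) \<partial>lborel) = (\<integral>\<^sup>+z. ?T z \<partial>lborel) + (\<integral>\<^sup>+z. ?E t z \<partial>lborel)"
      by (rule nn_integral_add) measurable
    finally show "(\<integral>\<^sup>+z. ennreal (\<bar>trunc \<beta> t (fst z) - trunc \<beta> t (snd z)\<bar> powr p / kap z) \<partial>lborel)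
        \<le> ennreal (2 powr p) * ((\<integral>\<^sup>+z. ?T z \<partial>lborel) + (\<integral>\<^sup>+z. ?E t z \<partial>lborel))" .
  qed simp
  also have "\<dots> = (\<integral>\<^sup>+t. ennreal (2 powr p) * ((\<integral>\<^sup>+z. ?T z \<partial>lborel) * indicator {a..b} t
      + (\<integral>\<^sup>+z. ?E t z \<partial>lborel) * indicator {a..b} t) \<partial>lborel)"
    by (simp add: distrib_right mult.assoc)
  also have "\<dots> = ennreal (2 powr p) * (\<integral>\<^sup>+t. ((\<integral>\<^sup>+z. ?T z \<partial>lborel) * indicator {a..b} t
      + (\<integral>\<^sup>+z. ?E t z \<partial>lborel) * indicator {a..b} t) \<partial>lborel)"
    by (rule nn_integral_cmult) measurable
  also have "(\<integral>\<^sup>+t. ((\<integral>\<^sup>+z. ?T z \<partial>lborel) * indicator {a..b} t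
      + (\<integral>\<^sup>+z. ?E t z \<partial>lborel) * indicator {a..b} t) \<partial>lborel) =
      (\<integral>\<^sup>+t. (\<integral>\<^sup>+z. ?T z \<partial>lborel) * indicator {a..b} t \<partial>lborel)
      + (\<integral>\<^sup>+t\<in>{a..b}. (\<integral>\<^sup>+z. ?E t z \<partial>lborel) \<partial>lborel)"
    by (rule nn_integral_add) measurable
  also have "ennreal (2 powr p) * \<dots> < \<infinity>"
    using energy_S_finite truncated_kernel_pairs_finite[OF L, of "2 * M"] M
    by (simp add: nn_integral_cmult ennreal_mult_less_top emeasure_lborel_Icc_eq)
  finally show ?thesis .
qed

lemma trunc_quotient_measurable:
  assumes bar: "barrier L \<beta>"
  shows "trunc_quotient \<beta> \<in> borel_measurable borel"
proof -
  note [measurable] = trunc_measurable[OF bar]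
  have "(\<lambda>w. indicator {a..b} (fst w) *
     ((trunc \<beta> (fst w) (fst (snd w)) - trunc \<beta> (fst w) (snd (snd w))) / kap (snd w) powr (1 / p))) \<in> borel_measurable borel"
    by measurable
  then show ?thesis by (simp add: trunc_quotient_def case_prod_beta)
qed

lemma trunc_quotient_integrable:
  assumes bar: "barrier L \<beta>"
  shows "integrable (lborel \<Otimes>\<^sub>M lborel) (\<lambda>w. \<bar>trunc_quotient \<beta> w\<bar> powr p)"
proof -
  note [measurable] = trunc_quotient_measurable[OF bar] trunc_measurable[OF bar]
  have eq: "ennreal (\<bar>trunc_quotient \<beta> (t, z)\<bar> powr p)
      = ennreal (\<bar>trunc \<beta> t (fst z) - trunc \<beta> t (snd z)\<bar> powr p / kap z) * indicator {a..b} t" for t z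
    using p by (cases "fst z = snd z")
      (auto simp: trunc_quotient_def indicator_def powr_divide powr_powr abs_mult)
  have "(\<integral>\<^sup>+w. ennreal (\<bar>trunc_quotient \<beta> w\<bar> powr p) \<partial>(lborel \<Otimes>\<^sub>M lborel))
      = (\<integral>\<^sup>+t. \<integral>\<^sup>+z. ennreal (\<bar>trunc_quotient \<beta> (t, z)\<bar> powr p) \<partial>lborel \<partial>lborel)"
    unfolding lborel_prod by (rule nn_integral_lborel_prod) measurable
  also have "\<dots> = (\<integral>\<^sup>+t\<in>{a..b}. (\<integral>\<^sup>+z. ennreal (\<bar>trunc \<beta> t (fst z) - trunc \<beta> t (snd z)\<bar> powr p / kap z) \<partial>lborel) \<partial>lborel)"
    unfolding eq by (intro nn_integral_cong nn_integral_multc) measurable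
  also have "\<dots> < \<infinity>" by (rule trunc_energy_finite[OF bar])
  finally show ?thesis
    by (intro integrableI_bounded) (simp_all add: lborel_prod)
qed

text \<open>The two times are independent: U is taken at t, the test function at \<tau>. On the
  diagonal and off S the increment of the truncation is zero, so neither the cut-off in
  \<open>flux\<close> nor the division by 0 does harm.\<close>

lemma flux_pairing:
  assumes bar: "barrier L \<beta>" and "t \<in> {a..b}" "\<tau> \<in> {a..b}"
  shows "flux (t, z) * trunc_quotient \<beta> (\<tau>, z)
    = signed_pow (p - 1) (dU t z) * (trunc \<beta> \<tau> (fst z) - trunc \<beta> \<tau> (snd z)) * k t (fst z) (snd z)"
proof (cases "z \<in> S \<and> fst z \<noteq> snd z")
  case True
  then show ?thesis using assms by (simp add: flux_def trunc_quotient_def)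
next
  case False
  then have "trunc \<beta> \<tau> (fst z) - trunc \<beta> \<tau> (snd z) = 0"
    using trunc_diff_zero[OF bar, of z \<tau>] by auto
  then show ?thesis by (simp add: trunc_quotient_def)
qed

lemma flux_pairing_integral:
  assumes bar: "barrier L \<beta>" and "t \<in> {a..b}" "\<tau> \<in> {a..b}"
  shows "(LINT z|lborel. flux (t, z) * trunc_quotient \<beta> (\<tau>, z)) = energy t (trunc \<beta> \<tau>)"
  unfolding energy_def flux_pairing[OF assms] ..

lemma bregman_int_integrable:
  assumes bar: "barrier L \<beta>"
  shows "integrable lborel (\<lambda>x. bregman q (\<beta> x) (U (x, t)))"
proof (rule Bochner_Integration.integrable_bound)
  show "integrable lborel (\<lambda>x. 3 * M powr (q + 1) * indicat_real (ball x0 R) x)"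
    using emeasure_bounded_finite[OF bounded_ball, of x0 R] by (intro integrable_mult_right integrable_real_indicator) auto
  note [measurable] = bar[unfolded barrier_def, THEN conjunct2, THEN conjunct1]
  show "(\<lambda>x. bregman q (\<beta> x) (U (x, t))) \<in> borel_measurable lborel" by measurable
  have "norm (bregman q (\<beta> x) (U (x, t))) \<le> norm (3 * M powr (q + 1) * indicat_real (ball x0 R) x)" for x
  proof (cases "x \<in> ball x0 R")
    case True
    have "bregman q (\<beta> x) (U (x, t)) \<le> 3 * M powr (q + 1)"
      using bar U_le by (intro bregman_le[OF q]) (auto simp: barrier_def)
    then show ?thesis using True bregman_nonneg[OF q] by simp
  next
    case False
    then have "\<beta> x \<le> U (x, t)" using bar U_le[of "(x, t)"] by (auto simp: barrier_def)
    then show ?thesis by (simp add: bregman_def)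
  qed
  then show "AE x in lborel. norm (bregman q (\<beta> x) (U (x, t))) \<le> norm (3 * M powr (q + 1) * indicat_real (ball x0 R) x)"
    by simp
qed

lemma bregman_int_diff:
  assumes bar: "barrier L \<beta>"
  shows "bregman_int \<beta> t2 - bregman_int \<beta> t1
    \<le> - (LINT x|lborel. (signed_pow q (U (x, t2)) - signed_pow q (U (x, t1))) * trunc \<beta> t2 x)"
proof -
  note [measurable] = trunc_measurable[OF bar]
  let ?h = "\<lambda>x. (signed_pow q (U (x, t2)) - signed_pow q (U (x, t1))) * trunc \<beta> t2 x"
  have int: "integrable lborel ?h"
  proof (rule Bochner_Integration.integrable_bound)
    show "integrable lborel (\<lambda>x. 2 * M powr q * (2 * M) * indicat_real (ball x0 R) x)"
      using emeasure_bounded_finite[OF bounded_ball, of x0 R] by (intro integrable_mult_right integrable_real_indicator) auto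
    have "norm (?h x) \<le> norm (2 * M powr q * (2 * M) * indicat_real (ball x0 R) x)" for x
    proof (cases "x \<in> ball x0 R")
      case True
      have "\<bar>signed_pow q (U (x, t))\<bar> \<le> M powr q" for t
        using q U_le by (auto simp: abs_signed_pow intro!: powr_mono2)
      from this[of t1] this[of t2]
      have "\<bar>signed_pow q (U (x, t2)) - signed_pow q (U (x, t1))\<bar> \<le> 2 * M powr q" by linarith
      then have "\<bar>?h x\<bar> \<le> 2 * M powr q * (2 * M)"
        unfolding abs_mult using trunc_bounds(1) trunc_bounds(2)[OF bar] by (intro mult_mono) auto
      then show ?thesis using True M by simp
    qed (simp add: trunc_zero[OF bar])
    then show "AE x in lborel. norm (?h x) \<le> norm (2 * M powr q * (2 * M) * indicat_real (ball x0 R) x)" by simp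
  qed measurable
  have "bregman_int \<beta> t2 - bregman_int \<beta> t1
      = (LINT x|lborel. bregman q (\<beta> x) (U (x, t2)) - bregman q (\<beta> x) (U (x, t1)))"
    unfolding bregman_int_def using bregman_int_integrable[OF bar] by simp
  also have "\<dots> \<le> (LINT x|lborel. - ?h x)"
    using bregman_convex[OF q] int bregman_int_integrable[OF bar]
    by (intro integral_mono) (auto simp: trunc_def mult.commute)
  finally show ?thesis by simp
qed

end

section \<open>From time steps to the energy inequality\<close>

lemma set_integral_reflect:
  fixes f :: "real \<Rightarrow> real"
  shows "(LINT \<sigma>:{0..h}|lborel. f (t - \<sigma>)) = (LINT x:{t - h..t}|lborel. f x)"
proof -
  have "(LINT x:{t - h..t}|lborel. f x) = (LINT \<sigma>|lborel. indicat_real {t - h..t} (t + (-1) * \<sigma>) * f (t + (-1) * \<sigma>))"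
    unfolding set_lebesgue_integral_def
    by (subst lborel_integral_real_affine[where c="-1" and t=t]) simp_all
  also have "\<dots> = (LINT \<sigma>:{0..h}|lborel. f (t - \<sigma>))"
    unfolding set_lebesgue_integral_def
    by (intro Bochner_Integration.integral_cong) (auto simp: indicator_def)
  finally show ?thesis ..
qed

text \<open>All but the two end pieces of length h cancel; divided by h, these are left averages at
  t2 and t1.\<close>

lemma set_integral_shift_difference:
  fixes F :: "real \<Rightarrow> real"
  assumes F: "\<And>a b. set_integrable lborel {a..b} F" and t: "t1 \<le> t2" "0 \<le> h"
  shows "(LINT \<tau>:{t1..t2}|lborel. F \<tau> - F (\<tau> - h))
    = (LINT \<sigma>:{0..h}|lborel. F (t2 - \<sigma>)) - (LINT \<sigma>:{0..h}|lborel. F (t1 - \<sigma>))"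
proof -
  have int: "F integrable_on {a..b}" and val: "(LINT x:{a..b}|lborel. F x) = integral {a..b} F" for a b
    using set_borel_integral_eq_integral[OF F[of a b]] by auto
  have shift: "set_integrable lborel {t1..t2} (\<lambda>\<tau>. F (\<tau> - h))"
    and shift_val: "(LINT \<tau>:{t1..t2}|lborel. F (\<tau> - h)) = (LINT x:{t1 - h..t2 - h}|lborel. F x)"
  proof -
    have eq: "(\<lambda>\<tau>. indicat_real {t1 - h..t2 - h} (- h + 1 * \<tau>) *\<^sub>R F (- h + 1 * \<tau>)) = (\<lambda>\<tau>. indicat_real {t1..t2} \<tau> *\<^sub>R F (\<tau> - h))"
      by (auto simp: indicator_def)
    show "set_integrable lborel {t1..t2} (\<lambda>\<tau>. F (\<tau> - h))"
      using lborel_integrable_real_affine[OF F[of "t1 - h" "t2 - h", unfolded set_integrable_def], of 1 "- h"]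
      unfolding eq set_integrable_def by simp
    show "(LINT \<tau>:{t1..t2}|lborel. F (\<tau> - h)) = (LINT x:{t1 - h..t2 - h}|lborel. F x)"
      unfolding set_lebesgue_integral_def eq[symmetric]
      by (subst (2) lborel_integral_real_affine[where c=1 and t="- h"]) simp_all
  qed
  have "(LINT \<tau>:{t1..t2}|lborel. F \<tau> - F (\<tau> - h)) = integral {t1..t2} F - integral {t1 - h..t2 - h} F"
    using set_integral_diff(2)[OF F shift] by (simp add: shift_val val)
  moreover have "integral {t1 - h..t1} F + integral {t1..t2} F = integral {t1 - h..t2} F"
    "integral {t1 - h..t2 - h} F + integral {t2 - h..t2} F = integral {t1 - h..t2} F"
    using t int by (auto intro!: Henstock_Kurzweil_Integration.integral_combine)
  ultimately show ?thesis
    by (simp add: set_integral_reflect val)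
qed

context nonlocal_problem begin

lemma bregman_int_measurable:
  assumes bar: "barrier L \<beta>"
  shows "bregman_int \<beta> \<in> borel_measurable borel"
proof -
  note [measurable] = bar[unfolded barrier_def, THEN conjunct2, THEN conjunct1]
  show ?thesis unfolding bregman_int_def[abs_def] by measurable
qed

lemma bregman_int_bounds:
  assumes bar: "barrier L \<beta>"
  shows "0 \<le> bregman_int \<beta> t" "bregman_int \<beta> t \<le> 3 * M powr (q + 1) * measure lborel (ball x0 R)"
proof -
  show "0 \<le> bregman_int \<beta> t"
    unfolding bregman_int_def by (intro Bochner_Integration.integral_nonneg bregman_nonneg q)
  have "bregman_int \<beta> t \<le> (LINT x|lborel. 3 * M powr (q + 1) * indicat_real (ball x0 R) x)"
    unfolding bregman_int_def
  proof (rule integral_mono[OF bregman_int_integrable[OF bar]])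
    show "integrable lborel (\<lambda>x. 3 * M powr (q + 1) * indicat_real (ball x0 R) x)"
      using emeasure_bounded_finite[OF bounded_ball, of x0 R] by (intro integrable_mult_right integrable_real_indicator) auto
    fix x
    show "bregman q (\<beta> x) (U (x, t)) \<le> 3 * M powr (q + 1) * indicat_real (ball x0 R) x"
    proof (cases "x \<in> ball x0 R")
      case True
      have "bregman q (\<beta> x) (U (x, t)) \<le> 3 * M powr (q + 1)"
        using bar U_le by (intro bregman_le[OF q]) (auto simp: barrier_def)
      then show ?thesis using True by simp
    next
      case False
      then have "\<beta> x \<le> U (x, t)" using bar U_le[of "(x, t)"] by (auto simp: barrier_def)
      then show ?thesis using False by (simp add: bregman_def)
    qed
  qed
  then show "bregman_int \<beta> t \<le> 3 * M powr (q + 1) * measure lborel (ball x0 R)" by simp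
qed

lemma bregman_int_set_integrable:
  assumes bar: "barrier L \<beta>"
  shows "set_integrable lborel {c..d} (bregman_int \<beta>)"
  unfolding set_integrable_def
proof (rule Bochner_Integration.integrable_bound)
  let ?K = "3 * M powr (q + 1) * measure lborel (ball x0 R)"
  note [measurable] = bregman_int_measurable[OF bar]
  show "integrable lborel (\<lambda>x. ?K * indicat_real {c..d} x)"
    by (intro integrable_mult_right integrable_real_indicator) (auto simp: emeasure_lborel_Icc_eq)
  show "(\<lambda>x. indicat_real {c..d} x *\<^sub>R bregman_int \<beta> x) \<in> borel_measurable lborel" by measurable
  show "AE x in lborel. norm (indicat_real {c..d} x *\<^sub>R bregman_int \<beta> x) \<le> norm (?K * indicat_real {c..d} x)"
    using bregman_int_bounds[OF bar] by (auto intro!: AE_I2 simp: indicator_def intro: order_trans[OF _ abs_ge_self])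
qed

lemma conjugate_exponents: "p / (p - 1) > 1" "1 / (p / (p - 1)) + 1 / p = 1"
  using p by (auto simp: field_simps)

lemma energy_set_integrable:
  assumes bar: "barrier L \<beta>"
  shows "set_integrable lborel {a..b} (\<lambda>t. energy t (trunc \<beta> t))"
    and "AE t in lborel. t \<in> {a..b} \<longrightarrow> integrable lborel
      (\<lambda>z. signed_pow (p - 1) (dU t z) * (trunc \<beta> t (fst z) - trunc \<beta> t (snd z)) * k t (fst z) (snd z))"
proof -
  note [measurable] = trunc_quotient_measurable[OF bar]
  have int: "integrable (lborel \<Otimes>\<^sub>M lborel) (\<lambda>w. flux w * trunc_quotient \<beta> w)"
    by (rule integrable_pairing[OF sigma_finite_lborel _ _ conjugate_exponents(1) p conjugate_exponents(2)
        flux_integrable trunc_quotient_integrable[OF bar]]) (auto simp: lborel_prod)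
  have "(LINT z|lborel. flux (t, z) * trunc_quotient \<beta> (t, z)) = indicat_real {a..b} t *\<^sub>R energy t (trunc \<beta> t)" for t
    using flux_pairing_integral[OF bar, of t t] by (auto simp: indicator_def flux_def)
  with lborel_pair.integrable_fst'[OF int]
  show "set_integrable lborel {a..b} (\<lambda>t. energy t (trunc \<beta> t))"
    by (simp add: set_integrable_def)
  show "AE t in lborel. t \<in> {a..b} \<longrightarrow> integrable lborel
      (\<lambda>z. signed_pow (p - 1) (dU t z) * (trunc \<beta> t (fst z) - trunc \<beta> t (snd z)) * k t (fst z) (snd z))"
    using lborel_pair.AE_integrable_fst'[OF int]
  proof eventually_elim
    case (elim t)
    then show ?case by (auto simp: flux_pairing[OF bar])
  qed
qed

text \<open>The test function for the step from \<tau> - h to \<tau> is the truncation at the end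
  time, as in an implicit Euler scheme; with this choice \<open>bregman_convex\<close> has the right
  sign. Both ends must be good times, and for the countably many h = 1 / (m + 1) this excludes only
  a null set of \<tau>.\<close>

lemma bregman_int_step:
  assumes bar: "barrier L \<beta>"
  shows "AE \<tau> in lborel. \<forall>m. a < \<tau> - 1 / real (Suc m) \<and> \<tau> < b \<longrightarrow>
    bregman_int \<beta> \<tau> - bregman_int \<beta> (\<tau> - 1 / real (Suc m))
      \<le> (LINT \<sigma>:{0..1 / real (Suc m)}|lborel. (LINT z|lborel. flux (\<tau> - \<sigma>, z) * trunc_quotient \<beta> (\<tau>, z)))"
proof -
  note [measurable] = trunc_measurable[OF bar]
  let ?E = "\<lambda>t. (\<integral>\<^sup>+z. ennreal (\<bar>trunc \<beta> t (fst z) - trunc \<beta> t (snd z)\<bar> powr p / kap z) \<partial>lborel)"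
  have "AE t in lborel. ?E t * indicator {a..b} t \<noteq> \<infinity>"
    using trunc_energy_finite[OF bar] by (intro nn_integral_noteq_infinite) auto
  then have fin: "AE t in lborel. t \<in> {a..b} \<longrightarrow> ?E t < \<infinity>"
    by eventually_elim (auto simp: less_top)
  have "AE t in lborel. \<forall>m. a < - (1 / real (Suc m)) + t \<and> - (1 / real (Suc m)) + t < b \<longrightarrow> - (1 / real (Suc m)) + t \<in> G"
    unfolding AE_all_countable by (intro allI AE_lborel_shift[OF G])
  with G fin show ?thesis
  proof eventually_elim
    case (elim \<tau>)
    show ?case
    proof (intro allI impI)
      fix m
      let ?h = "1 / real (Suc m)"
      assume m: "a < \<tau> - ?h \<and> \<tau> < b"
      have h: "?h > 0" by simp
      have \<tau>: "a < \<tau>" using m h by linarith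
      have "bregman_int \<beta> \<tau> - bregman_int \<beta> (\<tau> - ?h)
          \<le> - (LINT x|lborel. (signed_pow q (U (x, \<tau>)) - signed_pow q (U (x, \<tau> - ?h))) * trunc \<beta> \<tau> x)"
        by (rule bregman_int_diff[OF bar])
      also have "\<dots> \<le> (LINT t:{\<tau> - ?h..\<tau>}|lborel. energy t (trunc \<beta> \<tau>))"
      proof -
        have "- (LINT t:{\<tau> - ?h..\<tau>}|lborel. energy t (trunc \<beta> \<tau>))
          \<le> (LINT x|lborel. (signed_pow q (U (x, \<tau>)) - signed_pow q (U (x, \<tau> - ?h))) * trunc \<beta> \<tau> x)"
          unfolding energy_def
        proof (rule supersolution)
          show "trunc \<beta> \<tau> \<in> borel_measurable borel" by measurable
          show "0 \<le> trunc \<beta> \<tau> x" "trunc \<beta> \<tau> x \<le> 2 * M" for x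
            using trunc_bounds(1) trunc_bounds(2)[OF bar] by auto
          show "trunc \<beta> \<tau> x = 0" if "x \<notin> ball x0 R" for x by (rule trunc_zero[OF bar that])
          show "?E \<tau> < \<infinity>" using elim(2) \<tau> m by auto
          show "a < \<tau> - ?h" "\<tau> - ?h < \<tau>" "\<tau> < b" using m h by auto
          have "\<tau> - ?h < b" using m h by linarith
          with elim(3)[rule_format, of m] m show "\<tau> - ?h \<in> G" by simp
          show "\<tau> \<in> G" using elim(1) m \<tau> by simp
        qed
        then show ?thesis by linarith
      qed
      also have "\<dots> = (LINT \<sigma>:{0..?h}|lborel. energy (\<tau> - \<sigma>) (trunc \<beta> \<tau>))"
        by (rule set_integral_reflect[symmetric])
      also have "\<dots> = (LINT \<sigma>:{0..?h}|lborel. (LINT z|lborel. flux (\<tau> - \<sigma>, z) * trunc_quotient \<beta> (\<tau>, z)))"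
      proof (rule set_lebesgue_integral_cong)
        show "\<forall>\<sigma>. \<sigma> \<in> {0..?h} \<longrightarrow> energy (\<tau> - \<sigma>) (trunc \<beta> \<tau>) = (LINT z|lborel. flux (\<tau> - \<sigma>, z) * trunc_quotient \<beta> (\<tau>, z))"
          using m \<tau> by (auto intro!: flux_pairing_integral[OF bar, symmetric])
      qed simp
      finally show "bregman_int \<beta> \<tau> - bregman_int \<beta> (\<tau> - ?h)
          \<le> (LINT \<sigma>:{0..?h}|lborel. (LINT z|lborel. flux (\<tau> - \<sigma>, z) * trunc_quotient \<beta> (\<tau>, z)))" .
    qed
  qed
qed

text \<open>\<open>bregman_int_step\<close> is integrated over \<tau> in [t1, t2] and divided by h.
  The left-hand side telescopes to left averages of \<open>bregman_int\<close>, which converge at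
  the times of G'. The right-hand side is a shifted pairing, bounded in the limit by the energy of
  the truncation at its own time.\<close>

lemma energy_inequality:
  assumes bar: "barrier L \<beta>"
  obtains G' where "AE t in lborel. t \<in> G'"
    "\<And>t1 t2. \<lbrakk>a < t1; t1 < t2; t2 < b; t1 \<in> G'; t2 \<in> G'\<rbrakk> \<Longrightarrow>
      bregman_int \<beta> t2 - bregman_int \<beta> t1 \<le> (LINT t:{t1..t2}|lborel. energy t (trunc \<beta> t))"
proof -
  define F where "F = bregman_int \<beta>"
  have Fint: "set_integrable lborel {c..d} F" for c d
    unfolding F_def by (rule bregman_int_set_integrable[OF bar])
  define G' where "G' = {t. (\<lambda>m. real (Suc m) * (LINT \<sigma>:{0..1 / real (Suc m)}|lborel. F (t - \<sigma>))) \<longlonglongrightarrow> F t}"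
  note [measurable] = trunc_quotient_measurable[OF bar]
  have "AE t in lborel. t \<in> G'"
    unfolding G'_def using AE_average_tendsto_left[OF Fint] by simp
  moreover have "F t2 - F t1 \<le> (LINT t:{t1..t2}|lborel. energy t (trunc \<beta> t))"
    if t: "a < t1" "t1 < t2" "t2 < b" "t1 \<in> G'" "t2 \<in> G'" for t1 t2
  proof (rule field_le_epsilon)
    fix e :: real assume e: "0 < e"
    \<comment> \<open>The cut-off to [t1, t2] turns the integral over \<tau> into one over the whole
      line, as the pairing lemma has it.\<close>
    define g where "g w = indicat_real {t1..t2} (fst w) * trunc_quotient \<beta> w" for w :: "real \<times> 'a \<times> 'a"
    have [measurable]: "g \<in> borel_measurable borel" unfolding g_def by measurable
    have gint: "integrable (lborel \<Otimes>\<^sub>M lborel) (\<lambda>w. \<bar>g w\<bar> powr p)"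
      by (rule Bochner_Integration.integrable_bound[OF trunc_quotient_integrable[OF bar]])
         (auto simp: lborel_prod g_def indicator_def)
    let ?J = "\<lambda>m \<tau>. LINT \<sigma>:{0..1 / real (Suc m)}|lborel. (LINT z|lborel. flux (\<tau> - \<sigma>, z) * g (\<tau>, z))"
    have m: "flux \<in> borel_measurable (lborel \<Otimes>\<^sub>M lborel)" "g \<in> borel_measurable (lborel \<Otimes>\<^sub>M lborel)"
      by (auto simp: lborel_prod)
    note pair = sigma_finite_lborel m conjugate_exponents(1) p conjugate_exponents(2) flux_integrable gint
    have Jint: "integrable lborel (?J m)" for m
      by (rule integrable_shifted_pairing[OF pair])
    have ev1: "\<forall>\<^sub>F m in sequentially. real (Suc m) * (LINT \<tau>|lborel. ?J m \<tau>)
        \<le> (LINT w|(lborel \<Otimes>\<^sub>M lborel). flux w * g w) + e"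
      by (rule eventually_shifted_pairing_le[OF pair e])
    have "(LINT w|(lborel \<Otimes>\<^sub>M lborel). flux w * g w) = (LINT t|lborel. (LINT z|lborel. flux (t, z) * g (t, z)))"
      by (rule lborel_pair.integral_fst'[OF integrable_pairing[OF pair], symmetric])
    also have "\<dots> = (LINT t:{t1..t2}|lborel. energy t (trunc \<beta> t))"
      unfolding set_lebesgue_integral_def
      using t flux_pairing_integral[OF bar] by (intro Bochner_Integration.integral_cong) (auto simp: g_def indicator_def)
    finally have val: "(LINT w|(lborel \<Otimes>\<^sub>M lborel). flux w * g w) = (LINT t:{t1..t2}|lborel. energy t (trunc \<beta> t))" .
    \<comment> \<open>Steps starting after t1 must not reach back beyond a, hence h < t1 -
      a.\<close>
    obtain n where n: "1 / real (Suc n) < t1 - a" using nat_approx_posE[of "t1 - a"] t by auto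
    have ev2: "\<forall>\<^sub>F m in sequentially. 1 / real (Suc m) < t1 - a"
      unfolding eventually_sequentially
    proof (intro exI allI impI)
      fix m assume "n \<le> m"
      then have "1 / real (Suc m) \<le> 1 / real (Suc n)" by (simp add: frac_le)
      with n show "1 / real (Suc m) < t1 - a" by linarith
    qed
    have ev3: "\<forall>\<^sub>F m in sequentially. real (Suc m) * (LINT \<tau>:{t1..t2}|lborel. F \<tau> - F (\<tau> - 1 / real (Suc m)))
        \<le> (LINT t:{t1..t2}|lborel. energy t (trunc \<beta> t)) + e"
      using ev1 ev2
    proof eventually_elim
      case (elim m)
      let ?h = "1 / real (Suc m)"
      have Fsh: "set_integrable lborel {t1..t2} (\<lambda>\<tau>. F \<tau> - F (\<tau> - ?h))"
      proof (rule set_integral_diff(1)[OF Fint])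
        have eq: "(\<lambda>\<tau>. indicat_real {t1 - ?h..t2 - ?h} (- ?h + 1 * \<tau>) *\<^sub>R F (- ?h + 1 * \<tau>)) = (\<lambda>\<tau>. indicat_real {t1..t2} \<tau> *\<^sub>R F (\<tau> - ?h))"
          by (auto simp: indicator_def)
        show "set_integrable lborel {t1..t2} (\<lambda>\<tau>. F (\<tau> - ?h))"
          using lborel_integrable_real_affine[OF Fint[of "t1 - ?h" "t2 - ?h", unfolded set_integrable_def], of 1 "- ?h"]
          unfolding eq set_integrable_def by simp
      qed
      have "(LINT \<tau>:{t1..t2}|lborel. F \<tau> - F (\<tau> - ?h)) \<le> (LINT \<tau>|lborel. ?J m \<tau>)"
        unfolding set_lebesgue_integral_def[of _ "{t1..t2}"]
      proof (rule integral_mono_AE)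
        show "integrable lborel (\<lambda>\<tau>. indicat_real {t1..t2} \<tau> *\<^sub>R (F \<tau> - F (\<tau> - ?h)))"
          using Fsh by (simp add: set_integrable_def)
        show "integrable lborel (?J m)" by (rule Jint)
        show "AE \<tau> in lborel. indicat_real {t1..t2} \<tau> *\<^sub>R (F \<tau> - F (\<tau> - ?h)) \<le> ?J m \<tau>"
          using bregman_int_step[OF bar]
        proof eventually_elim
          case st: (elim \<tau>)
          show ?case
          proof (cases "\<tau> \<in> {t1..t2}")
            case True
            then have "a < \<tau> - ?h" "\<tau> < b" using elim(2) t by auto
            with st have "F \<tau> - F (\<tau> - ?h)
              \<le> (LINT \<sigma>:{0..?h}|lborel. (LINT z|lborel. flux (\<tau> - \<sigma>, z) * trunc_quotient \<beta> (\<tau>, z)))"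
              unfolding F_def by blast
            then show ?thesis using True by (simp add: g_def)
          next
            case False
            then show ?thesis by (simp add: g_def set_lebesgue_integral_def)
          qed
        qed
      qed
      then have "real (Suc m) * (LINT \<tau>:{t1..t2}|lborel. F \<tau> - F (\<tau> - ?h)) \<le> real (Suc m) * (LINT \<tau>|lborel. ?J m \<tau>)"
        by (intro mult_left_mono) auto
      with elim(1) show ?case unfolding val by linarith
    qed
    have "(\<lambda>m. real (Suc m) * (LINT \<sigma>:{0..1 / real (Suc m)}|lborel. F (t2 - \<sigma>))
        - real (Suc m) * (LINT \<sigma>:{0..1 / real (Suc m)}|lborel. F (t1 - \<sigma>))) \<longlonglongrightarrow> F t2 - F t1"
      using t unfolding G'_def by (intro tendsto_diff) auto
    moreover have "real (Suc m) * (LINT \<tau>:{t1..t2}|lborel. F \<tau> - F (\<tau> - 1 / real (Suc m)))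
        = real (Suc m) * (LINT \<sigma>:{0..1 / real (Suc m)}|lborel. F (t2 - \<sigma>))
        - real (Suc m) * (LINT \<sigma>:{0..1 / real (Suc m)}|lborel. F (t1 - \<sigma>))" for m
      using t by (subst set_integral_shift_difference[OF Fint]) (auto simp: right_diff_distrib)
    ultimately have "(\<lambda>m. real (Suc m) * (LINT \<tau>:{t1..t2}|lborel. F \<tau> - F (\<tau> - 1 / real (Suc m)))) \<longlonglongrightarrow> F t2 - F t1"
      by simp
    from tendsto_upperbound[OF this ev3] show "F t2 - F t1 \<le> (LINT t:{t1..t2}|lborel. energy t (trunc \<beta> t)) + e"
      by simp
  qed
  ultimately show ?thesis using that[of G'] unfolding F_def by blast
qed

end

section \<open>Decay of sublevel sets\<close>

text \<open>Moving x towards x0 by the fraction \<rho> / (2 r) displaces it by at most \<rho> / 2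
  and places it at depth at least \<rho> / 2 in the ball. So even points near the boundary see a
  fixed proportion of a small ball inside.\<close>

lemma ball_subset_inter:
  fixes x0 :: "'a::real_normed_vector"
  assumes "x \<in> ball x0 r" "0 < \<rho>" "\<rho> \<le> r"
  obtains c where "ball c (\<rho> / 2) \<subseteq> ball x \<rho> \<inter> ball x0 r"
proof -
  define e where "e = \<rho> / (2 * r)"
  have e: "0 < e" "e \<le> 1 / 2" "e * r = \<rho> / 2" using assms by (auto simp: e_def field_simps)
  define c where "c = x0 + (1 - e) *\<^sub>R (x - x0)"
  have n: "norm (x - x0) < r" using assms(1) by (simp add: dist_norm norm_minus_commute)
  have "x - c = e *\<^sub>R (x - x0)" unfolding c_def by (simp add: algebra_simps)
  then have "norm (x - c) = e * norm (x - x0)" using e by simp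
  also have "\<dots> \<le> \<rho> / 2" using n e by (simp flip: e(3))
  finally have 1: "dist x c \<le> \<rho> / 2" by (simp add: dist_norm)
  have "norm (c - x0) = (1 - e) * norm (x - x0)" using e unfolding c_def by simp
  also have "\<dots> \<le> (1 - e) * r" using n e by (intro mult_left_mono) auto
  also have "\<dots> = r - \<rho> / 2" using e by (simp add: algebra_simps)
  finally have 2: "dist x0 c \<le> r - \<rho> / 2" by (simp add: dist_norm norm_minus_commute)
  have "y \<in> ball x \<rho> \<inter> ball x0 r" if "y \<in> ball c (\<rho> / 2)" for y
    using that 1 2 dist_triangle[of x y c] dist_triangle[of x0 y c] by auto
  then show ?thesis using that by blast
qed

section \<open>Sublevel sets, cone barriers and the energy of a time slice\<close>

context nonlocal_problem begin

definition sublevel :: "real \<Rightarrow> real \<Rightarrow> real \<Rightarrow> 'a set" where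
  "sublevel r l t = {x \<in> ball x0 r. U (x, t) < l}"

definition sublevel_measure :: "real \<Rightarrow> real \<Rightarrow> real \<Rightarrow> real" where
  "sublevel_measure r l t = measure lborel (sublevel r l t)"

text \<open>Across the annulus from r' to r the slope 2 M / (r - r') lowers the level by 2 M, enough
  to reach - M from any l \<le> M.\<close>

definition cone :: "real \<Rightarrow> real \<Rightarrow> real \<Rightarrow> 'a \<Rightarrow> real" where
  "cone r' r l x = max (- M) (min l (l - 2 * M / (r - r') * (norm (x - x0) - r')))"

lemma cone_barrier:
  assumes r: "r' < r" "r \<le> R" and l: "\<bar>l\<bar> \<le> M"
  shows "barrier (2 * M / (r - r')) (cone r' r l)"
proof -
  let ?L = "2 * M / (r - r')"
  have L: "0 < ?L" using r M by simp
  have "\<bar>cone r' r l x - cone r' r l y\<bar> \<le> ?L * norm (x - y)" for x y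
  proof -
    have "\<bar>cone r' r l x - cone r' r l y\<bar> \<le> \<bar>?L * (norm (x - x0) - r') - ?L * (norm (y - x0) - r')\<bar>"
      unfolding cone_def by linarith
    also have "\<dots> = \<bar>?L * (norm (x - x0) - norm (y - x0))\<bar>"
      by (simp only: right_diff_distrib)
    also have "\<dots> = ?L * \<bar>norm (x - x0) - norm (y - x0)\<bar>"
      using L by (simp only: abs_mult)
    also have "\<dots> \<le> ?L * norm (x - y)"
      using L norm_triangle_ineq3[of "x - x0" "y - x0"] by (intro mult_left_mono) auto
    finally show ?thesis .
  qed
  moreover have "cone r' r l x = - M" if "x \<notin> ball x0 R" for x
  proof -
    have "r \<le> norm (x - x0)" using that r by (simp add: dist_norm norm_minus_commute)
    then have "?L * (r - r') \<le> ?L * (norm (x - x0) - r')" using L by (intro mult_left_mono) auto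
    then have "2 * M \<le> ?L * (norm (x - x0) - r')" using r by simp
    then show ?thesis using l unfolding cone_def by linarith
  qed
  moreover have "cone r' r l \<in> borel_measurable borel"
    unfolding cone_def[abs_def] by measurable
  ultimately show ?thesis
    using L l M unfolding barrier_def by (auto simp: cone_def abs_le_iff)
qed

lemma cone_inner:
  assumes "r' < r" "\<bar>l\<bar> \<le> M" "x \<in> ball x0 r'"
  shows "cone r' r l x = l"
proof -
  have "norm (x - x0) - r' \<le> 0" using assms by (simp add: dist_norm norm_minus_commute)
  then have "2 * M / (r - r') * (norm (x - x0) - r') \<le> 0"
    using assms M by (intro mult_nonneg_nonpos) auto
  then show ?thesis using assms unfolding cone_def by linarith
qed

lemma cone_outer:
  assumes "r' < r" "\<bar>l\<bar> \<le> M" "x \<notin> ball x0 r"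
  shows "cone r' r l x = - M"
proof -
  have "r \<le> norm (x - x0)" using assms by (simp add: dist_norm norm_minus_commute)
  then have "2 * M / (r - r') * (r - r') \<le> 2 * M / (r - r') * (norm (x - x0) - r')"
    using assms M by (intro mult_left_mono) auto
  then have "2 * M \<le> 2 * M / (r - r') * (norm (x - x0) - r')" using assms by simp
  then show ?thesis using assms unfolding cone_def by linarith
qed

text \<open>The cone is at most l everywhere and equals - M \<le> U off the ball. So the truncation
  and the Bregman density live on the sublevel set, whose measure is the quantity to be
  iterated.\<close>

lemma less_cone_sublevel:
  assumes "r' < r" "\<bar>l\<bar> \<le> M" "U (x, t) < cone r' r l x"
  shows "x \<in> sublevel r l t"
proof (cases "x \<in> ball x0 r")
  case True
  have "cone r' r l x \<le> l" using assms(2) unfolding cone_def by (auto simp: abs_le_iff)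
  with True assms show ?thesis by (simp add: sublevel_def)
next
  case False
  then show ?thesis using cone_outer[OF assms(1,2) False] U_le[of "(x, t)"] assms(3) by auto
qed

lemma sublevel_measurable[measurable]: "sublevel r l t \<in> sets borel"
proof -
  have "sublevel r l t = ball x0 r \<inter> ((\<lambda>x. U (x, t)) -` {..<l} \<inter> space borel)" by (auto simp: sublevel_def)
  also have "\<dots> \<in> sets borel" by (intro sets.Int measurable_sets[of _ borel borel]) (simp_all, measurable)
  finally show ?thesis .
qed

lemma sublevel_finite: "emeasure lborel (sublevel r l t) < \<infinity>"
  by (rule emeasure_bounded_finite) (auto intro: bounded_subset[OF bounded_ball[of x0 r]] simp: sublevel_def)

lemma emeasure_sublevel: "emeasure lborel (sublevel r l t) = ennreal (sublevel_measure r l t)"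
  using sublevel_finite[of r l t] by (simp add: sublevel_measure_def emeasure_eq_ennreal_measure less_top)

lemma sublevel_measure_nonneg: "0 \<le> sublevel_measure r l t"
  by (simp add: sublevel_measure_def)

lemma sublevel_measure_mono:
  assumes "r \<le> r'" "l \<le> l'"
  shows "sublevel_measure r l t \<le> sublevel_measure r' l' t"
  unfolding sublevel_measure_def
  by (rule measure_mono_fmeasurable)
     (use assms sublevel_finite[of r' l' t] in \<open>auto simp: sublevel_def fmeasurable_def subset_iff\<close>)

lemma sublevel_measure_le: "sublevel_measure r l t \<le> measure lborel (ball x0 r)"
  unfolding sublevel_measure_def
  by (rule measure_mono_fmeasurable)
     (use emeasure_bounded_finite[OF bounded_ball, of x0 r] in \<open>auto simp: sublevel_def fmeasurable_def\<close>)

lemma sublevel_measure_measurable[measurable]: "sublevel_measure r l \<in> borel_measurable borel"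
proof -
  have "sublevel_measure r l t = (LINT x|lborel. indicat_real (ball x0 r) x * (if U (x, t) < l then 1 else 0))" for t
  proof -
    have "sublevel_measure r l t = (LINT x|lborel. indicat_real (sublevel r l t) x)"
      by (simp add: sublevel_measure_def)
    then show ?thesis by (auto simp: sublevel_def indicator_def intro!: Bochner_Integration.integral_cong)
  qed
  moreover have [measurable]: "ball x0 r \<in> sets borel" by simp
  moreover have "(\<lambda>t. LINT x|lborel. indicat_real (ball x0 r) x * (if U (x, t) < l then 1 else 0)) \<in> borel_measurable borel"
    by measurable
  ultimately show ?thesis by presburger
qed

lemma sublevel_measure_set_integrable: "set_integrable lborel {c..d} (sublevel_measure r l)"
  unfolding set_integrable_def
proof (rule Bochner_Integration.integrable_bound)
  let ?K = "measure lborel (ball x0 r)"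
  show "integrable lborel (\<lambda>x. ?K * indicat_real {c..d} x)"
    by (intro integrable_mult_right integrable_real_indicator) (auto simp: emeasure_lborel_Icc_eq)
  show "AE t in lborel. norm (indicat_real {c..d} t *\<^sub>R sublevel_measure r l t) \<le> norm (?K * indicat_real {c..d} t)"
    using sublevel_measure_le sublevel_measure_nonneg by (auto intro!: AE_I2 simp: indicator_def)
qed measurable

lemma bregman_int_cone_le:
  assumes "r' < r" "r \<le> R" "\<bar>l\<bar> \<le> M"
  shows "bregman_int (cone r' r l) t \<le> 3 * M powr (q + 1) * sublevel_measure r l t"
proof -
  note bar = cone_barrier[OF assms]
  have "bregman_int (cone r' r l) t \<le> (LINT x|lborel. 3 * M powr (q + 1) * indicat_real (sublevel r l t) x)"
    unfolding bregman_int_def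
  proof (rule integral_mono[OF bregman_int_integrable[OF bar]])
    show "integrable lborel (\<lambda>x. 3 * M powr (q + 1) * indicat_real (sublevel r l t) x)"
      using sublevel_finite by (intro integrable_mult_right integrable_real_indicator) auto
    fix x
    show "bregman q (cone r' r l x) (U (x, t)) \<le> 3 * M powr (q + 1) * indicat_real (sublevel r l t) x"
    proof (cases "x \<in> sublevel r l t")
      case True
      have "bregman q (cone r' r l x) (U (x, t)) \<le> 3 * M powr (q + 1)"
        using bar U_le by (intro bregman_le[OF q]) (auto simp: barrier_def)
      then show ?thesis using True by simp
    next
      case False
      then have "cone r' r l x \<le> U (x, t)" using less_cone_sublevel[OF assms(1,3)] by force
      then show ?thesis using False by (simp add: bregman_def)
    qed
  qed
  then show ?thesis by (simp add: sublevel_measure_def)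
qed

text \<open>On the inner ball the cone is the constant l, so each point below the lower level l'
  contributes the full quadratic amount.\<close>

lemma bregman_int_cone_ge:
  assumes "r' < r" "r \<le> R" "\<bar>l\<bar> \<le> M" "l' \<le> l"
    and c0: "0 \<le> c0" "\<And>u. u \<le> l' \<Longrightarrow> c0 * (l - l')\<^sup>2 \<le> bregman q l u"
  shows "c0 * (l - l')\<^sup>2 * sublevel_measure r' l' t \<le> bregman_int (cone r' r l) t"
proof -
  note bar = cone_barrier[OF assms(1-3)]
  have "(LINT x|lborel. c0 * (l - l')\<^sup>2 * indicat_real (sublevel r' l' t) x) \<le> bregman_int (cone r' r l) t"
    unfolding bregman_int_def
  proof (rule integral_mono[OF _ bregman_int_integrable[OF bar]])
    show "integrable lborel (\<lambda>x. c0 * (l - l')\<^sup>2 * indicat_real (sublevel r' l' t) x)"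
      using sublevel_finite by (intro integrable_mult_right integrable_real_indicator) auto
    fix x
    show "c0 * (l - l')\<^sup>2 * indicat_real (sublevel r' l' t) x \<le> bregman q (cone r' r l x) (U (x, t))"
      using c0(2)[of "U (x, t)"] cone_inner[OF assms(1,3), of x] bregman_nonneg[OF q]
      by (auto simp: indicator_def sublevel_def)
  qed
  then show ?thesis by (simp add: sublevel_measure_def)
qed

text \<open>The truncated kernel bound for the cone, with Lipschitz constant 2 M / (r - r') and
  oscillation 2 M, times \<Lambda> from the kernel. The 2 accounts for either point of a pair lying
  in the sublevel set.\<close>

definition energy_const :: "real \<Rightarrow> real \<Rightarrow> real" where
  "energy_const r' r = 2 * \<Lambda> * C * (2 * M / (r - r')) powr (p * s) * (2 * M) powr (p - p * s)"

text \<open>The set where the nonlocal term is coercive: pairs of nearby points in the inner ball, the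
  first one deep in the sublevel set, the second one outside of it.\<close>
definition good_pairs :: "real \<Rightarrow> real \<Rightarrow> real \<Rightarrow> real \<Rightarrow> real \<Rightarrow> ('a \<times> 'a) set" where
  "good_pairs \<rho> r' l l' t = {z. fst z \<in> sublevel r' l' t \<and> snd z \<in> ball x0 r' \<and>
     norm (fst z - snd z) < \<rho> \<and> l \<le> U (snd z, t)}"

lemma good_pairs_measurable[measurable]: "good_pairs \<rho> r' l l' t \<in> sets borel"
proof -
  have ball: "ball x0 r' \<in> sets borel" by simp
  have [measurable]: "Measurable.pred borel (\<lambda>z :: 'a \<times> 'a. fst z \<in> sublevel r' l' t)"
    "Measurable.pred borel (\<lambda>z :: 'a \<times> 'a. snd z \<in> ball x0 r')"
    by (rule pred_sets2[OF sublevel_measurable borel_measurable_fst_snd(1)],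
        rule pred_sets2[OF ball borel_measurable_fst_snd(2)])
  have "good_pairs \<rho> r' l l' t = {z \<in> space borel. fst z \<in> sublevel r' l' t \<and> snd z \<in> ball x0 r' \<and>
     norm (fst z - snd z) < \<rho> \<and> l \<le> U (snd z, t)}" by (auto simp: good_pairs_def)
  also have "\<dots> \<in> sets borel" by measurable
  finally show ?thesis .
qed

lemma good_pairs_finite: "emeasure lborel (good_pairs \<rho> r' l l' t) < \<infinity>"
proof (rule emeasure_bounded_finite)
  have "good_pairs \<rho> r' l l' t \<subseteq> ball x0 r' \<times> ball x0 r'"
    by (auto simp: good_pairs_def sublevel_def)
  then show "bounded (good_pairs \<rho> r' l l' t)"
    by (rule bounded_subset[OF bounded_Times[OF bounded_ball bounded_ball]])
qed

text \<open>Each x in the inner sublevel set has a ball of radius \<rho> / 2 inside both its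
  \<rho>-ball and the ball of radius r'. What the outer sublevel set leaves of it are partners of x;
  integrating over x gives the product. A negative bracket is harmless, as \<open>ennreal\<close>
  turns it into 0.\<close>

lemma good_pairs_measure:
  assumes \<rho>: "0 < \<rho>" "\<rho> \<le> r'" and r: "r' \<le> r"
  shows "sublevel_measure r' l' t * (unit_ball_vol (real DIM('a)) * (\<rho> / 2) ^ DIM('a) - sublevel_measure r l t)
    \<le> measure lborel (good_pairs \<rho> r' l l' t)"
proof -
  let ?v = "unit_ball_vol (real DIM('a)) * (\<rho> / 2) ^ DIM('a)"
  let ?N = "sublevel_measure r l t" and ?N' = "sublevel_measure r' l' t"
  have inner: "ennreal (?v - ?N) \<le> (\<integral>\<^sup>+y. indicator (good_pairs \<rho> r' l l' t) (x, y) \<partial>lborel)"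
    if x: "x \<in> sublevel r' l' t" for x
  proof -
    have "x \<in> ball x0 r'" using x by (simp add: sublevel_def)
    from ball_subset_inter[OF this \<rho>] obtain c where c: "ball c (\<rho> / 2) \<subseteq> ball x \<rho> \<inter> ball x0 r'" .
    have "ennreal (?v - ?N) = emeasure lborel (ball c (\<rho> / 2)) - emeasure lborel (sublevel r l t)"
      using \<rho> by (subst emeasure_ball) (auto simp: emeasure_sublevel ennreal_minus sublevel_measure_nonneg)
    also have "\<dots> \<le> emeasure lborel (ball c (\<rho> / 2) - sublevel r l t)"
    proof -
      have "emeasure lborel (ball c (\<rho> / 2)) \<le> emeasure lborel ((ball c (\<rho> / 2) - sublevel r l t) \<union> sublevel r l t)"
        by (rule emeasure_mono) auto
      also have "\<dots> \<le> emeasure lborel (ball c (\<rho> / 2) - sublevel r l t) + emeasure lborel (sublevel r l t)"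
        by (rule emeasure_subadditive) auto
      finally show ?thesis
        using sublevel_finite[of r l t] by (subst ennreal_minus_le_iff) (auto simp: add.commute)
    qed
    also have "\<dots> = (\<integral>\<^sup>+y. indicator (ball c (\<rho> / 2) - sublevel r l t) y \<partial>lborel)"
      by simp
    also have "\<dots> \<le> (\<integral>\<^sup>+y. indicator (good_pairs \<rho> r' l l' t) (x, y) \<partial>lborel)"
    proof (intro nn_integral_mono)
      fix y
      have "(x, y) \<in> good_pairs \<rho> r' l l' t" if "y \<in> ball c (\<rho> / 2) - sublevel r l t"
        using that c x r by (force simp: good_pairs_def sublevel_def dist_norm)
      then show "indicator (ball c (\<rho> / 2) - sublevel r l t) y \<le> (indicator (good_pairs \<rho> r' l l' t) (x, y) :: ennreal)"
        by (auto simp: indicator_def)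
    qed
    finally show ?thesis .
  qed
  have "ennreal (?v - ?N) * ennreal ?N' = (\<integral>\<^sup>+x. ennreal (?v - ?N) * indicator (sublevel r' l' t) x \<partial>lborel)"
    by (subst nn_integral_cmult_indicator) (auto simp: emeasure_sublevel)
  also have "\<dots> \<le> (\<integral>\<^sup>+x. \<integral>\<^sup>+y. indicator (good_pairs \<rho> r' l l' t) (x, y) \<partial>lborel \<partial>lborel)"
    by (intro nn_integral_mono) (auto simp: indicator_def[of "sublevel r' l' t"] inner)
  also have "\<dots> = emeasure lborel (good_pairs \<rho> r' l l' t)"
    by (subst nn_integral_lborel_prod[symmetric]) auto
  also have "\<dots> = ennreal (measure lborel (good_pairs \<rho> r' l l' t))"
    using good_pairs_finite by (simp add: emeasure_eq_ennreal_measure less_top)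
  finally have "ennreal ((?v - ?N) * ?N') \<le> ennreal (measure lborel (good_pairs \<rho> r' l l' t))"
    by (simp add: ennreal_mult'' sublevel_measure_nonneg)
  then show ?thesis by (simp add: ennreal_le_iff mult.commute)
qed

text \<open>Pairs without a point in the sublevel set contribute nothing, the others at most the
  energy of the cone. On good pairs the cone is constant, and the contribution is negative, of size
  given by the level gap and the proximity of the points. The number c may be anything up to this
  coercivity constant; c = 0 drops the gain.\<close>

lemma energy_le:
  assumes r: "0 < r'" "r' < r" "r \<le> R" and l: "\<bar>l\<bar> \<le> M" "l' < l" and \<rho>: "0 < \<rho>" "\<rho> \<le> r'"
    and c: "0 \<le> c" "c \<le> inverse \<Lambda> * (l - l') powr p * \<rho> powr (- (real DIM('a) + p * s))"
    and int: "integrable lborel (\<lambda>z. signed_pow (p - 1) (dU t z) *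
      (trunc (cone r' r l) t (fst z) - trunc (cone r' r l) t (snd z)) * k t (fst z) (snd z))"
  shows "energy t (trunc (cone r' r l) t) \<le> energy_const r' r * sublevel_measure r l t
    - c * (sublevel_measure r' l' t *
      (unit_ball_vol (real DIM('a)) * (\<rho> / 2) ^ DIM('a) - sublevel_measure r l t))"
proof -
  let ?L = "2 * M / (r - r')" and ?P = "sublevel r l t" and ?E = "good_pairs \<rho> r' l l' t"
  let ?\<beta> = "cone r' r l"
  note bar = cone_barrier[OF r(2,3) l(1)]
  have L: "?L > 0" using r M by simp
  \<comment> \<open>Up to the factor \<Lambda>, B majorizes the energy density of the cone on pairs
    with a point in the sublevel set.\<close>
  define B where "B z = (indicat_real ?P (fst z) + indicat_real ?P (snd z)) *
     (min (?L * norm (fst z - snd z)) (2 * M) powr p / kap z)" for z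
  have mB[measurable]: "B \<in> borel_measurable borel"
  proof -
    have [measurable]: "(\<lambda>z :: 'a \<times> 'a. indicat_real ?P (fst z)) \<in> borel_measurable borel"
      "(\<lambda>z :: 'a \<times> 'a. indicat_real ?P (snd z)) \<in> borel_measurable borel"
      by (rule measurable_compose[OF borel_measurable_fst_snd(1)] measurable_compose[OF borel_measurable_fst_snd(2)]; measurable)+
    show ?thesis unfolding B_def[abs_def] by measurable
  qed
  have B0: "0 \<le> B z" for z unfolding B_def by simp
  have Bnn: "(\<integral>\<^sup>+z. ennreal (B z) \<partial>lborel) \<le> ennreal (2 * sublevel_measure r l t * (C * ?L powr (p * s) * (2 * M) powr (p - p * s)))"
  proof -
    have "(\<integral>\<^sup>+z. ennreal (B z) \<partial>lborel) = (\<integral>\<^sup>+z. (indicator ?P (fst z) + indicator ?P (snd z)) *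
      ennreal (min (?L * norm (fst z - snd z)) (2 * M) powr p / kap z) \<partial>lborel)"
    proof -
      have eq: "ennreal ((indicat_real ?P u + indicat_real ?P v) * X) = (indicator ?P u + indicator ?P v) * ennreal X"
        if "X \<ge> 0" for u v X
        using that by (auto simp: indicator_def ennreal_mult'')
      show ?thesis unfolding B_def by (intro nn_integral_cong eq) simp
    qed
    also have "\<dots> \<le> 2 * emeasure lborel ?P * ennreal (C * ?L powr (p * s) * (2 * M) powr (p - p * s))"
      using L M by (intro truncated_kernel_pairs) auto
    also have "\<dots> = ennreal (2 * sublevel_measure r l t * (C * ?L powr (p * s) * (2 * M) powr (p - p * s)))"
      using C by (simp add: emeasure_sublevel ennreal_mult'' ennreal_mult' sublevel_measure_nonneg)
    finally show ?thesis .
  qed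
  have Bint: "integrable lborel B"
    using Bnn by (intro integrableI_nonneg) (auto simp: B0 intro: order.strict_trans1)
  have Ble: "(LINT z|lborel. B z) \<le> 2 * sublevel_measure r l t * (C * ?L powr (p * s) * (2 * M) powr (p - p * s))"
    (is "_ \<le> ?X")
  proof -
    have "ennreal (LINT z|lborel. B z) = (\<integral>\<^sup>+z. ennreal (B z) \<partial>lborel)"
      by (rule nn_integral_eq_integral[symmetric, OF Bint]) (simp add: B0)
    with Bnn have "ennreal (LINT z|lborel. B z) \<le> ennreal ?X" by (simp only:)
    moreover have "0 \<le> ?X" using C sublevel_measure_nonneg[of r l t] by (intro mult_nonneg_nonneg) auto
    ultimately show ?thesis by (simp only: ennreal_le_iff)
  qed
  have pw: "signed_pow (p - 1) (dU t z) * (trunc ?\<beta> t (fst z) - trunc ?\<beta> t (snd z)) * k t (fst z) (snd z)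
      \<le> \<Lambda> * B z - c * indicat_real ?E z" for z
  proof (cases "z \<in> ?E")
    case True
    then have z: "fst z \<in> ball x0 r'" "U (fst z, t) < l'" "snd z \<in> ball x0 r'" "norm (fst z - snd z) < \<rho>" "l \<le> U (snd z, t)"
      by (auto simp: good_pairs_def sublevel_def)
    have ne: "fst z \<noteq> snd z" using z l by auto
    \<comment> \<open>The points are closer than \<rho>, so the kernel bound at distance \<rho> is
      available from below; this is the power of \<rho> in the condition on c.\<close>
    have kr: "\<rho> powr (- (real DIM('a) + p * s)) \<le> 1 / kap z"
    proof -
      have "kap z \<le> \<rho> powr (real DIM('a) + p * s)" using z(4) p s by (intro powr_mono2) auto
      moreover have "0 < kap z" using ne by simp
      ultimately show ?thesis unfolding powr_minus_divide by (intro frac_le) auto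
    qed
    have le: "signed_pow (p - 1) (dU t z) * (trunc ?\<beta> t (fst z) - trunc ?\<beta> t (snd z)) \<le> - ((l - l') powr p)"
      unfolding trunc_def cone_inner[OF r(2) l(1) z(1)] cone_inner[OF r(2) l(1) z(3)]
      using z l by (intro truncation_energy_coercive[OF p]) auto
    have "signed_pow (p - 1) (dU t z) * (trunc ?\<beta> t (fst z) - trunc ?\<beta> t (snd z)) * k t (fst z) (snd z)
        \<le> - ((l - l') powr p) * k t (fst z) (snd z)"
      by (intro mult_right_mono le k_nonneg)
    also have "\<dots> \<le> - ((l - l') powr p) * (inverse \<Lambda> / kap z)"
      by (intro mult_left_mono_neg k_lower) auto
    also have "\<dots> = - (inverse \<Lambda> * (l - l') powr p * (1 / kap z))" by simp
    also have "\<dots> \<le> - (inverse \<Lambda> * (l - l') powr p * \<rho> powr (- (real DIM('a) + p * s)))"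
      using kr Lam by (intro le_imp_neg_le mult_left_mono) auto
    also have "\<dots> \<le> - c" using c(2) by linarith
    also have "- c \<le> \<Lambda> * B z - c * indicat_real ?E z" using True B0[of z] Lam by simp
    finally show ?thesis .
  next
    case False
    show ?thesis
    proof (cases "fst z \<in> ?P \<or> snd z \<in> ?P")
      case True
      have "signed_pow (p - 1) (dU t z) * (trunc ?\<beta> t (fst z) - trunc ?\<beta> t (snd z)) * k t (fst z) (snd z)
        \<le> \<bar>?\<beta> (fst z) - ?\<beta> (snd z)\<bar> powr p * k t (fst z) (snd z)"
        unfolding trunc_def by (intro mult_right_mono truncation_energy_le[OF p] k_nonneg)
      also have "\<dots> \<le> min (?L * norm (fst z - snd z)) (2 * M) powr p * (\<Lambda> / kap z)"
        using barrier_diff_le[OF bar, of z] p by (intro mult_mono k_upper powr_mono2 k_nonneg) auto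
      also have "\<dots> = \<Lambda> * (1 * (min (?L * norm (fst z - snd z)) (2 * M) powr p / kap z))" by simp
      also have "\<dots> \<le> \<Lambda> * B z"
        unfolding B_def using True Lam by (intro mult_left_mono mult_right_mono) (auto simp: indicator_def)
      finally show ?thesis using False by simp
    next
      case nP: False
      have "trunc ?\<beta> t x = 0" if "x \<notin> ?P" for x
      proof -
        have "\<not> U (x, t) < ?\<beta> x" using that less_cone_sublevel[OF r(2) l(1)] by blast
        then show ?thesis by (simp add: trunc_def)
      qed
      with nP have "trunc ?\<beta> t (fst z) = 0" "trunc ?\<beta> t (snd z) = 0" by auto
      then show ?thesis using False B0[of z] Lam by simp
    qed
  qed
  have Eint: "integrable lborel (indicat_real ?E)"
    using good_pairs_finite by (intro integrable_real_indicator) auto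
  have "energy t (trunc ?\<beta> t) \<le> (LINT z|lborel. \<Lambda> * B z - c * indicat_real ?E z)"
    unfolding energy_def using Bint Eint pw by (intro integral_mono int) auto
  also have "\<dots> = \<Lambda> * (LINT z|lborel. B z) - c * measure lborel ?E"
    using Bint Eint by simp
  also have "\<dots> \<le> \<Lambda> * (2 * sublevel_measure r l t * (C * ?L powr (p * s) * (2 * M) powr (p - p * s)))
      - c * (sublevel_measure r' l' t *
      (unit_ball_vol (real DIM('a)) * (\<rho> / 2) ^ DIM('a) - sublevel_measure r l t))"
    using Ble good_pairs_measure[OF \<rho>, of r l' t l] r Lam c by (intro diff_mono mult_left_mono) auto
  finally show ?thesis by (simp add: energy_const_def algebra_simps)
qed

end

section \<open>One step between two levels\<close>

lemma AE_interval_obtains: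
  fixes c d :: real
  assumes "AE t in lborel. P t" "c < d"
  obtains t where "c < t" "t < d" "P t"
proof (rule ccontr)
  assume "\<not> thesis"
  with assms(1) that have "AE t in lborel. t \<notin> {c<..<d}" by (auto elim!: eventually_mono)
  then have "emeasure lborel {c<..<d} = 0"
    by (subst (asm) AE_iff_measurable[of "{c<..<d}"]) auto
  then show False using assms(2) by simp
qed

lemma set_integral_mono_subset:
  fixes f :: "real \<Rightarrow> real"
  assumes "set_integrable lborel {a..b} f" "\<And>x. 0 \<le> f x" "a \<le> c" "d \<le> b"
  shows "(LINT x:{c..d}|lborel. f x) \<le> (LINT x:{a..b}|lborel. f x)"
proof -
  have "set_integrable lborel {c..d} f" by (rule set_integrable_subset[OF assms(1)]) (use assms in auto)
  then show ?thesis
    using assms unfolding set_lebesgue_integral_def set_integrable_def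
    by (intro integral_mono) (auto simp: indicator_def)
qed

context nonlocal_problem begin

text \<open>The energy inequality is started at a time t1 whose slice measure is controlled by the
  space-time measure, which controls the initial Bregman term. The left-hand side keeps the final
  Bregman term and the coercive gain, and each is used alone below. The condition on m carries the
  factor c so that it is trivial for c = 0.\<close>

lemma decay_core:
  assumes r: "0 < r'" "r' < r" "r \<le> R" and l: "\<bar>l\<bar> \<le> M" "l' < l"
    and \<tau>: "a \<le> \<tau>0" "\<tau>0 < \<tau>1" "\<tau>1 < b" and \<rho>: "0 < \<rho>" "\<rho> \<le> r'"
    and c: "0 \<le> c" "c \<le> inverse \<Lambda> * (l - l') powr p * \<rho> powr (- (real DIM('a) + p * s))"
    and m: "0 \<le> m" "AE t in lborel. \<tau>0 < t \<and> t < b \<longrightarrow>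
      c * m \<le> c * (unit_ball_vol (real DIM('a)) * (\<rho> / 2) ^ DIM('a) - sublevel_measure r l t)"
  shows "AE t2 in lborel. \<tau>1 < t2 \<and> t2 < b \<longrightarrow>
    bregman_int (cone r' r l) t2 + c * m * (LINT t:{\<tau>1..t2}|lborel. sublevel_measure r' l' t)
      \<le> (3 * M powr (q + 1) / (\<tau>1 - \<tau>0) + energy_const r' r) * (LINT t:{\<tau>0..b}|lborel. sublevel_measure r l t)"
proof -
  let ?\<beta> = "cone r' r l" and ?N = "sublevel_measure r l" and ?N' = "sublevel_measure r' l'"
  let ?A = "LINT t:{\<tau>0..b}|lborel. ?N t" and ?EC = "energy_const r' r"
  note bar = cone_barrier[OF r(2,3) l(1)]
  have EC: "0 \<le> ?EC" unfolding energy_const_def using Lam C by simp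
  obtain G' where G': "AE t in lborel. t \<in> G'"
    and en: "\<And>t1 t2. \<lbrakk>a < t1; t1 < t2; t2 < b; t1 \<in> G'; t2 \<in> G'\<rbrakk> \<Longrightarrow>
      bregman_int ?\<beta> t2 - bregman_int ?\<beta> t1 \<le> (LINT t:{t1..t2}|lborel. energy t (trunc ?\<beta> t))"
    using energy_inequality[OF bar] by blast
  \<comment> \<open>Otherwise the slice measure would exceed this bound at almost every time in
    (\<tau>0, \<tau>1), and its integral there would exceed \<open>?A\<close>.\<close>
  have "\<exists>t1. \<tau>0 < t1 \<and> t1 < \<tau>1 \<and> t1 \<in> G' \<and> ?N t1 \<le> ?A / (\<tau>1 - \<tau>0)"
  proof (rule ccontr)
    assume "\<not> ?thesis"
    then have gt: "?A / (\<tau>1 - \<tau>0) < ?N t" if "\<tau>0 < t" "t < \<tau>1" "t \<in> G'" for t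
      using that by force
    let ?h = "\<lambda>t. indicat_real {\<tau>0..\<tau>1} t *\<^sub>R (?N t - ?A / (\<tau>1 - \<tau>0))"
    have ci: "set_integrable lborel {\<tau>0..\<tau>1} (\<lambda>t. ?A / (\<tau>1 - \<tau>0))"
      unfolding set_integrable_def by (intro integrable_scaleR_left integrable_real_indicator) (auto simp: emeasure_lborel_Icc_eq)
    have hi: "integrable lborel ?h"
      using set_integral_diff(1)[OF sublevel_measure_set_integrable ci] by (simp add: set_integrable_def)
    have "(LINT t|lborel. ?h t) = (LINT t:{\<tau>0..\<tau>1}|lborel. ?N t) - ?A"
      using set_integral_diff(2)[OF sublevel_measure_set_integrable ci] \<tau>
      by (simp add: set_lebesgue_integral_def)
    also have "\<dots> \<le> 0"
      using set_integral_mono_subset[OF sublevel_measure_set_integrable[of \<tau>0 b r l], of \<tau>0 \<tau>1] \<tau>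
      by (simp add: sublevel_measure_nonneg)
    finally have le0: "(LINT t|lborel. ?h t) \<le> 0" .
    have "AE t in lborel. t \<noteq> \<tau>0" "AE t in lborel. t \<noteq> \<tau>1" by (auto intro!: AE_lborel_singleton)
    with G' have "AE t in lborel. 0 \<le> ?h t \<and> (\<tau>0 < t \<and> t < \<tau>1 \<longrightarrow> 0 < ?h t)"
    proof eventually_elim
      case (elim t)
      then show ?case using gt[of t] by (auto simp: indicator_def)
    qed
    then have nn: "AE t in lborel. 0 \<le> ?h t" and pos: "AE t in lborel. \<tau>0 < t \<and> t < \<tau>1 \<longrightarrow> 0 < ?h t"
      by auto
    have "(LINT t|lborel. ?h t) = 0" using le0 integral_nonneg_AE[OF nn] by linarith
    with integral_nonneg_eq_0_iff_AE[OF hi nn] have "AE t in lborel. ?h t = 0" by blast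
    with pos have "AE t in lborel. \<not> (\<tau>0 < t \<and> t < \<tau>1)" by eventually_elim auto
    from AE_interval_obtains[OF this \<tau>(2)] show False by blast
  qed
  then obtain t1 where t1: "\<tau>0 < t1" "t1 < \<tau>1" "t1 \<in> G'" "?N t1 \<le> ?A / (\<tau>1 - \<tau>0)" by blast
  have e_le: "AE t in lborel. \<tau>0 < t \<and> t < b \<longrightarrow> energy t (trunc ?\<beta> t) \<le> ?EC * ?N t - c * m * ?N' t"
    using m(2) energy_set_integrable(2)[OF bar]
  proof eventually_elim
    case (elim t)
    show ?case
    proof
      assume t: "\<tau>0 < t \<and> t < b"
      then have "t \<in> {a..b}" using \<tau> by auto
      with elim(2) have "energy t (trunc ?\<beta> t) \<le> ?EC * ?N t - c * (?N' t * (unit_ball_vol (real DIM('a)) * (\<rho> / 2) ^ DIM('a) - ?N t))"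
        by (intro energy_le[OF r l \<rho> c]) simp
      also have "c * (?N' t * (unit_ball_vol (real DIM('a)) * (\<rho> / 2) ^ DIM('a) - ?N t))
          = ?N' t * (c * (unit_ball_vol (real DIM('a)) * (\<rho> / 2) ^ DIM('a) - ?N t))" by simp
      also have "?EC * ?N t - \<dots> \<le> ?EC * ?N t - ?N' t * (c * m)"
        by (rule diff_left_mono, rule mult_left_mono[OF _ sublevel_measure_nonneg]) (use elim(1) t in blast)
      finally show "energy t (trunc ?\<beta> t) \<le> ?EC * ?N t - c * m * ?N' t" by (simp add: mult.commute)
    qed
  qed
  show ?thesis
    using G'
  proof eventually_elim
    case (elim t2)
    show ?case
    proof
      assume t2: "\<tau>1 < t2 \<and> t2 < b"
      have iN: "set_integrable lborel {t1..t2} (\<lambda>t. ?EC * ?N t)" "set_integrable lborel {t1..t2} (\<lambda>t. c * m * ?N' t)"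
        by (auto intro: set_integrable_mult_right sublevel_measure_set_integrable)
      have "bregman_int ?\<beta> t2 - bregman_int ?\<beta> t1 \<le> (LINT t:{t1..t2}|lborel. energy t (trunc ?\<beta> t))"
        using t1 t2 \<tau> elim by (intro en) auto
      also have "\<dots> \<le> (LINT t:{t1..t2}|lborel. ?EC * ?N t - c * m * ?N' t)"
        unfolding set_lebesgue_integral_def
      proof (rule integral_mono_AE)
        show "integrable lborel (\<lambda>t. indicat_real {t1..t2} t *\<^sub>R energy t (trunc ?\<beta> t))"
          using set_integrable_subset[OF energy_set_integrable(1)[OF bar], of "{t1..t2}"] t1 t2 \<tau>
          by (simp add: set_integrable_def)
        show "integrable lborel (\<lambda>t. indicat_real {t1..t2} t *\<^sub>R (?EC * ?N t - c * m * ?N' t))"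
          using set_integral_diff(1)[OF iN] by (simp add: set_integrable_def)
        show "AE t in lborel. indicat_real {t1..t2} t *\<^sub>R energy t (trunc ?\<beta> t)
            \<le> indicat_real {t1..t2} t *\<^sub>R (?EC * ?N t - c * m * ?N' t)"
          using e_le by eventually_elim (use t1 t2 in \<open>auto simp: indicator_def\<close>)
      qed
      also have "\<dots> = ?EC * (LINT t:{t1..t2}|lborel. ?N t) - c * m * (LINT t:{t1..t2}|lborel. ?N' t)"
        using set_integral_diff(2)[OF iN] by simp
      also have "\<dots> \<le> ?EC * ?A - c * m * (LINT t:{\<tau>1..t2}|lborel. ?N' t)"
        using t1 t2 \<tau> EC c m(1)
        by (intro diff_mono mult_left_mono set_integral_mono_subset sublevel_measure_set_integrable sublevel_measure_nonneg) auto
      finally have "bregman_int ?\<beta> t2 + c * m * (LINT t:{\<tau>1..t2}|lborel. ?N' t) \<le> bregman_int ?\<beta> t1 + ?EC * ?A"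
        by linarith
      also have "bregman_int ?\<beta> t1 \<le> 3 * M powr (q + 1) * (?A / (\<tau>1 - \<tau>0))"
        using bregman_int_cone_le[OF r(2,3) l(1), of t1] t1(4)
        by (elim order_trans) (intro mult_left_mono, auto)
      finally show "bregman_int ?\<beta> t2 + c * m * (LINT t:{\<tau>1..t2}|lborel. ?N' t)
          \<le> (3 * M powr (q + 1) / (\<tau>1 - \<tau>0) + ?EC) * ?A"
        by (simp add: distrib_right)
    qed
  qed
qed

text \<open>With c = m = 0 the coercive gain is dropped, and the quadratic lower bound of the
  Bregman term turns a space-time measure into a bound for slices at almost all times.\<close>

lemma decay_sup:
  assumes r: "0 < r'" "r' < r" "r \<le> R" and l: "\<bar>l\<bar> \<le> M" "l' < l"
    and \<tau>: "a \<le> \<tau>0" "\<tau>0 < \<tau>1" "\<tau>1 < b"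
    and c0: "0 \<le> c0" "\<And>u. u \<le> l' \<Longrightarrow> c0 * (l - l')\<^sup>2 \<le> bregman q l u"
  shows "AE t in lborel. \<tau>1 < t \<and> t < b \<longrightarrow> c0 * (l - l')\<^sup>2 * sublevel_measure r' l' t
      \<le> (3 * M powr (q + 1) / (\<tau>1 - \<tau>0) + energy_const r' r) * (LINT t:{\<tau>0..b}|lborel. sublevel_measure r l t)"
proof -
  have "0 \<le> inverse \<Lambda> * (l - l') powr p * r' powr (- (real DIM('a) + p * s))" using Lam by simp
  from decay_core[OF r l \<tau> r(1) order_refl order_refl this, of 0]
  have "AE t in lborel. \<tau>1 < t \<and> t < b \<longrightarrow> bregman_int (cone r' r l) t
    \<le> (3 * M powr (q + 1) / (\<tau>1 - \<tau>0) + energy_const r' r) * (LINT t:{\<tau>0..b}|lborel. sublevel_measure r l t)"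
    by simp
  then show ?thesis
    by eventually_elim (use bregman_int_cone_ge[OF r(2,3) l(1) less_imp_le[OF l(2)] c0] in \<open>auto intro: order_trans\<close>)
qed

text \<open>Here the Bregman term is dropped instead. A ball of radius \<rho> / 2 has measure 2 m,
  so at least m of it remains after removal of a slice of measure at most m.\<close>

lemma decay_measure:
  assumes r: "0 < r'" "r' < r" "r \<le> R" and l: "\<bar>l\<bar> \<le> M" "l' < l"
    and \<tau>: "a \<le> \<tau>0" "\<tau>0 < \<tau>1" "\<tau>1 < b" and \<rho>: "0 < \<rho>" "\<rho> \<le> r'"
    and m: "0 \<le> m" "AE t in lborel. \<tau>0 < t \<and> t < b \<longrightarrow> sublevel_measure r l t \<le> m"
    and \<rho>m: "unit_ball_vol (real DIM('a)) * (\<rho> / 2) ^ DIM('a) = 2 * m"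
  shows "inverse \<Lambda> * (l - l') powr p * \<rho> powr (- (real DIM('a) + p * s)) * m * (LINT t:{\<tau>1..b}|lborel. sublevel_measure r' l' t)
      \<le> (3 * M powr (q + 1) / (\<tau>1 - \<tau>0) + energy_const r' r) * (LINT t:{\<tau>0..b}|lborel. sublevel_measure r l t)"
    (is "?c * m * ?I b \<le> ?X")
proof (rule field_le_epsilon)
  fix e :: real assume e: "0 < e"
  let ?c = "inverse \<Lambda> * (l - l') powr p * \<rho> powr (- (real DIM('a) + p * s))"
  have c: "0 \<le> ?c" using Lam by simp
  have "AE t in lborel. \<tau>0 < t \<and> t < b \<longrightarrow>
      ?c * m \<le> ?c * (unit_ball_vol (real DIM('a)) * (\<rho> / 2) ^ DIM('a) - sublevel_measure r l t)"
    using m(2) by eventually_elim (use c in \<open>auto simp: \<rho>m intro!: mult_left_mono\<close>)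
  from decay_core[OF r l \<tau> \<rho> c order_refl m(1) this]
  have core: "AE t2 in lborel. \<tau>1 < t2 \<and> t2 < b \<longrightarrow> bregman_int (cone r' r l) t2 + ?c * m * ?I t2 \<le> ?X" .
  let ?V = "measure lborel (ball x0 r')"
  \<comment> \<open>\<open>decay_core\<close> concerns almost every t2 < b. Stopping within \<delta>
    of b loses at most e; the summand 1 keeps the denominator positive.\<close>
  define \<delta> where "\<delta> = e / (?c * m * ?V + 1)"
  have K: "0 \<le> ?c * m * ?V" using c m by simp
  have \<delta>: "0 < \<delta>" using e K by (simp add: \<delta>_def add_nonneg_pos)
  from \<tau> \<delta> have "max \<tau>1 (b - \<delta>) < b" by simp
  from AE_interval_obtains[OF core this] obtain t2 where t2: "max \<tau>1 (b - \<delta>) < t2" "t2 < b"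
    and X: "bregman_int (cone r' r l) t2 + ?c * m * ?I t2 \<le> ?X" by auto
  have "?I b \<le> ?I t2 + \<delta> * ?V"
  proof -
    have int: "sublevel_measure r' l' integrable_on {x..y}" and val: "(LINT t:{x..y}|lborel. sublevel_measure r' l' t) = integral {x..y} (sublevel_measure r' l')" for x y
      using set_borel_integral_eq_integral[OF sublevel_measure_set_integrable[of x y r' l']] by auto
    have "integral {\<tau>1..t2} (sublevel_measure r' l') + integral {t2..b} (sublevel_measure r' l') = integral {\<tau>1..b} (sublevel_measure r' l')"
      using t2 int by (intro Henstock_Kurzweil_Integration.integral_combine) auto
    moreover have "integral {t2..b} (sublevel_measure r' l') \<le> integral {t2..b} (\<lambda>_. ?V)"
      by (intro integral_le int) (auto simp: sublevel_measure_le)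
    moreover have "integral {t2..b} (\<lambda>_. ?V) \<le> \<delta> * ?V" using t2 by (simp add: mult_right_mono)
    ultimately show ?thesis by (simp add: val)
  qed
  then have "?c * m * ?I b \<le> ?c * m * (?I t2 + \<delta> * ?V)" using c m by (intro mult_left_mono) auto
  also have "\<dots> = ?c * m * ?I t2 + (?c * m * ?V) * \<delta>" by (simp add: algebra_simps)
  also have "(?c * m * ?V) * \<delta> \<le> e"
  proof -
    have "x * (e / (x + 1)) \<le> e" if "0 \<le> x" for x
      using e that by (simp add: field_simps)
    then show ?thesis unfolding \<delta>_def using K by blast
  qed
  also have "?c * m * ?I t2 \<le> ?X"
  proof -
    have "0 \<le> bregman_int (cone r' r l) t2" by (rule bregman_int_bounds(1)[OF cone_barrier[OF r(2,3) l(1)]])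
    with X show ?thesis by linarith
  qed
  finally show "?c * m * ?I b \<le> ?X + e" by simp
qed

end

section \<open>The iteration over levels\<close>

lemma power_powr_commute: "0 < x \<Longrightarrow> (x ^ j) powr g = (x powr g) ^ j" for x g :: real
  by (simp add: powr_powr mult.commute flip: powr_realpow)

text \<open>\<open>decay_sup\<close> turns the space-time measure A i into a bound m (i + 1) for
  slices; with it \<open>decay_measure\<close> passes from A (i + 1) to A (i + 2), gaining the
  factor m^\<gamma>. This superlinear gain beats the geometric growth of the constants if A 0 is
  small. The threshold is produced before U, k and the cylinder, of which only the ratio \<sigma>
  enters: the smallness may thus be sought at any radius.\<close>

lemma de_giorgi:
  fixes p q s \<Lambda> M C c0 \<epsilon> l \<sigma> :: real
  assumes p: "1 < p" and q: "0 < q" and s: "0 < s" "s < 1" and Lam: "1 \<le> \<Lambda>" and M: "0 < M" and C: "0 < C"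
    and \<sigma>: "0 < \<sigma>" and \<epsilon>: "0 < \<epsilon>" and c0: "0 < c0" and l: "\<bar>l\<bar> \<le> M" "\<bar>l - \<epsilon>\<bar> \<le> M"
    and bq: "\<And>l1 l2 u. \<lbrakk>l - \<epsilon> \<le> l2; l2 \<le> l1; l1 \<le> l; u \<le> l2\<rbrakk> \<Longrightarrow> c0 * (l1 - l2)\<^sup>2 \<le> bregman q l1 u"
  obtains \<nu> where "0 < \<nu>"
    "\<And>(U :: 'a::euclidean_space \<times> real \<Rightarrow> real) k x0 R a b G.
      \<lbrakk>nonlocal_problem p q s \<Lambda> M C U k x0 R a b G; b - a = \<sigma> * R powr (p * s);
       (LINT t:{a..b}|lborel. measure lborel {x \<in> ball x0 R. U (x, t) < l}) \<le> \<nu> * R powr (real DIM('a) + p * s)\<rbrakk>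
      \<Longrightarrow> AE t in lborel. a + (b - a) / 4 < t \<and> t < b \<longrightarrow> (AE x in lborel. x \<in> ball x0 (R / 2) \<longrightarrow> l - \<epsilon> \<le> U (x, t))"
proof -
  define n where "n = real DIM('a)"
  define \<alpha> where "\<alpha> = n + p * s"
  define \<gamma> where "\<gamma> = p * s / n"
  define \<omega> where "\<omega> = unit_ball_vol n"
  \<comment> \<open>\<kappa>1 bounds the growth in i of the constant of one step: time gaps
    contribute 2^i, Lipschitz constants 2^(p s i). \<kappa>2 adds the 4^i from the squared level
    gaps.\<close>
  define \<kappa>1 where "\<kappa>1 = 2 powr (1 + p * s)"
  define \<kappa>2 where "\<kappa>2 = 4 * \<kappa>1"
  \<comment> \<open>24 is 3 times the 8 in the time gap \<sigma> R^(p s) / (8 * 2^i), and 8 M is 2 M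
    times the 4 in the radius gap R / (4 * 2^i).\<close>
  define K1 where "K1 = 24 * M powr (q + 1) / \<sigma> + 2 * \<Lambda> * C * (8 * M) powr (p * s) * (2 * M) powr (p - p * s)"
  \<comment> \<open>X is the growth rate in the passage from slices to space-time, with 2^p from the
    p-th power of the level gaps. The decay rate \<mu> of the slice bounds solves X \<mu>^\<gamma> =
    1. The rate lam of the space-time measures is smaller by \<kappa>2, which pays for the passage
    to slices.\<close>
  define X where "X = \<kappa>1 * 2 powr p"
  define \<mu> where "\<mu> = X powr (- (1 / \<gamma>))"
  define lam where "lam = \<mu> / \<kappa>2"
  define K2 where "K2 = K1 / (c0 * \<epsilon>\<^sup>2 * lam)"
  define K3 where "K3 = 2 powr \<alpha> * (2 / \<omega>) powr (1 + \<gamma>)"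
  define K4 where "K4 = K1 * \<Lambda> * (2 / \<epsilon>) powr p * K3 * K2 powr \<gamma> / lam"
  \<comment> \<open>The first entry gives K4 \<nu>^\<gamma> \<le> 1, which closes the induction; the
    second keeps the distance \<rho> of the good pairs at most R / 2.\<close>
  define \<nu> where "\<nu> = min ((1 / K4) powr (1 / \<gamma>)) (\<omega> * (1 / 4) ^ DIM('a) / (2 * K2))"
  have ps: "0 < p * s" "p * s < p" using p s by (auto simp: mult_less_cancel_left2)
  have n: "0 < n" by (simp add: n_def)
  have \<gamma>: "0 < \<gamma>" "n * \<gamma> = p * s" using ps n by (auto simp: \<gamma>_def)
  have \<omega>: "0 < \<omega>" using n by (simp add: \<omega>_def)
  have \<kappa>: "1 \<le> \<kappa>1" "2 \<le> \<kappa>1" "2 powr (p * s) \<le> \<kappa>1" "4 \<le> \<kappa>2"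
  proof -
    have "2 powr 1 \<le> \<kappa>1" unfolding \<kappa>1_def using ps by (intro powr_mono) auto
    then show "2 \<le> \<kappa>1" by simp
    then show "1 \<le> \<kappa>1" "4 \<le> \<kappa>2" by (auto simp: \<kappa>2_def)
    show "2 powr (p * s) \<le> \<kappa>1" unfolding \<kappa>1_def by (intro powr_mono) auto
  qed
  have X: "1 \<le> X" unfolding X_def using \<kappa>(1) p mult_mono[of 1 \<kappa>1 1 "2 powr p"] ge_one_powr_ge_zero[of 2 p] by simp
  have \<mu>: "0 < \<mu>" "\<mu> \<le> 1" "X * \<mu> powr \<gamma> = 1"
  proof -
    show "0 < \<mu>" using X by (simp add: \<mu>_def)
    show "\<mu> \<le> 1" using X \<gamma> powr_mono[of "- (1 / \<gamma>)" 0 X] by (simp add: \<mu>_def)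
    have "\<mu> powr \<gamma> = X powr (- 1)" unfolding \<mu>_def powr_powr using \<gamma> by simp
    then show "X * \<mu> powr \<gamma> = 1" using X by (simp add: powr_minus)
  qed
  have lam: "0 < lam" "lam < 1" "\<kappa>2 * lam = \<mu>"
    using \<mu> \<kappa> by (auto simp: lam_def)
  have K1: "0 < K1" unfolding K1_def using M \<sigma> Lam C by (intro add_pos_nonneg) auto
  have K2: "0 < K2" using K1 c0 \<epsilon> lam by (simp add: K2_def)
  have K3: "0 < K3" using \<omega> by (simp add: K3_def)
  have K4: "0 < K4" using K1 K2 K3 Lam \<epsilon> lam by (simp add: K4_def)
  have \<nu>: "0 < \<nu>" "K4 * \<nu> powr \<gamma> \<le> 1" "2 * K2 * \<nu> / \<omega> \<le> (1 / 4) ^ DIM('a)"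
  proof -
    show "0 < \<nu>" using K4 K2 \<omega> by (simp add: \<nu>_def)
    then have "\<nu> powr \<gamma> \<le> ((1 / K4) powr (1 / \<gamma>)) powr \<gamma>"
      using \<gamma> by (intro powr_mono2) (auto simp: \<nu>_def)
    also have "\<dots> = 1 / K4" using \<gamma> K4 by (simp add: powr_powr)
    finally show "K4 * \<nu> powr \<gamma> \<le> 1" using K4 by (simp add: field_simps)
    have "\<nu> \<le> \<omega> * (1 / 4) ^ DIM('a) / (2 * K2)" by (simp add: \<nu>_def)
    then show "2 * K2 * \<nu> / \<omega> \<le> (1 / 4) ^ DIM('a)" using K2 \<omega> by (simp add: field_simps)
  qed
  show ?thesis
  proof
    \<comment> \<open>The extra factor lam provides the second base case: A 1 \<le> A 0 \<le> \<nu>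
      lam R^(n + p s).\<close>
    show "0 < \<nu> * lam" using \<nu> lam by simp
  next
    fix U :: "'a \<times> real \<Rightarrow> real" and k x0 R a b G
    assume NP: "nonlocal_problem p q s \<Lambda> M C U k x0 R a b G" and ba: "b - a = \<sigma> * R powr (p * s)"
      and small: "(LINT t:{a..b}|lborel. measure lborel {x \<in> ball x0 R. U (x, t) < l}) \<le> \<nu> * lam * R powr (real DIM('a) + p * s)"
    interpret nonlocal_problem p q s \<Lambda> M C U k x0 R a b G by (rule NP)
    define Q where "Q = R powr (p * s)"
    have Q: "0 < Q" using R by (simp add: Q_def)
    have Rn: "R ^ DIM('a) = R powr n" using R by (simp add: n_def powr_realpow)
    have R\<alpha>: "R powr (real DIM('a) + p * s) = R ^ DIM('a) * Q" using R by (simp add: Rn Q_def n_def powr_add)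
    have ab: "b - a = \<sigma> * Q" using ba by (simp add: Q_def)
    moreover have "0 < \<sigma> * Q" using \<sigma> Q by simp
    ultimately have "a < b" by linarith
    \<comment> \<open>Radii decrease from R to R / 2, levels from l to l - \<epsilon>, and initial
      times increase from a to a + (b - a) / 4, with gaps halved at each index.\<close>
    define r where "r i = R / 2 * (1 + (1 / 2) ^ i)" for i :: nat
    define L where "L i = l - \<epsilon> + \<epsilon> * (1 / 2) ^ i" for i :: nat
    define \<tau> where "\<tau> i = a + (b - a) / 4 * (1 - (1 / 2) ^ i)" for i :: nat
    have rd: "r i - r (Suc i) = R / (4 * 2 ^ i)" for i by (simp add: r_def field_simps)
    have Ld: "L i - L (Suc i) = \<epsilon> / (2 * 2 ^ i)" for i by (simp add: L_def field_simps)
    have \<tau>d: "\<tau> (Suc i) - \<tau> i = \<sigma> * Q / (8 * 2 ^ i)" for i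
      unfolding ab[symmetric] by (simp add: \<tau>_def field_simps)
    have h1: "(1 / 2 :: real) ^ i \<le> 1" "0 < (1 / 2 :: real) ^ i" for i by (auto simp: power_le_one)
    have r: "0 < r i" "r (Suc i) < r i" "r i \<le> R" "R / 2 \<le> r i" for i
    proof -
      show "0 < r i" using R h1[of i] by (simp add: r_def add_pos_pos)
      have "0 < r i - r (Suc i)" unfolding rd using R by simp
      then show "r (Suc i) < r i" by simp
      have "R / 2 * (1 + (1 / 2) ^ i) \<le> R / 2 * 2" using R h1[of i] by (intro mult_left_mono) auto
      then show "r i \<le> R" by (simp add: r_def)
      show "R / 2 \<le> r i" using R h1[of i] by (simp add: r_def)
    qed
    have L: "\<bar>L i\<bar> \<le> M" "L (Suc i) < L i" "l - \<epsilon> \<le> L i" "L i \<le> l" for i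
    proof -
      show 1: "l - \<epsilon> \<le> L i" using \<epsilon> h1[of i] by (simp add: L_def)
      have "\<epsilon> * (1 / 2) ^ i \<le> \<epsilon> * 1" using \<epsilon> h1[of i] by (intro mult_left_mono) auto
      then show 2: "L i \<le> l" by (simp add: L_def)
      show "\<bar>L i\<bar> \<le> M" using 1 2 l by linarith
      have "0 < L i - L (Suc i)" unfolding Ld using \<epsilon> by simp
      then show "L (Suc i) < L i" by simp
    qed
    have \<tau>: "a \<le> \<tau> i" "\<tau> i < \<tau> (Suc i)" "\<tau> i < b" "\<tau> i \<le> a + (b - a) / 4" for i
    proof -
      have "(b - a) / 4 * (1 - (1 / 2) ^ i) \<le> (b - a) / 4 * 1" using \<open>a < b\<close> h1[of i] by (intro mult_left_mono) auto
      then show 1: "\<tau> i \<le> a + (b - a) / 4" by (simp add: \<tau>_def)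
      also have "\<dots> < b" using \<open>a < b\<close> by (simp add: field_simps)
      finally show "\<tau> i < b" .
      show "a \<le> \<tau> i" using \<open>a < b\<close> h1[of i] by (simp add: \<tau>_def)
      have "0 < \<tau> (Suc i) - \<tau> i" unfolding \<tau>d using \<sigma> Q by simp
      then show "\<tau> i < \<tau> (Suc i)" by simp
    qed
    define A where "A i = (LINT t:{\<tau> i..b}|lborel. sublevel_measure (r i) (L i) t)" for i
    have A0: "0 \<le> A i" for i
      unfolding A_def set_lebesgue_integral_def by (intro Bochner_Integration.integral_nonneg) (simp add: sublevel_measure_nonneg)
    define \<Gamma> where "\<Gamma> i = 3 * M powr (q + 1) / (\<tau> (Suc i) - \<tau> i) + energy_const (r (Suc i)) (r i)" for i
    have \<Gamma>: "\<Gamma> i \<le> K1 * \<kappa>1 ^ i / Q" for i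
    proof -
      have "3 * M powr (q + 1) / (\<tau> (Suc i) - \<tau> i) = 24 * M powr (q + 1) / \<sigma> * 2 ^ i / Q"
        unfolding \<tau>d using \<sigma> Q by (simp add: field_simps)
      also have "\<dots> \<le> 24 * M powr (q + 1) / \<sigma> * \<kappa>1 ^ i / Q"
        using \<kappa> \<sigma> Q by (intro divide_right_mono mult_left_mono power_mono) auto
      finally have 1: "3 * M powr (q + 1) / (\<tau> (Suc i) - \<tau> i) \<le> 24 * M powr (q + 1) / \<sigma> * \<kappa>1 ^ i / Q" .
      have "2 * M / (r i - r (Suc i)) = 8 * M * 2 ^ i / R" unfolding rd using R by (simp add: field_simps)
      then have "energy_const (r (Suc i)) (r i) = 2 * \<Lambda> * C * ((8 * M) powr (p * s) * (2 powr (p * s)) ^ i / Q) * (2 * M) powr (p - p * s)"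
        unfolding energy_const_def using M R by (simp add: powr_divide powr_mult power_powr_commute Q_def)
      also have "\<dots> \<le> 2 * \<Lambda> * C * ((8 * M) powr (p * s) * \<kappa>1 ^ i / Q) * (2 * M) powr (p - p * s)"
        using \<kappa> Q Lam C by (intro mult_right_mono mult_left_mono divide_right_mono power_mono) auto
      also have "\<dots> = 2 * \<Lambda> * C * (8 * M) powr (p * s) * (2 * M) powr (p - p * s) * \<kappa>1 ^ i / Q" by simp
      finally show ?thesis using 1 unfolding \<Gamma>_def K1_def by (simp add: distrib_right add_divide_distrib)
    qed
    have \<Gamma>A: "\<Gamma> i * A i \<le> K1 * \<kappa>1 ^ i * (\<nu> * lam ^ i * R ^ DIM('a))" if "A i \<le> \<nu> * lam ^ i * (R ^ DIM('a) * Q)" for i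
    proof -
      have "\<Gamma> i * A i \<le> (K1 * \<kappa>1 ^ i / Q) * (\<nu> * lam ^ i * (R ^ DIM('a) * Q))"
        using \<Gamma> that A0 K1 \<kappa> Q by (intro mult_mono) auto
      also have "\<dots> = K1 * \<kappa>1 ^ i * (\<nu> * lam ^ i * R ^ DIM('a))" using Q by simp
      finally show ?thesis .
    qed
    define m where "m i = K2 * \<mu> ^ i * \<nu> * R ^ DIM('a)" for i
    have m0: "0 < m i" for i unfolding m_def using K2 \<mu> \<nu> R by simp
    have sup: "AE t in lborel. \<tau> (Suc i) < t \<and> t < b \<longrightarrow> sublevel_measure (r (Suc i)) (L (Suc i)) t \<le> m (Suc i)"
      if Ai: "A i \<le> \<nu> * lam ^ i * (R ^ DIM('a) * Q)" for i
    proof -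
      have "AE t in lborel. \<tau> (Suc i) < t \<and> t < b \<longrightarrow> c0 * (L i - L (Suc i))\<^sup>2 * sublevel_measure (r (Suc i)) (L (Suc i)) t
        \<le> \<Gamma> i * A i"
        unfolding \<Gamma>_def A_def
        using L[of i] L[of "Suc i"] c0 bq[of "L (Suc i)" "L i"]
        by (intro decay_sup r L \<tau>) auto
      then show ?thesis
      proof eventually_elim
        case (elim t)
        show ?case
        proof
          assume t: "\<tau> (Suc i) < t \<and> t < b"
          let ?D = "c0 * (L i - L (Suc i))\<^sup>2" and ?N = "sublevel_measure (r (Suc i)) (L (Suc i)) t"
          have D: "?D = c0 * \<epsilon>\<^sup>2 / (4 * 4 ^ i)" "0 < ?D"
            unfolding Ld using c0 \<epsilon> by (auto simp: power_divide power_mult_distrib power2_eq_square simp flip: power_mult_distrib)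
          have "?D * ?N \<le> K1 * \<kappa>1 ^ i * (\<nu> * lam ^ i * R ^ DIM('a))"
            using elim t \<Gamma>A[OF Ai] by linarith
          \<comment> \<open>One factor \<kappa>1 is given away to match the power
            \<open>Suc i\<close> of \<mu> = \<kappa>2 lam.\<close>
          also have "\<dots> \<le> K1 * \<kappa>1 ^ Suc i * (\<nu> * lam ^ i * R ^ DIM('a))"
            using K1 \<kappa> \<nu> lam R by (intro mult_right_mono mult_left_mono power_increasing) auto
          also have "\<dots> = ?D * m (Suc i)"
          proof -
            have "\<mu> ^ Suc i = 4 * 4 ^ i * \<kappa>1 ^ Suc i * lam ^ Suc i"
              unfolding lam(3)[symmetric] \<kappa>2_def by (simp add: power_mult_distrib)
            then show ?thesis unfolding D m_def K2_def using c0 \<epsilon> lam by (simp add: field_simps)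
          qed
          finally show "?N \<le> m (Suc i)" by (rule mult_left_le_imp_le[OF _ D(2)])
        qed
      qed
    qed
    have step: "A (Suc (Suc i)) \<le> \<nu> * lam ^ Suc (Suc i) * (R ^ DIM('a) * Q)"
      if Ai: "A i \<le> \<nu> * lam ^ i * (R ^ DIM('a) * Q)" and Aj: "A (Suc i) \<le> \<nu> * lam ^ Suc i * (R ^ DIM('a) * Q)" for i
    proof -
      define j where "j = Suc i"
      \<comment> \<open>Solves |B(\<rho> / 2)| = 2 m j, the normalisation in
        \<open>decay_measure\<close>.\<close>
      define \<rho> where "\<rho> = 2 * (2 * m j / \<omega>) powr (1 / n)"
      have \<rho>0: "0 < \<rho>" unfolding \<rho>_def using m0[of j] \<omega> by simp
      have \<rho>n: "\<omega> * (\<rho> / 2) ^ DIM('a) = 2 * m j"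
      proof -
        have "(\<rho> / 2) ^ DIM('a) = ((2 * m j / \<omega>) powr (1 / n)) powr n"
          unfolding \<rho>_def n_def using m0[of j] \<omega> by (subst powr_realpow) auto
        also have "\<dots> = 2 * m j / \<omega>" using n m0[of j] \<omega> by (simp add: powr_powr)
        finally show ?thesis using \<omega> by simp
      qed
      have \<rho>R: "\<rho> \<le> R / 2"
      proof -
        have "(\<rho> / 2) ^ DIM('a) = 2 * m j / \<omega>" using \<rho>n \<omega> by (simp add: field_simps)
        also have "\<dots> = (2 * K2 * \<nu> / \<omega>) * \<mu> ^ j * R ^ DIM('a)" by (simp add: m_def)
        also have "\<dots> \<le> (1 / 4) ^ DIM('a) * 1 * R ^ DIM('a)"
          using \<nu>(3) \<mu> R K2 \<nu>(1) \<omega> by (intro mult_mono) (auto simp: power_le_one)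
        also have "\<dots> = (R / 4) ^ DIM('a)" by (simp add: power_divide)
        finally have "\<rho> / 2 \<le> R / 4" using R by (subst (asm) power_mono_iff) (use \<rho>0 in auto)
        then show ?thesis by simp
      qed
      have main: "inverse \<Lambda> * (L j - L (Suc j)) powr p * \<rho> powr (- \<alpha>) * m j * A (Suc j) \<le> \<Gamma> j * A j"
        unfolding \<Gamma>_def A_def \<alpha>_def n_def
      proof (rule decay_measure[OF r(1,2,3) L(1,2) \<tau>(1,2,3) \<rho>0])
        show "\<rho> \<le> r (Suc j)" using \<rho>R r(4)[of "Suc j"] by linarith
        show "0 \<le> m j" using m0[of j] by simp
        show "AE t in lborel. \<tau> j < t \<and> t < b \<longrightarrow> sublevel_measure (r j) (L j) t \<le> m j"
          unfolding j_def by (rule sup[OF Ai])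
        show "unit_ball_vol (real DIM('a)) * (\<rho> / 2) ^ DIM('a) = 2 * m j"
          using \<rho>n by (simp add: \<omega>_def n_def)
      qed
      define E where "E = (2 / \<epsilon>) powr p * (2 powr p) ^ j"
      have E: "(L j - L (Suc j)) powr p * E = 1"
      proof -
        have "(\<epsilon> / (2 * 2 ^ j)) powr p * ((2 * 2 ^ j) / \<epsilon>) powr p = 1"
          using \<epsilon> by (subst powr_mult[symmetric]) auto
        moreover have "((2 * 2 ^ j) / \<epsilon>) powr p = E"
          unfolding E_def using \<epsilon> by (simp add: powr_divide powr_mult power_powr_commute)
        ultimately show ?thesis by (simp add: Ld)
      qed
      have rm: "\<rho> powr \<alpha> = K3 * m j powr \<gamma> * m j"
      proof -
        have "\<rho> powr \<alpha> = 2 powr \<alpha> * (2 * m j / \<omega>) powr (\<alpha> / n)"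
          unfolding \<rho>_def using m0[of j] \<omega> by (simp add: powr_mult powr_powr)
        also have "\<alpha> / n = 1 + \<gamma>" using n by (simp add: \<alpha>_def \<gamma>_def add_divide_distrib)
        also have "(2 * m j / \<omega>) powr (1 + \<gamma>) = (2 / \<omega>) powr (1 + \<gamma>) * (m j powr \<gamma> * m j)"
          using m0[of j] \<omega> by (subst powr_mult[symmetric, of _ "m j powr \<gamma> * m j"] | simp add: powr_mult powr_divide powr_add)+
        finally show ?thesis by (simp add: K3_def)
      qed
      have mg: "m j powr \<gamma> = K2 powr \<gamma> * (\<mu> powr \<gamma>) ^ j * \<nu> powr \<gamma> * Q"
        unfolding m_def Rn using K2 \<mu> \<nu> R \<gamma>(2) by (simp add: powr_mult power_powr_commute powr_powr Q_def)
      \<comment> \<open>The coefficient of A (Suc j) in \<open>main\<close> is inverted explicitly;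
        by \<open>rm\<close>, its factor \<rho>^(-\<alpha>) m j equals 1 / (K3 (m
        j)^\<gamma>).\<close>
      have "A (Suc j) = (inverse \<Lambda> * (L j - L (Suc j)) powr p * \<rho> powr (- \<alpha>) * m j * A (Suc j)) * (\<Lambda> * E * (K3 * m j powr \<gamma>))"
      proof -
        have "\<rho> powr (- \<alpha>) * m j * (K3 * m j powr \<gamma>) = \<rho> powr (- \<alpha>) * \<rho> powr \<alpha>" by (simp add: rm)
        also have "\<dots> = 1" using \<rho>0 by (simp flip: powr_add)
        finally have "\<rho> powr (- \<alpha>) * m j * (K3 * m j powr \<gamma>) = 1" .
        moreover have "(inverse \<Lambda> * (L j - L (Suc j)) powr p * \<rho> powr (- \<alpha>) * m j * A (Suc j)) * (\<Lambda> * E * (K3 * m j powr \<gamma>))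
          = (inverse \<Lambda> * \<Lambda>) * ((L j - L (Suc j)) powr p * E) * (\<rho> powr (- \<alpha>) * m j * (K3 * m j powr \<gamma>)) * A (Suc j)"
          by (simp only: mult_ac)
        ultimately show ?thesis using Lam by (simp add: E)
      qed
      also have "\<dots> \<le> (K1 * \<kappa>1 ^ j * (\<nu> * lam ^ j * R ^ DIM('a))) * (\<Lambda> * E * (K3 * m j powr \<gamma>))"
      proof (rule mult_right_mono)
        show "inverse \<Lambda> * (L j - L (Suc j)) powr p * \<rho> powr (- \<alpha>) * m j * A (Suc j) \<le> K1 * \<kappa>1 ^ j * (\<nu> * lam ^ j * R ^ DIM('a))"
          using main \<Gamma>A[OF Aj] unfolding j_def by linarith
        show "0 \<le> \<Lambda> * E * (K3 * m j powr \<gamma>)" unfolding E_def using Lam K3 by simp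
      qed
      \<comment> \<open>Apart from lam^j, all j-th powers combine to X \<mu>^\<gamma> = 1, and the
        constants to K4 \<nu>^\<gamma> \<le> 1.\<close>
      also have "\<dots> = (X * \<mu> powr \<gamma>) ^ j * (K4 * \<nu> powr \<gamma>) * (\<nu> * (lam * lam ^ j) * (R ^ DIM('a) * Q))"
        unfolding mg E_def X_def K4_def power_mult_distrib using lam by simp
      also have "\<dots> \<le> 1 * (\<nu> * (lam * lam ^ j) * (R ^ DIM('a) * Q))"
        unfolding \<mu>(3) using \<nu> lam R Q by (intro mult_right_mono) auto
      finally show ?thesis by (simp add: j_def)
    qed
    have base0: "A 0 \<le> \<nu> * lam * (R ^ DIM('a) * Q)"
      using small unfolding A_def sublevel_measure_def sublevel_def R\<alpha> by (simp add: r_def L_def \<tau>_def)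
    have mono: "A (Suc i) \<le> A i" for i
    proof -
      have "A (Suc i) \<le> (LINT t:{\<tau> i..b}|lborel. sublevel_measure (r (Suc i)) (L (Suc i)) t)"
        unfolding A_def using \<tau>(2)[of i]
        by (intro set_integral_mono_subset sublevel_measure_set_integrable sublevel_measure_nonneg) auto
      also have "\<dots> \<le> A i"
        unfolding A_def using r(2)[of i] L(2)[of i]
        by (intro set_integral_mono sublevel_measure_set_integrable sublevel_measure_mono) auto
      finally show ?thesis .
    qed
    have "A i \<le> \<nu> * lam ^ i * (R ^ DIM('a) * Q) \<and> A (Suc i) \<le> \<nu> * lam ^ Suc i * (R ^ DIM('a) * Q)" for i
    proof (induction i)
      case 0
      have "\<nu> * lam * (R ^ DIM('a) * Q) \<le> \<nu> * 1 * (R ^ DIM('a) * Q)"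
        using \<nu> lam R Q by (intro mult_right_mono mult_left_mono) auto
      then show ?case using base0 mono[of 0] by simp
    next
      case (Suc i)
      then show ?case using step by blast
    qed
    then have Ab: "A i \<le> \<nu> * lam ^ i * (R ^ DIM('a) * Q)" for i by blast
    \<comment> \<open>The limiting radius, level and initial time are dominated by those of every
      index, so this measure is below all A i and hence zero.\<close>
    let ?I = "LINT t:{a + (b - a) / 4..b}|lborel. sublevel_measure (R / 2) (l - \<epsilon>) t"
    have "?I \<le> A i" for i
    proof -
      have "?I \<le> (LINT t:{\<tau> i..b}|lborel. sublevel_measure (R / 2) (l - \<epsilon>) t)"
        using \<tau>(4)[of i]
        by (intro set_integral_mono_subset sublevel_measure_set_integrable sublevel_measure_nonneg) auto
      also have "\<dots> \<le> A i"
        unfolding A_def using r(4)[of i] L(3)[of i]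
        by (intro set_integral_mono sublevel_measure_set_integrable sublevel_measure_mono) auto
      finally show ?thesis .
    qed
    moreover have "(\<lambda>i. \<nu> * lam ^ i * (R ^ DIM('a) * Q)) \<longlonglongrightarrow> \<nu> * 0 * (R ^ DIM('a) * Q)"
      using lam by (intro tendsto_intros LIMSEQ_realpow_zero) auto
    ultimately have "?I \<le> 0"
      using Ab by (intro LIMSEQ_le_const[of _ 0]) (auto intro: order_trans)
    let ?f = "\<lambda>t. indicat_real {a + (b - a) / 4..b} t *\<^sub>R sublevel_measure (R / 2) (l - \<epsilon>) t"
    have fi: "integrable lborel ?f" using sublevel_measure_set_integrable by (simp add: set_integrable_def)
    have f0: "AE t in lborel. 0 \<le> ?f t" by (simp add: sublevel_measure_nonneg)
    have "(LINT t|lborel. ?f t) = 0"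
      using \<open>?I \<le> 0\<close> integral_nonneg_AE[OF f0] by (simp add: set_lebesgue_integral_def)
    then have "AE t in lborel. ?f t = 0" using integral_nonneg_eq_0_iff_AE[OF fi f0] by blast
    then show "AE t in lborel. a + (b - a) / 4 < t \<and> t < b \<longrightarrow> (AE x in lborel. x \<in> ball x0 (R / 2) \<longrightarrow> l - \<epsilon> \<le> U (x, t))"
    proof eventually_elim
      case (elim t)
      show ?case
      proof
        assume "a + (b - a) / 4 < t \<and> t < b"
        with elim have "sublevel_measure (R / 2) (l - \<epsilon>) t = 0" by simp
        then have "emeasure lborel (sublevel (R / 2) (l - \<epsilon>) t) = 0" by (simp add: emeasure_sublevel)
        then have "AE x in lborel. x \<notin> sublevel (R / 2) (l - \<epsilon>) t"
          by (intro AE_not_in null_setsI) auto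
        then show "AE x in lborel. x \<in> ball x0 (R / 2) \<longrightarrow> l - \<epsilon> \<le> U (x, t)"
          by eventually_elim (auto simp: sublevel_def not_less)
      qed
    qed
  qed
qed

section \<open>Reduction to Borel measurable data\<close>

text \<open>Completeness of the Lebesgue measure supplies the measurability of f. Thus u and K can
  be replaced by Borel versions slice by slice, where only equality almost everywhere is
  known.\<close>

lemma measurable_lebesgue_AE:
  fixes f g :: "'a::euclidean_space \<Rightarrow> 'b::topological_space"
  assumes ae: "AE x in lborel. f x = g x" and g: "g \<in> borel_measurable borel"
  shows "f \<in> borel_measurable lebesgue"
proof (rule measurableI)
  fix A :: "'b set" assume A: "A \<in> sets borel"
  have "AE x in lborel. x \<in> g -` A \<longleftrightarrow> x \<in> f -` A"
    using ae by eventually_elim simp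
  then have "AE x in lebesgue. x \<in> g -` A \<longleftrightarrow> x \<in> f -` A"
    by (simp only: AE_completion_iff)
  moreover have "g -` A \<in> sets lebesgue"
    using measurable_sets[OF g A] by (intro sets_completionI_sets) simp
  ultimately have "f -` A \<in> sets lebesgue"
    by (rule completion.in_sets_AE) simp
  then show "f -` A \<inter> space lebesgue \<in> sets lebesgue" by simp
qed simp

lemma integral_lebesgue_eq_lborel:
  fixes f g :: "'a::euclidean_space \<Rightarrow> real"
  assumes ae: "AE x in lborel. f x = g x" and g: "g \<in> borel_measurable borel"
  shows "(LINT x|lebesgue. f x) = (LINT x|lborel. g x)"
proof -
  have "(LINT x|lebesgue. f x) = (LINT x|lebesgue. g x)"
  proof (rule integral_cong_AE)
    show "f \<in> borel_measurable lebesgue" by (rule measurable_lebesgue_AE[OF ae g])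
    show "g \<in> borel_measurable lebesgue" using g by (intro measurable_completion) simp
    show "AE x in lebesgue. f x = g x" using ae by (simp only: AE_completion_iff)
  qed
  also have "\<dots> = (LINT x|lborel. g x)"
    using g by (intro integral_completion) simp
  finally show ?thesis .
qed

lemma set_integral_lebesgue_eq_lborel:
  fixes f g :: "'a::euclidean_space \<Rightarrow> real"
  assumes ae: "AE x in lborel. x \<in> A \<longrightarrow> f x = g x" and [measurable]: "g \<in> borel_measurable borel" "A \<in> sets borel"
  shows "(LINT x:A|lebesgue. f x) = (LINT x:A|lborel. g x)"
  unfolding set_lebesgue_integral_def
proof (rule integral_lebesgue_eq_lborel)
  show "AE x in lborel. indicat_real A x *\<^sub>R f x = indicat_real A x *\<^sub>R g x"
    using ae by eventually_elim (auto simp: indicator_def)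
qed measurable

text \<open>Fubini's theorem moves the time average onto W; dominated convergence applies since W
  and g are bounded and g has bounded support. The condition on t involves W alone, so one null set
  of times serves all g, including test functions that depend on the time at which they are
  frozen.\<close>

lemma average_pairing_tendsto:
  fixes W :: "real \<times> 'a::euclidean_space \<Rightarrow> real" and g :: "'a \<Rightarrow> real"
  assumes W[measurable]: "W \<in> borel_measurable borel" and WB: "\<And>z. \<bar>W z\<bar> \<le> B"
    and g[measurable]: "g \<in> borel_measurable borel" and gB: "\<And>x. \<bar>g x\<bar> \<le> D"
    and g0: "\<And>x. x \<notin> ball x0 R \<Longrightarrow> g x = 0"
    and lim: "AE x in lborel. (\<lambda>m. real (Suc m) * (LINT \<sigma>:{0..1 / real (Suc m)}|lborel. W (t + c * \<sigma>, x))) \<longlonglongrightarrow> W (t, x)"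
  shows "(\<lambda>m. real (Suc m) * (LINT \<sigma>:{0..1 / real (Suc m)}|lborel. (LINT x|lborel. W (t + c * \<sigma>, x) * g x)))
    \<longlonglongrightarrow> (LINT x|lborel. W (t, x) * g x)"
proof -
  have B0: "0 \<le> B" "0 \<le> D" using WB[of undefined] gB[of undefined] by linarith+
  let ?I = "\<lambda>m \<sigma>. indicat_real {0..1 / real (Suc m)} \<sigma>"
  let ?avg = "\<lambda>m x. real (Suc m) * (LINT \<sigma>:{0..1 / real (Suc m)}|lborel. W (t + c * \<sigma>, x))"
  have Wm[measurable]: "(\<lambda>w :: real \<times> 'a. W (t + c * fst w, snd w)) \<in> borel_measurable borel"
  proof -
    have "(\<lambda>w :: real \<times> 'a. (t + c * fst w, snd w)) \<in> borel \<rightarrow>\<^sub>M borel" by measurable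
    from measurable_compose[OF this W] show ?thesis .
  qed
  have swap: "real (Suc m) * (LINT \<sigma>:{0..1 / real (Suc m)}|lborel. (LINT x|lborel. W (t + c * \<sigma>, x) * g x))
      = (LINT x|lborel. ?avg m x * g x)" for m
  proof -
    have gfin: "emeasure lborel (ball x0 R) < \<infinity>" by (rule emeasure_bounded_finite) simp
    have int: "integrable (lborel \<Otimes>\<^sub>M lborel) (\<lambda>(\<sigma>, x). ?I m \<sigma> * (W (t + c * \<sigma>, x) * g x))"
    proof (rule Bochner_Integration.integrable_bound)
      show "integrable (lborel \<Otimes>\<^sub>M lborel) (\<lambda>w. B * D * indicat_real ({0..1 / real (Suc m)} \<times> ball x0 R) w)"
      proof (intro integrable_mult_right integrable_real_indicator)
        show "emeasure (lborel \<Otimes>\<^sub>M lborel) ({0..1 / real (Suc m)} \<times> ball x0 R) < \<infinity>"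
          using gfin by (simp add: lborel.emeasure_pair_measure_Times ennreal_mult_less_top)
      qed simp
      show "AE w in lborel \<Otimes>\<^sub>M lborel. norm ((\<lambda>(\<sigma>, x). ?I m \<sigma> * (W (t + c * \<sigma>, x) * g x)) w)
          \<le> norm (B * D * indicat_real ({0..1 / real (Suc m)} \<times> ball x0 R) w)"
      proof (rule AE_I2)
        fix w :: "real \<times> 'a"
        obtain \<sigma> x where w: "w = (\<sigma>, x)" by (cases w)
        show "norm ((\<lambda>(\<sigma>, x). ?I m \<sigma> * (W (t + c * \<sigma>, x) * g x)) w) \<le> norm (B * D * indicat_real ({0..1 / real (Suc m)} \<times> ball x0 R) w)"
        proof (cases "\<sigma> \<in> {0..1 / real (Suc m)} \<and> x \<in> ball x0 R")
          case True
          then have "\<bar>W (t + c * \<sigma>, x)\<bar> * \<bar>g x\<bar> \<le> B * D" using WB gB B0 by (intro mult_mono) auto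
          with True show ?thesis using B0 by (simp add: w abs_mult indicator_def)
        next
          case False
          then show ?thesis using g0[of x] by (auto simp: w)
        qed
      qed
    next
      have "(\<lambda>w :: real \<times> 'a. ?I m (fst w) * (W (t + c * fst w, snd w) * g (snd w))) \<in> borel_measurable borel"
        by measurable
      then show "(\<lambda>(\<sigma>, x). ?I m \<sigma> * (W (t + c * \<sigma>, x) * g x)) \<in> borel_measurable (lborel \<Otimes>\<^sub>M lborel)"
        by (simp add: lborel_prod case_prod_beta)
    qed
    have "(LINT \<sigma>:{0..1 / real (Suc m)}|lborel. (LINT x|lborel. W (t + c * \<sigma>, x) * g x))
        = (LINT \<sigma>|lborel. (LINT x|lborel. ?I m \<sigma> * (W (t + c * \<sigma>, x) * g x)))"
      by (simp add: set_lebesgue_integral_def)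
    also have "\<dots> = (LINT x|lborel. (LINT \<sigma>|lborel. ?I m \<sigma> * (W (t + c * \<sigma>, x) * g x)))"
      by (rule lborel_pair.Fubini_integral[symmetric, OF int])
    also have "\<dots> = (LINT x|lborel. (LINT \<sigma>:{0..1 / real (Suc m)}|lborel. W (t + c * \<sigma>, x)) * g x)"
      by (simp add: set_lebesgue_integral_def flip: mult.assoc)
    finally show ?thesis by (simp add: mult.assoc del: of_nat_Suc)
  qed
  have "(\<lambda>m. LINT x|lborel. ?avg m x * g x) \<longlonglongrightarrow> (LINT x|lborel. W (t, x) * g x)"
  proof (rule integral_dominated_convergence[where w="\<lambda>x. B * D * indicat_real (ball x0 R) x"])
    show "integrable lborel (\<lambda>x. B * D * indicat_real (ball x0 R) x)"
      using emeasure_bounded_finite[OF bounded_ball, of x0 R] by (intro integrable_mult_right integrable_real_indicator) auto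
    show "AE x in lborel. (\<lambda>m. ?avg m x * g x) \<longlonglongrightarrow> W (t, x) * g x"
      using lim by eventually_elim (rule tendsto_mult_right)
    have avgB: "\<bar>?avg m x\<bar> \<le> B" for m x
    proof -
      have [measurable]: "(\<lambda>\<sigma>. W (t + c * \<sigma>, x)) \<in> borel_measurable borel"
        by (rule measurable_compose[OF _ W]) measurable
      have "\<bar>LINT \<sigma>:{0..1 / real (Suc m)}|lborel. W (t + c * \<sigma>, x)\<bar> \<le> (LINT \<sigma>:{0..1 / real (Suc m)}|lborel. B)"
        unfolding set_lebesgue_integral_def
      proof (rule order_trans[OF integral_abs_bound], rule integral_mono')
        show "integrable lborel (\<lambda>\<sigma>. indicat_real {0..1 / real (Suc m)} \<sigma> *\<^sub>R B)"
          by (intro integrable_scaleR_left integrable_real_indicator) (auto simp: emeasure_lborel_Icc_eq)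
      qed (use WB B0 in \<open>auto simp: indicator_def\<close>)
      also have "\<dots> = B / real (Suc m)" by (simp add: set_lebesgue_integral_def)
      finally have "real (Suc m) * \<bar>LINT \<sigma>:{0..1 / real (Suc m)}|lborel. W (t + c * \<sigma>, x)\<bar> \<le> real (Suc m) * (B / real (Suc m))"
        by (rule mult_left_mono) simp
      then show ?thesis by (simp add: abs_mult del: of_nat_Suc)
    qed
    show "AE x in lborel. norm (?avg m x * g x) \<le> B * D * indicat_real (ball x0 R) x" for m
    proof (rule AE_I2)
      fix x
      show "norm (?avg m x * g x) \<le> B * D * indicat_real (ball x0 R) x"
      proof (cases "x \<in> ball x0 R")
        case True
        have "\<bar>?avg m x\<bar> * \<bar>g x\<bar> \<le> B * D" using avgB[of m x] gB[of x] B0 by (intro mult_mono) auto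
        with True show ?thesis by (simp add: abs_mult del: of_nat_Suc)
      qed (simp add: g0)
    qed
    have m1: "(\<lambda>x. LINT \<sigma>|lborel. ?I m \<sigma> *\<^sub>R W (t + c * \<sigma>, x)) \<in> borel_measurable borel" for m
    proof -
      have "(\<lambda>w :: 'a \<times> real. ?I m (snd w) *\<^sub>R W (t + c * snd w, fst w)) \<in> borel_measurable borel"
      proof -
        have "(\<lambda>w :: 'a \<times> real. (t + c * snd w, fst w)) \<in> borel \<rightarrow>\<^sub>M borel" by measurable
        from measurable_compose[OF this W] have [measurable]: "(\<lambda>w :: 'a \<times> real. W (t + c * snd w, fst w)) \<in> borel_measurable borel" .
        show ?thesis by measurable
      qed
      then have "(\<lambda>(x, \<sigma>). ?I m \<sigma> *\<^sub>R W (t + c * \<sigma>, x)) \<in> borel_measurable (borel \<Otimes>\<^sub>M lborel)"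
        by (simp add: case_prod_beta borel_prod cong: measurable_cong_sets)
      from lborel.borel_measurable_lebesgue_integral[OF this] show ?thesis .
    qed
    then show "(\<lambda>x. ?avg m x * g x) \<in> borel_measurable lborel" for m
      unfolding set_lebesgue_integral_def by measurable
    have [measurable]: "(\<lambda>x. W (t, x)) \<in> borel_measurable borel"
      by (rule measurable_compose[OF _ W]) measurable
    show "(\<lambda>x. W (t, x) * g x) \<in> borel_measurable lborel" by measurable
  qed
  then show ?thesis unfolding swap .
qed

context nonlocal_kernel begin

text \<open>By Young's inequality the integrand is dominated by the energy densities of U on S and
  of g, so the exceptional times depend on U only. This integrability identifies the iterated
  integral in \<open>nonlocal_energy\<close> with an integral over pairs.\<close>

lemma pairing_integrable:
  "AE t in lborel. t \<in> {a..b} \<longrightarrow> (\<forall>g. g \<in> borel_measurable borel \<longrightarrow> (\<forall>x. x \<notin> ball x0 R \<longrightarrow> g x = 0) \<longrightarrow>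
      (\<integral>\<^sup>+z. ennreal (\<bar>g (fst z) - g (snd z)\<bar> powr p / kap z) \<partial>lborel) < \<infinity> \<longrightarrow>
      integrable lborel (\<lambda>z. signed_pow (p - 1) (dU t z) * (g (fst z) - g (snd z)) * k t (fst z) (snd z)))"
proof -
  let ?E = "\<lambda>t. \<integral>\<^sup>+z\<in>S. ennreal (\<bar>dU t z\<bar> powr p / kap z) \<partial>lborel"
  have "AE t in lborel. ?E t * indicator {a..b} t \<noteq> \<infinity>"
    using energy_S_finite by (intro nn_integral_noteq_infinite) auto
  then show ?thesis
  proof (eventually_elim, intro impI allI)
    fix t :: real and g :: "'a \<Rightarrow> real"
    assume "?E t * indicator {a..b} t \<noteq> \<infinity>" "t \<in> {a..b}"
    then have E: "?E t < \<infinity>" by (simp add: less_top)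
    assume [measurable]: "g \<in> borel_measurable borel" and g0: "\<forall>x. x \<notin> ball x0 R \<longrightarrow> g x = 0"
      and gE: "(\<integral>\<^sup>+z. ennreal (\<bar>g (fst z) - g (snd z)\<bar> powr p / kap z) \<partial>lborel) < \<infinity>"
    have pw: "norm (signed_pow (p - 1) (dU t z) * (g (fst z) - g (snd z)) * k t (fst z) (snd z))
        \<le> \<Lambda> * (indicator S z * (\<bar>dU t z\<bar> powr p / kap z) + \<bar>g (fst z) - g (snd z)\<bar> powr p / kap z)" for z
    proof (cases "z \<in> S")
      case True
      let ?d = "\<bar>dU t z\<bar>" and ?h = "\<bar>g (fst z) - g (snd z)\<bar>"
      have "?d powr (p - 1) * ?h \<le> (?d powr (p - 1)) powr (p / (p - 1)) / (p / (p - 1)) + ?h powr p / p"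
        using p by (intro Youngs_inequality) (auto simp: field_simps)
      also have "(?d powr (p - 1)) powr (p / (p - 1)) = ?d powr p" using p by (simp add: powr_powr)
      also have "?d powr p / (p / (p - 1)) + ?h powr p / p \<le> ?d powr p + ?h powr p"
      proof (rule add_mono)
        have "?d powr p / (p / (p - 1)) \<le> ?d powr p / 1" using p by (intro divide_left_mono) (auto simp: field_simps)
        then show "?d powr p / (p / (p - 1)) \<le> ?d powr p" by simp
        have "?h powr p / p \<le> ?h powr p / 1" using p by (intro divide_left_mono) auto
        then show "?h powr p / p \<le> ?h powr p" by simp
      qed
      finally have Y: "?d powr (p - 1) * ?h \<le> ?d powr p + ?h powr p" .
      have "norm (signed_pow (p - 1) (dU t z) * (g (fst z) - g (snd z)) * k t (fst z) (snd z))
          = ?d powr (p - 1) * ?h * k t (fst z) (snd z)"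
        using k_nonneg[of t "fst z" "snd z"] by (simp add: abs_mult abs_signed_pow)
      also have "\<dots> \<le> (?d powr p + ?h powr p) * (\<Lambda> / kap z)"
        by (intro mult_mono Y k_upper k_nonneg) auto
      also have "\<dots> = \<Lambda> * (?d powr p / kap z + ?h powr p / kap z)" by (simp add: algebra_simps add_divide_distrib)
      finally show ?thesis using True by simp
    next
      case False
      then show ?thesis using g0 Lam by simp
    qed
    have i1: "integrable lborel (\<lambda>z. indicator S z * (\<bar>dU t z\<bar> powr p / kap z))"
    proof (rule integrableI_nonneg)
      have "(\<integral>\<^sup>+z. ennreal (indicator S z * (\<bar>dU t z\<bar> powr p / kap z)) \<partial>lborel) = ?E t"
        by (intro nn_integral_cong) (auto simp: indicator_def)
      with E show "(\<integral>\<^sup>+z. ennreal (indicator S z * (\<bar>dU t z\<bar> powr p / kap z)) \<partial>lborel) < \<infinity>" by simp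
    qed (auto intro!: AE_I2)
    have i2: "integrable lborel (\<lambda>z. \<bar>g (fst z) - g (snd z)\<bar> powr p / kap z)"
      using gE by (intro integrableI_nonneg) auto
    show "integrable lborel (\<lambda>z. signed_pow (p - 1) (dU t z) * (g (fst z) - g (snd z)) * k t (fst z) (snd z))"
    proof (rule Bochner_Integration.integrable_bound)
      show "integrable lborel (\<lambda>z. \<Lambda> * (indicator S z * (\<bar>dU t z\<bar> powr p / kap z) + \<bar>g (fst z) - g (snd z)\<bar> powr p / kap z))"
        using i1 i2 by auto
    qed (use pw in \<open>auto intro!: AE_I2 order_trans[OF _ abs_ge_self]\<close>)
  qed
qed

end

text \<open>A Borel null set covering the exceptional set makes Tonelli's theorem applicable to
  predicates of unknown measurability. The converse \<open>AE_lborel_prodI\<close> asks for a Borel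
  exceptional set.\<close>

lemma AE_lborel_prodD:
  fixes P :: "'a::euclidean_space \<times> 'b::euclidean_space \<Rightarrow> bool"
  assumes "AE w in lborel. P w"
  shows "AE x in lborel. AE y in lborel. P (x, y)" "AE y in lborel. AE x in lborel. P (x, y)"
proof -
  obtain N where N: "{w \<in> space lborel. \<not> P w} \<subseteq> N" "emeasure lborel N = 0" "N \<in> sets lborel"
    using AE_E[OF assms] by blast
  have NB[measurable]: "N \<in> sets borel" using N by simp
  have imp: "w \<notin> N \<Longrightarrow> P w" for w using N(1) by auto
  have z: "(\<integral>\<^sup>+w. indicator N w \<partial>lborel) = 0" using N by simp
  have m: "(\<lambda>(x, y). indicator N (x, y) :: ennreal) \<in> borel_measurable (lborel \<Otimes>\<^sub>M lborel)"
    by (simp add: lborel_prod)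
  have "(\<integral>\<^sup>+x. \<integral>\<^sup>+y. indicator N (x, y) \<partial>lborel \<partial>lborel) = (0::ennreal)"
    using z by (subst (asm) nn_integral_lborel_prod) auto
  then have "AE x in lborel. (\<integral>\<^sup>+y. indicator N (x, y) \<partial>lborel) = (0::ennreal)"
    using lborel.borel_measurable_nn_integral_fst[OF m[simplified]] by (subst (asm) nn_integral_0_iff_AE) auto
  then show "AE x in lborel. AE y in lborel. P (x, y)"
  proof eventually_elim
    case (elim x)
    have "(\<lambda>y. indicator N (x, y) :: ennreal) \<in> borel_measurable lborel"
      by (rule measurable_compose[of "\<lambda>y. (x, y)" _ borel]) measurable
    with elim have "AE y in lborel. indicator N (x, y) = (0::ennreal)"
      by (subst (asm) nn_integral_0_iff_AE) auto
    then show ?case by eventually_elim (auto simp: indicator_def imp split: if_splits)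
  qed
  have "(\<integral>\<^sup>+y. \<integral>\<^sup>+x. indicator N (x, y) \<partial>lborel \<partial>lborel) = (0::ennreal)"
    using z by (subst (asm) nn_integral_lborel_prod_swap) auto
  moreover have "(\<lambda>y. \<integral>\<^sup>+x. indicator N (x, y) \<partial>lborel :: ennreal) \<in> borel_measurable lborel"
  proof -
    have "(\<lambda>w :: 'b \<times> 'a. indicator N (snd w, fst w) :: ennreal) \<in> borel_measurable borel"
      by (rule measurable_compose[of "\<lambda>w. (snd w, fst w)" _ borel]) measurable
    then have "(\<lambda>(y, x). indicator N (x, y) :: ennreal) \<in> borel_measurable (lborel \<Otimes>\<^sub>M lborel)"
      by (simp add: lborel_prod case_prod_beta)
    from lborel.borel_measurable_nn_integral_fst[OF this] show ?thesis by simp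
  qed
  ultimately have "AE y in lborel. (\<integral>\<^sup>+x. indicator N (x, y) \<partial>lborel) = (0::ennreal)"
    by (subst (asm) nn_integral_0_iff_AE) auto
  then show "AE y in lborel. AE x in lborel. P (x, y)"
  proof eventually_elim
    case (elim y)
    have "(\<lambda>x. indicator N (x, y) :: ennreal) \<in> borel_measurable lborel"
      by (rule measurable_compose[of "\<lambda>x. (x, y)" _ borel]) measurable
    with elim have "AE x in lborel. indicator N (x, y) = (0::ennreal)"
      by (subst (asm) nn_integral_0_iff_AE) auto
    then show ?case by eventually_elim (auto simp: indicator_def imp split: if_splits)
  qed
qed

lemma AE_lborel_prodI:
  fixes P :: "'a::euclidean_space \<times> 'b::euclidean_space \<Rightarrow> bool"
  assumes N[measurable]: "{w. \<not> P w} \<in> sets borel" and "AE y in lborel. AE x in lborel. P (x, y)"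
  shows "AE w in lborel. P w"
proof -
  let ?N = "{w. \<not> P w}"
  have "emeasure lborel ?N = (\<integral>\<^sup>+w. indicator ?N w \<partial>lborel)" by simp
  also have "\<dots> = (\<integral>\<^sup>+y. \<integral>\<^sup>+x. indicator ?N (x, y) \<partial>lborel \<partial>lborel)"
    by (rule nn_integral_lborel_prod_swap) measurable
  also have "\<dots> = (\<integral>\<^sup>+y. 0 \<partial>(lborel :: 'b measure))"
  proof (rule nn_integral_cong_AE)
    show "AE y in lborel. (\<integral>\<^sup>+x. indicator ?N (x, y) \<partial>lborel) = (0::ennreal)"
      using assms(2)
    proof eventually_elim
      case (elim y)
      then have "(\<integral>\<^sup>+x. indicator ?N (x, y) \<partial>lborel) = (\<integral>\<^sup>+x. 0 \<partial>(lborel :: 'a measure))"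
        by (intro nn_integral_cong_AE) (auto elim!: eventually_mono simp: indicator_def)
      then show ?case by simp
    qed
  qed
  finally show ?thesis by (intro AE_I[of _ _ ?N]) auto
qed

text \<open>The kernel is measurable in the order (x, y, t), whereas statements at a fixed time are
  wanted; Tonelli's theorem on a Borel null set moves t to the outside.\<close>

lemma AE_lborel_tripleD:
  fixes P :: "'a::euclidean_space \<times> 'b::euclidean_space \<times> 'c::euclidean_space \<Rightarrow> bool"
  assumes "AE w in lborel. P w"
  shows "AE t in lborel. AE x in lborel. AE y in lborel. P (x, y, t)"
proof -
  obtain N where N: "{w \<in> space lborel. \<not> P w} \<subseteq> N" "emeasure lborel N = 0" "N \<in> sets lborel"
    using AE_E[OF assms] by blast
  have NB[measurable]: "N \<in> sets borel" using N by simp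
  have imp: "w \<notin> N \<Longrightarrow> P w" for w using N(1) by auto
  have ind: "(\<lambda>w :: 'c \<times> 'a \<times> 'b. indicator N (fst (snd w), snd (snd w), fst w) :: ennreal) \<in> borel_measurable borel"
    by (rule measurable_compose[of "\<lambda>w. (fst (snd w), snd (snd w), fst w)" _ borel]) measurable
  have "(\<integral>\<^sup>+w. indicator N (fst (snd w), snd (snd w), fst w) \<partial>(lborel :: ('c \<times> 'a \<times> 'b) measure))
      = (\<integral>\<^sup>+t. \<integral>\<^sup>+z. indicator N (fst z, snd z, t) \<partial>lborel \<partial>lborel)"
    by (subst nn_integral_lborel_prod[OF ind]) simp
  also have "\<dots> = (\<integral>\<^sup>+z. \<integral>\<^sup>+t. indicator N (fst z, snd z, t) \<partial>lborel \<partial>lborel)"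
    by (rule lborel_pair.Fubini') (use ind in \<open>simp add: lborel_prod case_prod_beta\<close>)
  also have "\<dots> = (\<integral>\<^sup>+x. \<integral>\<^sup>+y. \<integral>\<^sup>+t. indicator N (x, y, t) \<partial>lborel \<partial>lborel \<partial>lborel)"
  proof (subst nn_integral_lborel_prod)
    have "(\<lambda>w :: ('a \<times> 'b) \<times> 'c. indicator N (fst (fst w), snd (fst w), snd w) :: ennreal) \<in> borel_measurable borel"
      by (rule measurable_compose[of "\<lambda>w. (fst (fst w), snd (fst w), snd w)" _ borel]) measurable
    then have "(\<lambda>(z, t). indicator N (fst z, snd z, t) :: ennreal) \<in> borel_measurable (lborel \<Otimes>\<^sub>M lborel)"
      by (simp add: lborel_prod case_prod_beta)
    from lborel.borel_measurable_nn_integral_fst[OF this]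
    show "(\<lambda>z :: 'a \<times> 'b. \<integral>\<^sup>+t. indicator N (fst z, snd z, t) \<partial>lborel) \<in> borel_measurable borel" by simp
  qed simp
  also have "\<dots> = (\<integral>\<^sup>+x. \<integral>\<^sup>+v. indicator N (x, v) \<partial>lborel \<partial>lborel)"
  proof (rule nn_integral_cong)
    fix x :: 'a
    show "(\<integral>\<^sup>+y. \<integral>\<^sup>+t. indicator N (x, y, t) \<partial>lborel \<partial>lborel) = (\<integral>\<^sup>+v. indicator N (x, v) \<partial>lborel)"
      by (rule nn_integral_lborel_prod[symmetric], rule measurable_compose[of "\<lambda>v. (x, v)" _ borel]) measurable
  qed
  also have "\<dots> = (\<integral>\<^sup>+w. indicator N w \<partial>lborel)"
    by (rule nn_integral_lborel_prod[symmetric]) measurable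
  also have "\<dots> = 0" using N by simp
  finally have "AE w in (lborel :: ('c \<times> 'a \<times> 'b) measure). indicator N (fst (snd w), snd (snd w), fst w) = (0::ennreal)"
    using ind by (subst (asm) nn_integral_0_iff_AE) auto
  then have "AE w in (lborel :: ('c \<times> 'a \<times> 'b) measure). P (fst (snd w), snd (snd w), fst w)"
    by eventually_elim (auto simp: indicator_def imp split: if_splits)
  from AE_lborel_prodD(1)[OF this] have "AE t in lborel. AE z in lborel. P (fst z, snd z, t)" by simp
  then show ?thesis
    by eventually_elim (drule AE_lborel_prodD(1), simp)
qed

section \<open>Time-independent test functions and Borel versions of the data\<close>

lemma smooth_compact_support_integral:
  assumes \<eta>: "\<eta> \<in> smooth_compact_support T" and T: "0 < T"
  shows "(LINT t:{0<..<T}|lebesgue. deriv \<eta> t) = 0"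
proof -
  have d0: "\<eta> differentiable_on UNIV" and d1: "deriv \<eta> differentiable_on UNIV"
    using \<eta> unfolding smooth_compact_support_def by (auto dest: spec[of _ 0] spec[of _ 1])
  have supp: "closure {t. \<eta> t \<noteq> 0} \<subseteq> {0<..<T}" using \<eta> by (simp add: smooth_compact_support_def)
  have z: "\<eta> 0 = 0" "\<eta> T = 0"
    using supp closure_subset[of "{t. \<eta> t \<noteq> 0}"] by force+
  have cont: "continuous_on UNIV (deriv \<eta>)" by (rule differentiable_imp_continuous_on[OF d1])
  then have [measurable]: "deriv \<eta> \<in> borel_measurable borel" by (rule borel_measurable_continuous_onI)
  have der: "(\<eta> has_real_derivative deriv \<eta> t) (at t)" for t
    using d0 by (simp add: differentiable_on_def DERIV_deriv_iff_real_differentiable)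
  have "(deriv \<eta> has_integral \<eta> T - \<eta> 0) {0..T}"
    using T der by (intro fundamental_theorem_of_calculus)
      (auto simp: has_real_derivative_iff_has_vector_derivative[symmetric] intro: has_field_derivative_at_within)
  then have "integral {0..T} (deriv \<eta>) = 0" using z by (simp add: integral_unique)
  moreover have "set_integrable lborel {0..T} (deriv \<eta>)"
    unfolding set_integrable_def by (rule borel_integrable_compact) (auto intro: continuous_on_subset[OF cont])
  ultimately have "(LINT t:{0..T}|lborel. deriv \<eta> t) = 0"
    using set_borel_integral_eq_integral(2) by metis
  moreover have "(LINT t:{0<..<T}|lborel. deriv \<eta> t) = (LINT t:{0..T}|lborel. deriv \<eta> t)"
    unfolding set_lebesgue_integral_def
  proof (rule integral_cong_AE)
    show "AE t in lborel. indicat_real {0<..<T} t *\<^sub>R deriv \<eta> t = indicat_real {0..T} t *\<^sub>R deriv \<eta> t"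
      using AE_lborel_singleton[of 0] AE_lborel_singleton[of T] by eventually_elim (auto simp: indicator_def)
  qed measurable
  moreover have "(LINT t:{0<..<T}|lebesgue. deriv \<eta> t) = (LINT t:{0<..<T}|lborel. deriv \<eta> t)"
    by (rule set_integral_lebesgue_eq_lborel) auto
  ultimately show ?thesis by simp
qed

text \<open>The weak time derivative is 0 because derivatives of functions with compact support in
  (0, T) integrate to 0. The remaining conditions are finiteness statements for g, which is bounded
  with bounded support and finite energy.\<close>

lemma admissible_test_const:
  fixes g :: "'a::euclidean_space \<Rightarrow> real"
  assumes T: "0 < T" and p: "1 < p" and q: "0 < q"
    and g[measurable]: "g \<in> borel_measurable borel" and g0: "\<And>x. 0 \<le> g x" and gD: "\<And>x. g x \<le> D"
    and supp: "\<And>x. x \<notin> ball x0 R \<Longrightarrow> g x = 0"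
    and gE: "(\<integral>\<^sup>+z. ennreal (\<bar>g (fst z) - g (snd z)\<bar> powr p
          / norm (fst z - snd z) powr (real DIM('a) + p * s)) \<partial>lborel) < \<infinity>"
  shows "admissible_test s p q T (ball x0 R) (\<lambda>(x, t). g x) (\<lambda>_. 0)"
proof -
  have fin: "(\<integral>\<^sup>+x. ennreal (\<bar>g x\<bar> powr r) \<partial>lborel) < \<infinity>" if "0 < r" for r
  proof -
    have "(\<integral>\<^sup>+x. ennreal (\<bar>g x\<bar> powr r) \<partial>lborel) \<le> (\<integral>\<^sup>+x. ennreal (D powr r) * indicator (ball x0 R) x \<partial>lborel)"
    proof (rule nn_integral_mono)
      fix x show "ennreal (\<bar>g x\<bar> powr r) \<le> ennreal (D powr r) * indicator (ball x0 R) x"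
        using g0[of x] gD[of x] supp[of x] that
        by (cases "x \<in> ball x0 R") (auto intro!: ennreal_leI powr_mono2)
    qed
    also have "\<dots> = ennreal (D powr r) * emeasure lborel (ball x0 R)" by (rule nn_integral_cmult_indicator) simp
    also have "\<dots> < \<infinity>" using emeasure_bounded_finite[OF bounded_ball, of x0 R] by (simp add: ennreal_mult_less_top)
    finally show ?thesis .
  qed
  have gB: "(\<lambda>w :: 'a \<times> real. g (fst w)) \<in> borel_measurable lebesgue"
    by (intro measurable_completion) simp
  have gm: "(\<lambda>(x, t). g x) \<in> borel_measurable (lebesgue_on A)" for A :: "('a \<times> real) set"
    using measurable_restrict_space1[OF gB] by (simp add: case_prod_beta)
  have W: "Wsp_norm_pow s p UNIV g < \<infinity>"
  proof -
    have "(\<integral>\<^sup>+x. \<integral>\<^sup>+y. ennreal (\<bar>g x - g y\<bar> powr p / norm (x - y) powr (real DIM('a) + p * s)) \<partial>lborel \<partial>lborel)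
        = (\<integral>\<^sup>+z. ennreal (\<bar>g (fst z) - g (snd z)\<bar> powr p / norm (fst z - snd z) powr (real DIM('a) + p * s)) \<partial>lborel)"
      by (subst nn_integral_lborel_prod) auto
    then show ?thesis
      using gE fin[of p] p by (simp add: Wsp_norm_pow_def nn_integral_completion)
  qed
  have bd: "emeasure lebesgue {c..d} < \<infinity>" for c d :: real
    by (simp add: emeasure_lborel_Icc_eq)
  have "admissible_test s p q T (ball x0 R) (\<lambda>(x, t). g x) (\<lambda>_. 0) \<longleftrightarrow> True"
    unfolding admissible_test_def
  proof (simp, intro conjI allI impI)
    fix c d :: real
    have "(\<integral>\<^sup>+x\<in>ball x0 R. ennreal (\<bar>g x\<bar> powr (q + 1)) \<partial>lebesgue) \<le> (\<integral>\<^sup>+x. ennreal (\<bar>g x\<bar> powr (q + 1)) \<partial>lebesgue)"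
      by (intro nn_integral_mono) (auto simp: indicator_def)
    also have "\<dots> < \<infinity>" using fin[of "q + 1"] q by (simp add: nn_integral_completion)
    finally show "(\<lambda>(x, t). g x) \<in> Lr_Lr (q + 1) (ball x0 R) {c..d}"
      unfolding Lr_Lr_def using gm by (simp add: nn_integral_cmult_indicator ennreal_mult_less_top emeasure_lborel_Icc_eq)
    show "(\<lambda>_. 0) \<in> Lr_Lr (q + 1) (ball x0 R) {c..d}"
      unfolding Lr_Lr_def using q by simp
    have "g \<in> Wsp0 s p (ball x0 R)"
    proof -
      have "g \<in> borel_measurable (lebesgue_on UNIV)"
        by (intro measurable_restrict_space1 measurable_completion) simp
      then show ?thesis using W supp by (simp add: Wsp0_def Wsp_def)
    qed
    moreover have "(\<lambda>(x, t). g x) \<in> Lp_Wsp s p UNIV {c..d}"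
      unfolding Lp_Wsp_def using gm W by (simp add: nn_integral_cmult_indicator ennreal_mult_less_top emeasure_lborel_Icc_eq)
    ultimately show "(\<lambda>(x, t). g x) \<in> Lp_Wsp0 s p (ball x0 R) {c..d}"
      by (simp add: Lp_Wsp0_def)
  next
    show "weak_time_deriv T (ball x0 R) (\<lambda>(x, t). g x) (\<lambda>_. 0)"
      unfolding weak_time_deriv_def using smooth_compact_support_integral[OF _ T] by simp
  next
    show "AE z in lebesgue_on (UNIV \<times> {0<..<T}). 0 \<le> (case z of (x, t) \<Rightarrow> g x)"
      using g0 by (simp add: case_prod_beta)
  qed
  then show ?thesis by simp
qed

lemma lebesgue_on_borel_version:
  fixes f :: "'a::euclidean_space \<Rightarrow> real"
  assumes f: "f \<in> borel_measurable (lebesgue_on A)" and A[measurable]: "A \<in> sets borel"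
  obtains g where "g \<in> borel_measurable borel" "AE x in lborel. x \<in> A \<longrightarrow> f x = g x"
proof -
  have "A \<in> sets lebesgue" using A by (intro sets_completionI_sets) simp
  then have "(\<lambda>x. indicator A x *\<^sub>R f x) \<in> borel_measurable lebesgue"
    using f by (subst (asm) borel_measurable_restrict_space_iff) auto
  from completion_ex_borel_measurable_real[of _ lborel, OF this[unfolded real_scaleR_def]]
  obtain g where g: "g \<in> borel_measurable lborel" "AE x in lborel. indicator A x * f x = g x" by auto
  show ?thesis
  proof
    show "g \<in> borel_measurable borel" using g by simp
    show "AE x in lborel. x \<in> A \<longrightarrow> f x = g x" using g(2) by eventually_elim auto
  qed
qed

text \<open>Clipping a Borel version to [- M, M] changes it only on a null set of the times in (0,
  T). M0 lets M be chosen large enough to contain all levels used later.\<close>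

lemma Linf_borel_version:
  fixes u :: "'a::euclidean_space \<times> real \<Rightarrow> real"
  assumes u: "u \<in> Linf_Linf T"
  obtains M V where "M0 \<le> M" "0 < M" "V \<in> borel_measurable borel" "\<And>w. \<bar>V w\<bar> \<le> M"
    "AE w in lborel. snd w \<in> {0<..<T} \<longrightarrow> u w = V w"
proof -
  have A: "UNIV \<times> {0<..<T} \<in> sets (borel :: ('a \<times> real) measure)"
    by (intro borel_open open_Times) auto
  have "u \<in> borel_measurable (lebesgue_on (UNIV \<times> {0<..<T}))" using u by (simp add: Linf_Linf_def)
  from lebesgue_on_borel_version[OF this A] obtain V0 where V0[measurable]: "V0 \<in> borel_measurable borel"
    and eq: "AE w in lborel. w \<in> UNIV \<times> {0<..<T} \<longrightarrow> u w = V0 w" by blast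
  obtain M1 where "AE t in lebesgue_on {0<..<T}. AE x in lebesgue. \<bar>u (x, t)\<bar> \<le> M1"
    using u by (auto simp: Linf_Linf_def)
  then have "AE t in lebesgue. t \<in> {0<..<T} \<longrightarrow> (AE x in lebesgue. \<bar>u (x, t)\<bar> \<le> M1)"
    by (subst (asm) AE_restrict_space_iff) auto
  then have bd: "AE t in lborel. t \<in> {0<..<T} \<longrightarrow> (AE x in lborel. \<bar>u (x, t)\<bar> \<le> M1)"
    by (simp only: AE_completion_iff)
  define M where "M = max M0 (max M1 1)"
  define V where "V w = max (- M) (min M (V0 w))" for w
  \<comment> \<open>The bound on u is given slice by slice. For V0 it can be turned into a bound
    almost everywhere in space-time, because the exceptional set of V0 is Borel.\<close>
  have "AE w in lborel. snd w \<in> {0<..<T} \<longrightarrow> \<bar>V0 w\<bar> \<le> M1"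
  proof (rule AE_lborel_prodI)
    have "{w :: 'a \<times> real. \<not> (snd w \<in> {0<..<T} \<longrightarrow> \<bar>V0 w\<bar> \<le> M1)} = {w \<in> space borel. 0 < snd w \<and> snd w < T \<and> M1 < \<bar>V0 w\<bar>}"
      by auto
    also have "\<dots> \<in> sets borel" by measurable
    finally show "{w :: 'a \<times> real. \<not> (snd w \<in> {0<..<T} \<longrightarrow> \<bar>V0 w\<bar> \<le> M1)} \<in> sets borel" .
    show "AE t in lborel. AE x in lborel. snd (x, t) \<in> {0<..<T} \<longrightarrow> \<bar>V0 (x, t)\<bar> \<le> M1"
      using AE_lborel_prodD(2)[OF eq] bd
    proof eventually_elim
      case (elim t)
      show ?case
      proof (cases "t \<in> {0<..<T}")
        case True
        with elim(2) have "AE x in lborel. \<bar>u (x, t)\<bar> \<le> M1" by blast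
        with elim(1) show ?thesis by eventually_elim auto
      next
        case False
        then show ?thesis by (intro AE_I2) auto
      qed
    qed
  qed
  with eq have "AE w in lborel. snd w \<in> {0<..<T} \<longrightarrow> u w = V w"
  proof eventually_elim
    case (elim w)
    then show ?case by (cases w) (auto simp: V_def M_def)
  qed
  moreover have "V \<in> borel_measurable borel" unfolding V_def[abs_def] by measurable
  moreover have "\<bar>V w\<bar> \<le> M" for w by (auto simp: V_def M_def)
  ultimately show ?thesis using that[of M V] by (auto simp: M_def)
qed

text \<open>Clamping between the two bounds makes them hold everywhere and changes almost no value.
  On the diagonal both bounds are x / 0 = 0, so k vanishes there. Time becomes the first argument,
  for use with Fubini's theorem.\<close>

lemma kernel_borel_version:
  fixes K :: "'a::euclidean_space \<Rightarrow> 'a \<Rightarrow> real \<Rightarrow> real"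
  assumes K: "admissible_kernel s p \<Lambda> T K" and Lam: "1 \<le> \<Lambda>"
  obtains k where "(\<lambda>(t, x, y). k t x y) \<in> borel_measurable borel"
    "\<And>t x y. inverse \<Lambda> / norm (x - y) powr (real DIM('a) + p * s) \<le> k t x y"
    "\<And>t x y. k t x y \<le> \<Lambda> / norm (x - y) powr (real DIM('a) + p * s)"
    "AE t in lborel. t \<in> {0<..<T} \<longrightarrow> (AE x in lborel. AE y in lborel. K x y t = k t x y)"
proof -
  let ?\<kappa> = "\<lambda>x y :: 'a. norm (x - y) powr (real DIM('a) + p * s)"
  have A: "UNIV \<times> UNIV \<times> {0<..<T} \<in> sets (borel :: ('a \<times> 'a \<times> real) measure)"
    by (intro borel_open open_Times) auto
  have "(\<lambda>(x, y, t). K x y t) \<in> borel_measurable (lebesgue_on (UNIV \<times> UNIV \<times> {0<..<T}))"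
    using K by (simp add: admissible_kernel_def)
  from lebesgue_on_borel_version[OF this A] obtain k0 where k0: "k0 \<in> borel_measurable borel"
    and eq: "AE w in lborel. w \<in> UNIV \<times> UNIV \<times> {0<..<T} \<longrightarrow> (case w of (x, y, t) \<Rightarrow> K x y t) = k0 w" by blast
  have bd: "AE w in lborel. inverse \<Lambda> / ?\<kappa> (fst w) (snd w) \<le> K (fst w) (snd w) t \<and> K (fst w) (snd w) t \<le> \<Lambda> / ?\<kappa> (fst w) (snd w)"
    if "t \<in> {0<..<T}" for t
    using K that unfolding admissible_kernel_def AE_completion_iff by (auto simp: case_prod_beta)
  define k where "k t x y = max (inverse \<Lambda> / ?\<kappa> x y) (min (\<Lambda> / ?\<kappa> x y) (k0 (x, y, t)))" for t x y
  have le: "inverse \<Lambda> / ?\<kappa> x y \<le> \<Lambda> / ?\<kappa> x y" for x y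
  proof (rule divide_right_mono)
    have "inverse \<Lambda> \<le> 1" using Lam by (simp add: inverse_le_1_iff)
    then show "inverse \<Lambda> \<le> \<Lambda>" using Lam by linarith
  qed simp
  show ?thesis
  proof
    have "(\<lambda>w :: real \<times> 'a \<times> 'a. (fst (snd w), snd (snd w), fst w)) \<in> borel \<rightarrow>\<^sub>M borel" by measurable
    from measurable_compose[OF this k0]
    have [measurable]: "(\<lambda>w :: real \<times> 'a \<times> 'a. k0 (fst (snd w), snd (snd w), fst w)) \<in> borel_measurable borel" .
    have "(\<lambda>w :: real \<times> 'a \<times> 'a. k (fst w) (fst (snd w)) (snd (snd w))) \<in> borel_measurable borel"
      unfolding k_def by measurable
    then show "(\<lambda>(t, x, y). k t x y) \<in> borel_measurable borel" by (simp add: case_prod_beta)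
    show "inverse \<Lambda> / ?\<kappa> x y \<le> k t x y" for t x y by (simp add: k_def)
    show "k t x y \<le> \<Lambda> / ?\<kappa> x y" for t x y using le[of x y] by (simp add: k_def)
    show "AE t in lborel. t \<in> {0<..<T} \<longrightarrow> (AE x in lborel. AE y in lborel. K x y t = k t x y)"
      using AE_lborel_tripleD[OF eq]
    proof eventually_elim
      case (elim t)
      show ?case
      proof
        assume t: "t \<in> {0<..<T}"
        from elim AE_lborel_prodD(1)[OF bd[OF t]]
        show "AE x in lborel. AE y in lborel. K x y t = k t x y"
        proof eventually_elim
          case (elim x)
          then show ?case by eventually_elim (use t in \<open>auto simp: k_def\<close>)
        qed
      qed
    qed
  qed
qed

lemma local_energy_finite:
  fixes u :: "'a::euclidean_space \<times> real \<Rightarrow> real"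
  assumes u: "u \<in> Lp_Wsp s p D {a..b}" and ab: "0 < a" "b < T" and D[measurable]: "D \<in> sets borel"
    and V[measurable]: "V \<in> borel_measurable borel" and eq: "AE w in lborel. snd w \<in> {0<..<T} \<longrightarrow> u w = V w"
  shows "(\<integral>\<^sup>+t\<in>{a..b}. (\<integral>\<^sup>+z\<in>D \<times> D. ennreal (\<bar>V (fst z, t) - V (snd z, t)\<bar> powr p
          / norm (fst z - snd z) powr (real DIM('a) + p * s)) \<partial>lborel) \<partial>lborel) < \<infinity>"
proof -
  have "(\<integral>\<^sup>+t\<in>{a..b}. (\<integral>\<^sup>+z\<in>D \<times> D. ennreal (\<bar>V (fst z, t) - V (snd z, t)\<bar> powr p
          / norm (fst z - snd z) powr (real DIM('a) + p * s)) \<partial>lborel) \<partial>lborel)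
      \<le> (\<integral>\<^sup>+t\<in>{a..b}. Wsp_norm_pow s p D (\<lambda>x. u (x, t)) \<partial>lborel)"
  proof (rule nn_integral_mono_AE)
    show "AE t in lborel. (\<integral>\<^sup>+z\<in>D \<times> D. ennreal (\<bar>V (fst z, t) - V (snd z, t)\<bar> powr p
          / norm (fst z - snd z) powr (real DIM('a) + p * s)) \<partial>lborel) * indicator {a..b} t
      \<le> Wsp_norm_pow s p D (\<lambda>x. u (x, t)) * indicator {a..b} t"
      using AE_lborel_prodD(2)[OF eq]
    proof eventually_elim
      case (elim t)
      show ?case
      proof (cases "t \<in> {a..b}")
        case True
        then have ae: "AE x in lborel. u (x, t) = V (x, t)" using elim ab by auto
        have DD: "D \<times> D \<in> sets (borel :: ('a \<times> 'a) measure)"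
        proof -
          have "D \<times> D \<in> sets (borel \<Otimes>\<^sub>M borel)" by (rule pair_measureI[OF D D])
          then show ?thesis unfolding borel_prod .
        qed
        have "(\<integral>\<^sup>+z\<in>D \<times> D. ennreal (\<bar>V (fst z, t) - V (snd z, t)\<bar> powr p
          / norm (fst z - snd z) powr (real DIM('a) + p * s)) \<partial>lborel)
          = (\<integral>\<^sup>+x. \<integral>\<^sup>+y. ennreal (\<bar>V (x, t) - V (y, t)\<bar> powr p / norm (x - y) powr (real DIM('a) + p * s))
              * indicator (D \<times> D) (x, y) \<partial>lborel \<partial>lborel)"
        proof (subst nn_integral_lborel_prod)
          have [measurable]: "(\<lambda>z :: 'a \<times> 'a. V (fst z, t)) \<in> borel_measurable borel" "(\<lambda>z :: 'a \<times> 'a. V (snd z, t)) \<in> borel_measurable borel"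
            by (rule measurable_compose[OF _ V], measurable)+
          have [measurable]: "(\<lambda>z. indicator (D \<times> D) z :: ennreal) \<in> borel_measurable borel"
            using DD by (rule borel_measurable_indicator)
          show "(\<lambda>z. ennreal (\<bar>V (fst z, t) - V (snd z, t)\<bar> powr p
              / norm (fst z - snd z) powr (real DIM('a) + p * s)) * indicator (D \<times> D) z) \<in> borel_measurable borel"
            by measurable
        qed simp
        also have "\<dots> = (\<integral>\<^sup>+x\<in>D. (\<integral>\<^sup>+y\<in>D. ennreal (\<bar>u (x, t) - u (y, t)\<bar> powr p / norm (x - y) powr (real DIM('a) + p * s))
              \<partial>lborel) \<partial>lborel)"
        proof (rule nn_integral_cong_AE)
          show "AE x in lborel. (\<integral>\<^sup>+y. ennreal (\<bar>V (x, t) - V (y, t)\<bar> powr p / norm (x - y) powr (real DIM('a) + p * s))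
              * indicator (D \<times> D) (x, y) \<partial>lborel)
            = (\<integral>\<^sup>+y\<in>D. ennreal (\<bar>u (x, t) - u (y, t)\<bar> powr p / norm (x - y) powr (real DIM('a) + p * s)) \<partial>lborel) * indicator D x"
            using ae
          proof eventually_elim
            case (elim x)
            show ?case
            proof (cases "x \<in> D")
              case True
              have "(\<integral>\<^sup>+y. ennreal (\<bar>V (x, t) - V (y, t)\<bar> powr p / norm (x - y) powr (real DIM('a) + p * s))
                  * indicator (D \<times> D) (x, y) \<partial>lborel)
                = (\<integral>\<^sup>+y\<in>D. ennreal (\<bar>u (x, t) - u (y, t)\<bar> powr p / norm (x - y) powr (real DIM('a) + p * s)) \<partial>lborel)"
                by (rule nn_integral_cong_AE) (use ae True elim in \<open>auto elim!: eventually_mono simp: indicator_def\<close>)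
              then show ?thesis using True by simp
            qed simp
          qed
        qed
        also have "\<dots> \<le> Wsp_norm_pow s p D (\<lambda>x. u (x, t))"
          unfolding Wsp_norm_pow_def nn_integral_completion by simp
        finally show ?thesis using True by simp
      qed simp
    qed
  qed
  also have "\<dots> < \<infinity>"
    using u unfolding Lp_Wsp_def nn_integral_completion by simp
  finally show ?thesis .
qed

section \<open>Weak supersolutions fit the abstract setting\<close>

lemma inverse_Suc_at_right: "filterlim (\<lambda>m. 1 / real (Suc m)) (at_right 0) sequentially"
proof -
  have "(\<lambda>m. 1 / real (Suc m)) \<longlonglongrightarrow> 0" by (rule LIMSEQ_Suc[OF lim_1_over_n])
  then show ?thesis unfolding filterlim_at by (simp add: eventuallyI)
qed

lemma set_integral_shift:
  fixes f :: "real \<Rightarrow> real"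
  shows "(LINT \<sigma>:{0..h}|lborel. f (t + \<sigma>)) = (LINT x:{t..t + h}|lborel. f x)"
  unfolding set_lebesgue_integral_def
  by (subst (2) lborel_integral_real_affine[where c=1 and t=t])
     (auto intro!: Bochner_Integration.integral_cong simp: indicator_def)

text \<open>The local energy is taken on the doubled ball, which therefore has to lie in \<Omega>;
  test functions are supported in the ball of radius R. The boundary values b1 and b2 exist by
  definition, and at times in G they are identified with slice integrals along h = 1 / (m +
  1).\<close>

lemma supersolution_problem:
  fixes \<Omega> :: "'a::euclidean_space set" and u V :: "'a \<times> real \<Rightarrow> real"
  assumes p: "1 < p" and q: "0 < q" and s: "0 < s" "s < 1" and Lam: "1 \<le> \<Lambda>"
    and K: "admissible_kernel s p \<Lambda> T K" and u: "weak_supersolution s p q K \<Omega> T u"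
    and M: "0 < M" and V[measurable]: "V \<in> borel_measurable borel" and VM: "\<And>w. \<bar>V w\<bar> \<le> M"
    and eq: "AE w in lborel. snd w \<in> {0<..<T} \<longrightarrow> u w = V w"
    and C: "0 < C" "\<And>L N. L > 0 \<Longrightarrow> N > 0 \<Longrightarrow>
      (\<integral>\<^sup>+w. ennreal (min (L * norm w) N powr p / norm (w :: 'a) powr (real DIM('a) + p * s)) \<partial>lborel)
      \<le> ennreal (C * L powr (p * s) * N powr (p - p * s))"
    and Rb: "0 < R" "cball x0 (2 * R) \<subseteq> \<Omega>" and ab: "0 < a" "a < b" "b < T"
  obtains k G where "nonlocal_problem p q s \<Lambda> M C V k x0 R a b G"
proof -
  obtain k where k[measurable]: "(\<lambda>(t, x, y). k t x y) \<in> borel_measurable borel"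
    and kl: "\<And>t x y. inverse \<Lambda> / norm (x - y) powr (real DIM('a) + p * s) \<le> k t x y"
    and ku: "\<And>t x y. k t x y \<le> \<Lambda> / norm (x - y) powr (real DIM('a) + p * s)"
    and Kk: "AE t in lborel. t \<in> {0<..<T} \<longrightarrow> (AE x in lborel. AE y in lborel. K x y t = k t x y)"
    using kernel_borel_version[OF K Lam] by blast
  have T: "0 < T" using ab by linarith
  have sub2: "compact_subcylinder \<Omega> T (ball x0 (2 * R)) a b"
    using Rb ab by (simp add: compact_subcylinder_def)
  have "u \<in> Lp_Wsp s p (ball x0 (2 * R)) {a..b}"
    using u sub2 unfolding weak_supersolution_def by blast
  then have le: "(\<integral>\<^sup>+t\<in>{a..b}. (\<integral>\<^sup>+z\<in>ball x0 (2 * R) \<times> ball x0 (2 * R).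
        ennreal (\<bar>V (fst z, t) - V (snd z, t)\<bar> powr p
          / norm (fst z - snd z) powr (real DIM('a) + p * s)) \<partial>lborel) \<partial>lborel) < \<infinity>"
    by (rule local_energy_finite[OF _ ab(1,3) _ V eq]) simp
  interpret nonlocal_kernel p q s \<Lambda> M C V k x0 R a b
    by unfold_locales (use p q s Lam M Rb C VM k kl ku le in auto)
  have slice: "AE t in lborel. t \<in> {0<..<T} \<longrightarrow> (AE x in lborel. u (x, t) = V (x, t))"
    using AE_lborel_prodD(2)[OF eq] by eventually_elim auto
  define W where "W = (\<lambda>(t, x). signed_pow q (V (x, t)))"
  have W[measurable]: "W \<in> borel_measurable borel"
  proof -
    have "(\<lambda>w. signed_pow q (V (snd w, fst w))) \<in> borel_measurable borel" by measurable
    then show ?thesis by (simp add: W_def case_prod_beta)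
  qed
  have WB: "\<bar>W w\<bar> \<le> M powr q" for w
    using VM q by (auto simp: W_def abs_signed_pow case_prod_beta intro!: powr_mono2)
  have Wint: "set_integrable lborel {c..d} (\<lambda>t. W (t, x))" for c d x
    unfolding set_integrable_def
  proof (rule Bochner_Integration.integrable_bound)
    show "integrable lborel (\<lambda>t. M powr q * indicat_real {c..d} t)"
      by (intro integrable_mult_right integrable_real_indicator) (auto simp: emeasure_lborel_Icc_eq)
    have [measurable]: "(\<lambda>t. W (t, x)) \<in> borel_measurable borel"
      by (rule measurable_compose[OF _ W]) measurable
    show "(\<lambda>t. indicat_real {c..d} t *\<^sub>R W (t, x)) \<in> borel_measurable lborel" by measurable
  qed (use WB in \<open>auto simp: indicator_def\<close>)
  \<comment> \<open>For almost every x, t is a one-sided Lebesgue point of the time function W(.,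
    x). The case c = 1 is needed at initial times, c = - 1 at final times; times in G may play both
    roles.\<close>
  define P where "P c t \<longleftrightarrow> (AE x in lborel. (\<lambda>m. real (Suc m) *
    (LINT \<sigma>:{0..1 / real (Suc m)}|lborel. W (t + c * \<sigma>, x))) \<longlonglongrightarrow> W (t, x))" for c t
  have PAE: "AE t in lborel. P c t" if "c = 1 \<or> c = - 1" for c
    unfolding P_def
    by (rule AE_average_tendsto_product[OF sigma_finite_lborel _ that]) (auto simp: lborel_prod Wint)
  define G where "G = {t. P 1 t \<and> P (- 1) t}"
  have "nonlocal_problem p q s \<Lambda> M C V k x0 R a b G"
  proof unfold_locales
    show "AE t in lborel. a < t \<and> t < b \<longrightarrow> t \<in> G"
      using PAE[OF disjI1, OF refl] PAE[OF disjI2, OF refl] by eventually_elim (simp add: G_def)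
  next
    fix g :: "'a \<Rightarrow> real" and t1 t2
    assume g[measurable]: "g \<in> borel_measurable borel" and g0: "\<And>x. 0 \<le> g x" and gM: "\<And>x. g x \<le> 2 * M"
      and supp: "\<And>x. x \<notin> ball x0 R \<Longrightarrow> g x = 0"
      and gE: "(\<integral>\<^sup>+z. ennreal (\<bar>g (fst z) - g (snd z)\<bar> powr p
          / norm (fst z - snd z) powr (real DIM('a) + p * s)) \<partial>lborel) < \<infinity>"
      and t: "a < t1" "t1 < t2" "t2 < b" "t1 \<in> G" "t2 \<in> G"
    have gD: "\<bar>g x\<bar> \<le> 2 * M" for x using g0[of x] gM[of x] by simp
    have "cball x0 R \<subseteq> cball x0 (2 * R)" using R by auto
    also note Rb(2)
    finally have "cball x0 R \<subseteq> \<Omega>" .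
    then have sub: "compact_subcylinder \<Omega> T (ball x0 R) t1 t2"
      using R ab t by (simp add: compact_subcylinder_def)
    have adm: "admissible_test s p q T (ball x0 R) (\<lambda>(x, t). g x) (\<lambda>_. 0)"
      by (rule admissible_test_const[OF T p q g g0 gM supp gE])
    have ws: "\<forall>\<Omega>' t1 t2 \<phi> \<psi>. compact_subcylinder \<Omega> T \<Omega>' t1 t2 \<and> admissible_test s p q T \<Omega>' \<phi> \<psi> \<longrightarrow>
        (\<exists>b1 b2.
           ((\<lambda>h. 1 / h * (LINT t:{t1..t1 + h}|lebesgue. (LINT x:\<Omega>'|lebesgue.
                signed_pow q (u (x, t)) * \<phi> (x, t)))) \<longlongrightarrow> b1) (at_right 0) \<and>
           ((\<lambda>h. 1 / h * (LINT t:{t2 - h..t2}|lebesgue. (LINT x:\<Omega>'|lebesgue.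
                signed_pow q (u (x, t)) * \<phi> (x, t)))) \<longlongrightarrow> b2) (at_right 0) \<and>
           nonlocal_energy p K t1 t2 u \<phi>
           - (LINT t:{t1..t2}|lebesgue. (LINT x:\<Omega>'|lebesgue. signed_pow q (u (x, t)) * \<psi> (x, t)))
           + b2 - b1 \<ge> 0)"
      using u unfolding weak_supersolution_def by (elim conjE)
    from ws[rule_format, OF conjI[OF sub adm]] obtain b1 b2 where
      b1: "((\<lambda>h. 1 / h * (LINT t:{t1..t1 + h}|lebesgue. (LINT x:ball x0 R|lebesgue. signed_pow q (u (x, t)) * g x))) \<longlongrightarrow> b1) (at_right 0)"
      and b2: "((\<lambda>h. 1 / h * (LINT t:{t2 - h..t2}|lebesgue. (LINT x:ball x0 R|lebesgue. signed_pow q (u (x, t)) * g x))) \<longlongrightarrow> b2) (at_right 0)"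
      and ineq: "nonlocal_energy p K t1 t2 u (\<lambda>(x, t). g x) + b2 - b1 \<ge> 0"
      by (elim exE conjE) (simp add: set_lebesgue_integral_def)
    define H where "H t = (LINT x|lborel. W (t, x) * g x)" for t
    have Hm[measurable]: "H \<in> borel_measurable borel"
    proof -
      have "(\<lambda>w :: real \<times> 'a. W w * g (snd w)) \<in> borel_measurable borel" by measurable
      then have "(\<lambda>(t, x). W (t, x) * g x) \<in> borel_measurable (borel \<Otimes>\<^sub>M lborel)"
        by (simp add: case_prod_beta borel_prod cong: measurable_cong_sets)
      from lborel.borel_measurable_lebesgue_integral[OF this] show ?thesis by (simp add: H_def[abs_def])
    qed
    have inner: "AE t in lborel. t \<in> {0<..<T} \<longrightarrow> (LINT x:ball x0 R|lebesgue. signed_pow q (u (x, t)) * g x) = H t"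
      using slice
    proof eventually_elim
      case (elim t)
      show ?case
      proof
        assume "t \<in> {0<..<T}"
        with elim have ae: "AE x in lborel. u (x, t) = V (x, t)" by blast
        have [measurable]: "(\<lambda>x. W (t, x)) \<in> borel_measurable borel"
          by (rule measurable_compose[OF _ W]) measurable
        show "(LINT x:ball x0 R|lebesgue. signed_pow q (u (x, t)) * g x) = H t"
          unfolding set_lebesgue_integral_def H_def
        proof (rule integral_lebesgue_eq_lborel)
          show "AE x in lborel. indicat_real (ball x0 R) x *\<^sub>R (signed_pow q (u (x, t)) * g x) = W (t, x) * g x"
            using ae by eventually_elim (auto simp: W_def supp indicator_def)
        qed measurable
      qed
    qed
    have outer: "(LINT t:{c..d}|lebesgue. (LINT x:ball x0 R|lebesgue. signed_pow q (u (x, t)) * g x)) = (LINT t:{c..d}|lborel. H t)"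
      if "0 < c" "d < T" for c d
      by (rule set_integral_lebesgue_eq_lborel) (use inner that in \<open>auto elim!: eventually_mono\<close>)
    \<comment> \<open>The averaging intervals must stay inside (0, T), where u and V agree almost
      everywhere.\<close>
    obtain n where n: "1 / real (Suc n) < min t1 (T - t2)"
      using nat_approx_posE[of "min t1 (T - t2)"] ab t by auto
    have small: "\<forall>\<^sub>F m in sequentially. 1 / real (Suc m) < min t1 (T - t2)"
      unfolding eventually_sequentially
    proof (intro exI allI impI)
      fix m assume "n \<le> m"
      then have "1 / real (Suc m) \<le> 1 / real (Suc n)" by (simp add: frac_le)
      with n show "1 / real (Suc m) < min t1 (T - t2)" by linarith
    qed
    have B1: "b1 = H t1"
    proof (rule LIMSEQ_unique)
      have "P 1 t1" using t by (simp add: G_def)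
      from average_pairing_tendsto[OF W WB g gD supp this[unfolded P_def]]
      show "(\<lambda>m. real (Suc m) * (LINT \<sigma>:{0..1 / real (Suc m)}|lborel. H (t1 + \<sigma>))) \<longlonglongrightarrow> H t1"
        by (simp add: H_def)
      have "(\<lambda>m. 1 / (1 / real (Suc m)) * (LINT t:{t1..t1 + 1 / real (Suc m)}|lebesgue. (LINT x:ball x0 R|lebesgue. signed_pow q (u (x, t)) * g x))) \<longlonglongrightarrow> b1"
        by (rule filterlim_compose[OF b1 inverse_Suc_at_right])
      then show "(\<lambda>m. real (Suc m) * (LINT \<sigma>:{0..1 / real (Suc m)}|lborel. H (t1 + \<sigma>))) \<longlonglongrightarrow> b1"
      proof (rule Lim_transform_eventually)
        show "\<forall>\<^sub>F m in sequentially. 1 / (1 / real (Suc m)) * (LINT t:{t1..t1 + 1 / real (Suc m)}|lebesgue. (LINT x:ball x0 R|lebesgue. signed_pow q (u (x, t)) * g x))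
            = real (Suc m) * (LINT \<sigma>:{0..1 / real (Suc m)}|lborel. H (t1 + \<sigma>))"
          using small
        proof eventually_elim
          case (elim m)
          have "0 < t1" "t1 + 1 / real (Suc m) < T" using elim t ab by linarith+
          from outer[OF this] show ?case by (simp add: set_integral_shift del: of_nat_Suc)
        qed
      qed
    qed
    have B2: "b2 = H t2"
    proof (rule LIMSEQ_unique)
      have "P (- 1) t2" using t by (simp add: G_def)
      from average_pairing_tendsto[OF W WB g gD supp this[unfolded P_def]]
      show "(\<lambda>m. real (Suc m) * (LINT \<sigma>:{0..1 / real (Suc m)}|lborel. H (t2 - \<sigma>))) \<longlonglongrightarrow> H t2"
        by (simp add: H_def)
      have "(\<lambda>m. 1 / (1 / real (Suc m)) * (LINT t:{t2 - 1 / real (Suc m)..t2}|lebesgue. (LINT x:ball x0 R|lebesgue. signed_pow q (u (x, t)) * g x))) \<longlonglongrightarrow> b2"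
        by (rule filterlim_compose[OF b2 inverse_Suc_at_right])
      then show "(\<lambda>m. real (Suc m) * (LINT \<sigma>:{0..1 / real (Suc m)}|lborel. H (t2 - \<sigma>))) \<longlonglongrightarrow> b2"
      proof (rule Lim_transform_eventually)
        show "\<forall>\<^sub>F m in sequentially. 1 / (1 / real (Suc m)) * (LINT t:{t2 - 1 / real (Suc m)..t2}|lebesgue. (LINT x:ball x0 R|lebesgue. signed_pow q (u (x, t)) * g x))
            = real (Suc m) * (LINT \<sigma>:{0..1 / real (Suc m)}|lborel. H (t2 - \<sigma>))"
          using small
        proof eventually_elim
          case (elim m)
          have "0 < t2 - 1 / real (Suc m)" "t2 < T" using elim t ab by linarith+
          from outer[OF this] show ?case by (simp add: set_integral_reflect del: of_nat_Suc)
        qed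
      qed
    qed
    let ?E = "\<lambda>t. LINT z|lborel. signed_pow (p - 1) (dU t z) * (g (fst z) - g (snd z)) * k t (fst z) (snd z)"
    have Em: "?E \<in> borel_measurable borel" by measurable
    have en: "nonlocal_energy p K t1 t2 u (\<lambda>(x, t). g x) = (LINT t:{t1..t2}|lborel. ?E t)"
      unfolding nonlocal_energy_def
    proof (rule set_integral_lebesgue_eq_lborel[OF _ Em])
      show "AE t in lborel. t \<in> {t1..t2} \<longrightarrow> (LINT x|lebesgue. (LINT y|lebesgue.
          signed_pow (p - 1) (u (x, t) - u (y, t)) * ((case (x, t) of (x, t) \<Rightarrow> g x) - (case (y, t) of (x, t) \<Rightarrow> g x)) * K x y t)) = ?E t"
        using slice Kk pairing_integrable
      proof eventually_elim
        case (elim t)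
        show ?case
        proof
          assume tt: "t \<in> {t1..t2}"
          then have tI: "t \<in> {0<..<T}" "t \<in> {a..b}" using t ab by auto
          have ae: "AE x in lborel. u (x, t) = V (x, t)" and Kae: "AE x in lborel. AE y in lborel. K x y t = k t x y"
            using elim(1,2) tI by auto
          have int: "integrable lborel (\<lambda>z. signed_pow (p - 1) (dU t z) * (g (fst z) - g (snd z)) * k t (fst z) (snd z))"
            using elim(3) tI g supp gE by blast
          let ?h = "\<lambda>x y. signed_pow (p - 1) (V (x, t) - V (y, t)) * (g x - g y) * k t x y"
          have hm: "(\<lambda>z. ?h (fst z) (snd z)) \<in> borel_measurable borel" by measurable
          have "?E t = (LINT x|lborel. (LINT y|lborel. ?h x y))"
            using lborel_pair.integral_fst'[of "\<lambda>z. ?h (fst z) (snd z)"] int by (simp add: lborel_prod)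
          also have "\<dots> = (LINT x|lebesgue. (LINT y|lebesgue. signed_pow (p - 1) (u (x, t) - u (y, t)) * (g x - g y) * K x y t))"
          proof (rule integral_lebesgue_eq_lborel[symmetric])
            show "AE x in lborel. (LINT y|lebesgue. signed_pow (p - 1) (u (x, t) - u (y, t)) * (g x - g y) * K x y t) = (LINT y|lborel. ?h x y)"
              using ae Kae
            proof eventually_elim
              case (elim x)
              show ?case
              proof (rule integral_lebesgue_eq_lborel)
                show "AE y in lborel. signed_pow (p - 1) (u (x, t) - u (y, t)) * (g x - g y) * K x y t = ?h x y"
                  using ae elim(2) by eventually_elim (simp add: elim(1))
                show "(\<lambda>y. ?h x y) \<in> borel_measurable borel" by measurable
              qed
            qed
            have "(\<lambda>(x, y). ?h x y) \<in> borel_measurable (borel \<Otimes>\<^sub>M lborel)"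
              using hm by (simp add: case_prod_beta borel_prod cong: measurable_cong_sets)
            from lborel.borel_measurable_lebesgue_integral[OF this]
            show "(\<lambda>x. LINT y|lborel. ?h x y) \<in> borel_measurable borel" by simp
          qed
          finally show "(LINT x|lebesgue. (LINT y|lebesgue.
            signed_pow (p - 1) (u (x, t) - u (y, t)) * ((case (x, t) of (x, t) \<Rightarrow> g x) - (case (y, t) of (x, t) \<Rightarrow> g x)) * K x y t)) = ?E t"
            by simp
        qed
      qed
    qed simp
    have Hint: "integrable lborel (\<lambda>x. W (t, x) * g x)" for t
    proof (rule Bochner_Integration.integrable_bound)
      show "integrable lborel (\<lambda>x. M powr q * (2 * M) * indicat_real (ball x0 R) x)"
        using emeasure_bounded_finite[OF bounded_ball, of x0 R] by (intro integrable_mult_right integrable_real_indicator) auto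
      have [measurable]: "(\<lambda>x. W (t, x)) \<in> borel_measurable borel"
        by (rule measurable_compose[OF _ W]) measurable
      show "(\<lambda>x. W (t, x) * g x) \<in> borel_measurable lborel" by measurable
      show "AE x in lborel. norm (W (t, x) * g x) \<le> norm (M powr q * (2 * M) * indicat_real (ball x0 R) x)"
      proof (rule AE_I2)
        fix x
        have "\<bar>W (t, x)\<bar> * \<bar>g x\<bar> \<le> M powr q * (2 * M)" using WB gD[of x] M by (intro mult_mono) auto
        then show "norm (W (t, x) * g x) \<le> norm (M powr q * (2 * M) * indicat_real (ball x0 R) x)"
          using supp[of x] M by (cases "x \<in> ball x0 R") (simp_all add: abs_mult)
      qed
    qed
    have "(LINT x|lborel. (signed_pow q (V (x, t2)) - signed_pow q (V (x, t1))) * g x) = H t2 - H t1"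
      using Bochner_Integration.integral_diff[OF Hint[of t2] Hint[of t1]]
      by (simp add: H_def W_def left_diff_distrib)
    with ineq show "- (LINT t:{t1..t2}|lborel. ?E t) \<le> (LINT x|lborel. (signed_pow q (V (x, t2)) - signed_pow q (V (x, t1))) * g x)"
      unfolding en B1 B2 by linarith
  qed
  then show ?thesis by (rule that)
qed

section \<open>Lower bounds from sublevel sets of small density\<close>

lemma cyl_measurable[measurable]: "cyl s p \<theta> r z \<in> sets borel"
  unfolding cyl_def by (intro borel_open open_Times) auto

lemma open_cyl: "open (cyl s p \<theta> r z)"
  unfolding cyl_def by (intro open_Times) auto

text \<open>\<open>de_giorgi\<close> is applied with \<sigma> = 2 \<theta> on one small cylinder
  centred at the point. Smallness is assumed for every \<nu> at some radius below every r0, because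
  the threshold and the admissible radii become known only inside the proof.\<close>

lemma supersolution_lower_bound:
  fixes \<Omega> :: "'a::euclidean_space set" and u :: "'a \<times> real \<Rightarrow> real"
  assumes \<Omega>: "open \<Omega>" and p: "1 < p" and q: "0 < q" and s: "0 < s" "s < 1" and Lam: "1 \<le> \<Lambda>"
    and K: "admissible_kernel s p \<Lambda> T K" and u: "weak_supersolution s p q K \<Omega> T u"
    and z: "x0 \<in> \<Omega>" "0 < t0" "t0 < T" and \<theta>: "0 < \<theta>" and \<epsilon>: "0 < \<epsilon>"
    and small: "\<And>\<nu> r0. \<lbrakk>0 < \<nu>; 0 < r0\<rbrakk> \<Longrightarrow> \<exists>r. 0 < r \<and> r < r0 \<and>
      emeasure lebesgue {w \<in> cyl s p \<theta> r (x0, t0). u w < c} \<le> ennreal (\<nu> * r powr (real DIM('a) + p * s))"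
  obtains N where "open N" "(x0, t0) \<in> N" "AE w in lborel. w \<in> N \<longrightarrow> c - \<epsilon> \<le> u w"
proof -
  have ps: "0 < p * s" using p s by simp
  have uL: "u \<in> Linf_Linf T" using u by (simp add: weak_supersolution_def)
  obtain M V where M: "\<bar>c\<bar> + \<epsilon> \<le> M" "0 < M" and V[measurable]: "V \<in> borel_measurable borel" and VM: "\<And>w. \<bar>V w\<bar> \<le> M"
    and eq: "AE w in lborel. snd w \<in> {0<..<T} \<longrightarrow> u w = V w"
    by (rule Linf_borel_version[OF uL, of "\<bar>c\<bar> + \<epsilon>"]) blast
  \<comment> \<open>The levels used below stay away from \<open>0\<close>, where \<open>|u|\<^sup>q\<^sup>-\<^sup>1 u\<close> may degenerate.\<close>
  obtain l e where le: "0 < e" "l \<le> c" "c - \<epsilon> \<le> l - e" "0 < l - e \<or> l < 0"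
  proof (cases "0 < c")
    case True
    then show ?thesis using that[of "min \<epsilon> (c / 2)" c] \<epsilon> by (auto simp: min_def field_simps)
  next
    case False
    then show ?thesis using that[of "\<epsilon> / 2" "c - \<epsilon> / 2"] \<epsilon> by auto
  qed
  have lM: "\<bar>l\<bar> \<le> M" "\<bar>l - e\<bar> \<le> M" using M le by linarith+
  obtain c0 where c0: "0 < c0" "\<And>l1 l2 u. \<lbrakk>l - e \<le> l2; l2 \<le> l1; l1 \<le> l; u \<le> l2\<rbrakk> \<Longrightarrow> c0 * (l1 - l2)\<^sup>2 \<le> bregman q l1 u"
    using bregman_quadratic[OF q le(4)] by blast
  obtain C where C: "0 < C" "\<And>L N. L > 0 \<Longrightarrow> N > 0 \<Longrightarrow>
      (\<integral>\<^sup>+w. ennreal (min (L * norm w) N powr p / norm (w :: 'a) powr (real DIM('a) + p * s)) \<partial>lborel)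
      \<le> ennreal (C * L powr (p * s) * N powr (p - p * s))"
    using truncated_kernel_bound[OF s p, where 'a = 'a] by blast
  have \<sigma>: "0 < 2 * \<theta>" using \<theta> by simp
  obtain \<nu> where \<nu>: "0 < \<nu>" and dg: "\<And>(U :: 'a \<times> real \<Rightarrow> real) k x0 R a b G.
      \<lbrakk>nonlocal_problem p q s \<Lambda> M C U k x0 R a b G; b - a = 2 * \<theta> * R powr (p * s);
       (LINT t:{a..b}|lborel. measure lborel {x \<in> ball x0 R. U (x, t) < l}) \<le> \<nu> * R powr (real DIM('a) + p * s)\<rbrakk>
      \<Longrightarrow> AE t in lborel. a + (b - a) / 4 < t \<and> t < b \<longrightarrow> (AE x in lborel. x \<in> ball x0 (R / 2) \<longrightarrow> l - e \<le> U (x, t))"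
    using de_giorgi[OF p q s Lam M(2) C(1) \<sigma> le(1) c0(1) lM c0(2), where 'a = 'a] by blast
  obtain d where d: "0 < d" "cball x0 d \<subseteq> \<Omega>" using \<Omega> z(1) open_contains_cball by blast
  define \<delta> where "\<delta> = min t0 (T - t0) / \<theta>"
  have \<delta>: "0 < \<delta>" using z \<theta> by (simp add: \<delta>_def)
  \<comment> \<open>d / 2 keeps the doubled ball in \<Omega>; the other bound keeps the time
    interval of half-length \<theta> r^(p s) in (0, T).\<close>
  define r0 where "r0 = min (d / 2) (\<delta> powr (1 / (p * s)))"
  have r0: "0 < r0" using d \<delta> by (simp add: r0_def)
  from small[OF \<nu> r0] obtain r where r: "0 < r" "r < r0"
    and sm: "emeasure lebesgue {w \<in> cyl s p \<theta> r (x0, t0). u w < c} \<le> ennreal (\<nu> * r powr (real DIM('a) + p * s))" by blast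
  define h where "h = \<theta> * r powr (p * s)"
  have h: "0 < h" "h < t0" "h < T - t0"
  proof -
    show "0 < h" using \<theta> r by (simp add: h_def)
    have "r powr (p * s) < (\<delta> powr (1 / (p * s))) powr (p * s)"
      using r ps by (intro powr_less_mono2) (auto simp: r0_def)
    also have "\<dots> = \<delta>" using \<delta> p s by (simp add: powr_powr)
    finally have "h < min t0 (T - t0)" using \<theta> by (simp add: h_def \<delta>_def field_simps)
    then show "h < t0" "h < T - t0" by auto
  qed
  define a b where "a = t0 - h" and "b = t0 + h"
  have ab: "0 < a" "a < b" "b < T" "b - a = 2 * \<theta> * r powr (p * s)" using h by (auto simp: a_def b_def h_def)
  have "cball x0 (2 * r) \<subseteq> cball x0 d" using r by (auto simp: r0_def)
  with d have rb: "cball x0 (2 * r) \<subseteq> \<Omega>" by blast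
  obtain k G where NP: "nonlocal_problem p q s \<Lambda> M C V k x0 r a b G"
    using supersolution_problem[OF p q s Lam K u M(2) V VM eq C r(1) rb ab(1-3)] by blast
  interpret nonlocal_problem p q s \<Lambda> M C V k x0 r a b G by (rule NP)
  have cyl: "cyl s p \<theta> r (x0, t0) = ball x0 r \<times> {a<..<b}"
    by (simp add: cyl_def a_def b_def h_def mult.commute)
  define E where "E = {w \<in> cyl s p \<theta> r (x0, t0). V w < l}"
  have E[measurable]: "E \<in> sets borel"
  proof -
    have "E = cyl s p \<theta> r (x0, t0) \<inter> (V -` {..<l} \<inter> space borel)" by (auto simp: E_def)
    also have "\<dots> \<in> sets borel" by (intro sets.Int cyl_measurable measurable_sets[OF V]) simp
    finally show ?thesis .
  qed
  have E_le: "emeasure lborel E \<le> ennreal (\<nu> * r powr (real DIM('a) + p * s))"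
  proof -
    let ?A = "{w \<in> cyl s p \<theta> r (x0, t0). u w < c}" and ?B = "cyl s p \<theta> r (x0, t0) \<inter> (V -` {..<c} \<inter> space borel)"
    have B: "?B \<in> sets borel" by (intro sets.Int cyl_measurable measurable_sets[OF V]) simp
    have "AE w in lborel. w \<in> ?B \<longleftrightarrow> w \<in> ?A"
      using eq by eventually_elim (use ab in \<open>auto simp: cyl\<close>)
    then have AB: "AE w in lebesgue. w \<in> ?B \<longleftrightarrow> w \<in> ?A" by (simp only: AE_completion_iff)
    have "?A \<in> sets lebesgue"
      by (rule completion.in_sets_AE[OF AB]) (use B in auto)
    moreover have "AE w in lebesgue. w \<in> E \<longrightarrow> w \<in> ?A"
      using AB by eventually_elim (use le in \<open>auto simp: E_def\<close>)
    ultimately have "emeasure lebesgue E \<le> emeasure lebesgue ?A"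
      by (intro emeasure_mono_AE)
    also note sm
    finally show ?thesis using E by simp
  qed
  have "ennreal (LINT t:{a..b}|lborel. sublevel_measure r l t) = (\<integral>\<^sup>+t. ennreal (indicat_real {a..b} t *\<^sub>R sublevel_measure r l t) \<partial>lborel)"
    unfolding set_lebesgue_integral_def
    by (rule nn_integral_eq_integral[symmetric])
       (use sublevel_measure_set_integrable[of a b r l] sublevel_measure_nonneg in \<open>auto simp: set_integrable_def\<close>)
  also have "\<dots> = (\<integral>\<^sup>+t. \<integral>\<^sup>+x. indicator E (x, t) \<partial>lborel \<partial>lborel)"
  proof (rule nn_integral_cong_AE)
    show "AE t in lborel. ennreal (indicat_real {a..b} t *\<^sub>R sublevel_measure r l t) = (\<integral>\<^sup>+x. indicator E (x, t) \<partial>lborel)"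
      using AE_lborel_singleton[of a] AE_lborel_singleton[of b]
    proof eventually_elim
      case (elim t)
      show ?case
      proof (cases "t \<in> {a..b}")
        case True
        then have "a < t" "t < b" using elim by auto
        then have "(\<integral>\<^sup>+x. indicator E (x, t) \<partial>lborel) = (\<integral>\<^sup>+x. indicator (sublevel r l t) x \<partial>lborel)"
          by (intro nn_integral_cong) (auto simp: indicator_def E_def cyl sublevel_def)
        then show ?thesis using True by (simp add: emeasure_sublevel)
      next
        case False
        then have "indicator E (x, t) = (0 :: ennreal)" for x by (auto simp: E_def cyl)
        then show ?thesis using False by simp
      qed
    qed
  qed
  also have "\<dots> = emeasure lborel E"
    by (subst nn_integral_lborel_prod_swap[symmetric]) auto
  also note E_le
  finally have "(LINT t:{a..b}|lborel. sublevel_measure r l t) \<le> \<nu> * r powr (real DIM('a) + p * s)"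
    using \<nu> by (subst (asm) ennreal_le_iff) auto
  then have "(LINT t:{a..b}|lborel. measure lborel {x \<in> ball x0 r. V (x, t) < l}) \<le> \<nu> * r powr (real DIM('a) + p * s)"
    by (simp only: sublevel_measure_def sublevel_def)
  from dg[OF NP ab(4) this]
  have concl: "AE t in lborel. a + (b - a) / 4 < t \<and> t < b \<longrightarrow> (AE x in lborel. x \<in> ball x0 (r / 2) \<longrightarrow> l - e \<le> V (x, t))" .
  \<comment> \<open>As t0 is the midpoint of (a, b), it exceeds a + (b - a) / 4 and lies in the
    interior of the times covered by the bound.\<close>
  define N where "N = ball x0 (r / 2) \<times> {a + (b - a) / 4<..<b}"
  have oN: "open N" unfolding N_def by (intro open_Times) auto
  have "AE w in lborel. w \<in> N \<longrightarrow> l - e \<le> V w"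
  proof (rule AE_lborel_prodI)
    have "{w. \<not> (w \<in> N \<longrightarrow> l - e \<le> V w)} = N \<inter> (V -` {..<l - e} \<inter> space borel)" by auto
    also have "\<dots> \<in> sets borel" using oN by (intro sets.Int measurable_sets[OF V]) auto
    finally show "{w. \<not> (w \<in> N \<longrightarrow> l - e \<le> V w)} \<in> sets borel" .
    show "AE t in lborel. AE x in lborel. (x, t) \<in> N \<longrightarrow> l - e \<le> V (x, t)"
      using concl
    proof eventually_elim
      case (elim t)
      show ?case
      proof (cases "a + (b - a) / 4 < t \<and> t < b")
        case True
        with elim have "AE x in lborel. x \<in> ball x0 (r / 2) \<longrightarrow> l - e \<le> V (x, t)" by blast
        then show ?thesis by eventually_elim (simp add: N_def)
      next
        case False
        then show ?thesis by (intro AE_I2) (auto simp: N_def)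
      qed
    qed
  qed
  with eq have "AE w in lborel. w \<in> N \<longrightarrow> c - \<epsilon> \<le> u w"
  proof eventually_elim
    case (elim w)
    show ?case
    proof
      assume wN: "w \<in> N"
      then have "snd w \<in> {0<..<T}" using ab by (auto simp: N_def field_simps)
      with elim wN le show "c - \<epsilon> \<le> u w" by auto
    qed
  qed
  moreover have "(x0, t0) \<in> N" using r h by (simp add: N_def a_def b_def)
  ultimately show ?thesis using that oN by blast
qed

section \<open>Density and semicontinuity\<close>

lemma emeasure_lborel_shift:
  fixes A :: "'d::euclidean_space set"
  assumes [measurable]: "A \<in> sets borel"
  shows "emeasure lborel {z. z + w \<in> A} = emeasure lborel A" "{z. z + w \<in> A} \<in> sets borel"
proof -
  have "{z. z + w \<in> A} = (\<lambda>z. z + w) -` A \<inter> space borel" by auto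
  also have "\<dots> \<in> sets borel" by measurable
  finally show m[measurable]: "{z. z + w \<in> A} \<in> sets borel" .
  have "emeasure lborel {z. z + w \<in> A} = (\<integral>\<^sup>+z. indicator {z. z + w \<in> A} z \<partial>lborel)" by simp
  also have "\<dots> = (\<integral>\<^sup>+z. indicator A (w + z) \<partial>lborel)"
    by (intro nn_integral_cong) (simp add: indicator_def add.commute)
  also have "\<dots> = emeasure lborel A"
    by (subst nn_integral_lborel_translation) auto
  finally show "emeasure lborel {z. z + w \<in> A} = emeasure lborel A" .
qed

text \<open>E is squeezed between a compact F and an open U, up to measure e / 2 on each side. For
  short w a point z with z + w in F lies in U, so only U - E and a shifted copy of E - F can
  contribute.\<close>

lemma emeasure_shift_difference:
  fixes E :: "'d::euclidean_space set"
  assumes E[measurable]: "E \<in> sets borel" and fin: "bounded E" and e: "0 < (e :: real)"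
  obtains \<delta> where "0 < \<delta>" "\<And>w. norm w < \<delta> \<Longrightarrow> emeasure lborel {z. z \<notin> E \<and> z + w \<in> E} \<le> ennreal e"
proof -
  have El: "E \<in> sets lebesgue" using E by simp
  obtain U where U: "open U" "E \<subseteq> U" "U - E \<in> lmeasurable" "emeasure lebesgue (U - E) < ennreal (e / 2)"
    using sets_lebesgue_outer_open[OF El, of "e / 2"] e by auto
  obtain F where F: "closed F" "F \<subseteq> E" "E - F \<in> lmeasurable" "emeasure lebesgue (E - F) < ennreal (e / 2)"
    using sets_lebesgue_inner_closed[OF El, of "e / 2"] e by auto
  have "compact F" using F fin by (meson bounded_subset compact_eq_bounded_closed)
  moreover have "F \<subseteq> U" using F U by blast
  ultimately obtain \<delta> where \<delta>: "0 < \<delta>" "(\<Union>x\<in>F. ball x \<delta>) \<subseteq> U"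
    using compact_subset_open_imp_ball_epsilon_subset[OF _ U(1)] by blast
  have [measurable]: "U \<in> sets borel" "F \<in> sets borel" using U F by auto
  have "emeasure lborel {z. z \<notin> E \<and> z + w \<in> E} \<le> ennreal e" if w: "norm w < \<delta>" for w
  proof -
    have "{z. z \<notin> E \<and> z + w \<in> E} \<subseteq> (U - E) \<union> {z. z + w \<in> E - F}"
    proof (intro subsetI, elim CollectE conjE)
      fix z assume z: "z \<notin> E" "z + w \<in> E"
      show "z \<in> (U - E) \<union> {z. z + w \<in> E - F}"
      proof (cases "z + w \<in> F")
        case True
        have "z \<in> ball (z + w) \<delta>" using w by (simp add: dist_norm)
        then show ?thesis using True \<delta> z by blast
      qed (use z in blast)
    qed
    then have "emeasure lborel {z. z \<notin> E \<and> z + w \<in> E} \<le> emeasure lborel ((U - E) \<union> {z. z + w \<in> E - F})"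
      using emeasure_lborel_shift(2)[of "E - F" w] by (intro emeasure_mono) auto
    also have "\<dots> \<le> emeasure lborel (U - E) + emeasure lborel {z. z + w \<in> E - F}"
      using emeasure_lborel_shift(2)[of "E - F" w] by (intro emeasure_subadditive) auto
    also have "\<dots> = emeasure lborel (U - E) + emeasure lborel (E - F)"
      by (subst emeasure_lborel_shift(1)) auto
    also have "\<dots> \<le> ennreal (e / 2) + ennreal (e / 2)"
      using U(4) F(4) by (intro add_mono) auto
    also have "\<dots> = ennreal e" using e by (subst ennreal_plus[symmetric]) auto
    finally show ?thesis .
  qed
  with \<delta>(1) that show ?thesis by blast
qed

lemma emeasure_cyl:
  fixes z :: "'a::euclidean_space \<times> real"
  assumes "0 < r" "0 < \<theta>"
  shows "emeasure lborel (cyl s p \<theta> r z) = ennreal (2 * \<theta> * unit_ball_vol (real DIM('a)) * r powr (real DIM('a) + p * s))"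
proof -
  let ?h = "\<theta> * r powr (s * p)"
  have h: "0 < ?h" using assms by simp
  have "emeasure lborel (cyl s p \<theta> r z) = emeasure (lborel \<Otimes>\<^sub>M lborel) (ball (fst z) r \<times> {snd z - ?h<..<snd z + ?h})"
    by (simp add: cyl_def lborel_prod)
  also have "\<dots> = emeasure lborel (ball (fst z) r) * emeasure lborel {snd z - ?h<..<snd z + ?h}"
    by (rule lborel.emeasure_pair_measure_Times) auto
  also have "\<dots> = ennreal (unit_ball_vol (real DIM('a)) * r ^ DIM('a)) * ennreal (2 * ?h)"
    using assms h by (simp add: emeasure_ball)
  also have "\<dots> = ennreal (2 * \<theta> * unit_ball_vol (real DIM('a)) * r powr (real DIM('a) + p * s))"
    using assms h by (subst ennreal_mult[symmetric]) (auto simp: powr_add powr_realpow mult_ac)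
  finally show ?thesis .
qed

lemma cyl_subset_ball:
  assumes "0 < \<delta>" "0 < p * s" "0 < \<theta>"
  obtains \<rho> where "0 < \<rho>" "\<And>r z. 0 < r \<Longrightarrow> r < \<rho> \<Longrightarrow> cyl s p \<theta> r z \<subseteq> ball z \<delta>"
proof
  define \<rho> where "\<rho> = min (\<delta> / 2) ((\<delta> / (2 * \<theta>)) powr (1 / (p * s)))"
  show "0 < \<rho>" using assms by (simp add: \<rho>_def)
  fix r and z :: "'a::euclidean_space \<times> real"
  assume r: "0 < r" "r < \<rho>"
  have "r powr (s * p) < ((\<delta> / (2 * \<theta>)) powr (1 / (p * s))) powr (s * p)"
    using r assms by (intro powr_less_mono2) (auto simp: \<rho>_def mult.commute)
  also have "\<dots> = (\<delta> / (2 * \<theta>)) powr (1 / (p * s) * (s * p))" by (simp only: powr_powr)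
  also have "1 / (p * s) * (s * p) = 1"
  proof -
    have "p \<noteq> 0" "s \<noteq> 0" using assms(2) by auto
    then show ?thesis by simp
  qed
  finally have h: "\<theta> * r powr (s * p) < \<delta> / 2" using assms by (simp add: field_simps)
  show "cyl s p \<theta> r z \<subseteq> ball z \<delta>"
  proof
    fix w assume "w \<in> cyl s p \<theta> r z"
    then have "dist (fst z) (fst w) < r" "\<bar>snd z - snd w\<bar> < \<theta> * r powr (s * p)"
      by (auto simp: cyl_def abs_less_iff)
    then have "dist (fst z) (fst w) < \<delta> / 2" "dist (snd z) (snd w) < \<delta> / 2"
      using r h by (auto simp: \<rho>_def dist_real_def)
    moreover have "dist z w \<le> dist (fst z) (fst w) + dist (snd z) (snd w)"
      unfolding dist_prod_def by (rule sqrt_sum_squares_le_sum) auto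
    ultimately show "w \<in> ball z \<delta>" by simp
  qed
qed

lemma cyl_translate: "z + w \<in> cyl s p \<theta> r z \<longleftrightarrow> w \<in> cyl s p \<theta> r 0"
  by (auto simp: cyl_def mem_Times_iff dist_norm)

text \<open>Averages over shrinking cylinders of an indicator function tend to it in \<open>L\<^sup>1\<close>, hence, by Fatou's
  lemma, along the sequence \<open>r = 1 / (j + 1)\<close> the lower density vanishes almost everywhere outside.\<close>
lemma AE_lower_density_zero:
  fixes E :: "('a::euclidean_space \<times> real) set"
  assumes E[measurable]: "E \<in> sets borel" and bE: "bounded E" and ps: "0 < p * s" and \<theta>: "0 < \<theta>"
  shows "AE z in lborel. z \<notin> E \<longrightarrow> (\<forall>\<nu>>0. \<forall>r0>0. \<exists>r. 0 < r \<and> r < r0 \<and>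
    emeasure lborel (E \<inter> cyl s p \<theta> r z) \<le> ennreal (\<nu> * r powr (real DIM('a) + p * s)))"
proof -
  let ?\<alpha> = "real DIM('a) + p * s"
  define r where "r j = 1 / real (Suc j)" for j
  define c where "c j = 2 * \<theta> * unit_ball_vol (real DIM('a)) * r j powr ?\<alpha>" for j
  have r: "0 < r j" for j by (simp add: r_def)
  have c: "0 < c j" for j using \<theta> r[of j] by (simp add: c_def)
  let ?Q = "\<lambda>j. cyl s p \<theta> (r j) (0 :: 'a \<times> real)"
  have cQ: "emeasure lborel (?Q j) = ennreal (c j)" for j
    unfolding c_def by (rule emeasure_cyl[OF r \<theta>])
  have shiftm[measurable]: "(\<lambda>w :: ('a \<times> real) \<times> ('a \<times> real). indicator E (fst w + snd w) :: ennreal) \<in> borel_measurable borel"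
    by (rule measurable_compose[of "\<lambda>w. fst w + snd w" _ borel]) measurable
  \<comment> \<open>The density of E in the cylinder at z, written over the fixed cylinder at 0:
    this shows measurability in z and allows the shift w to be integrated last.\<close>
  define h where "h j z = (\<integral>\<^sup>+w. indicator E (z + w) * indicator (?Q j) w \<partial>lborel) / ennreal (c j)" for j z
  have hm[measurable]: "h j \<in> borel_measurable borel" for j
  proof -
    have Qm: "(\<lambda>w :: ('a \<times> real) \<times> ('a \<times> real). indicator (?Q j) (snd w) :: ennreal) \<in> borel_measurable borel"
      by (rule measurable_compose[OF borel_measurable_fst_snd(2)]) measurable
    have "(\<lambda>w :: ('a \<times> real) \<times> ('a \<times> real). indicator E (fst w + snd w) * indicator (?Q j) (snd w) :: ennreal) \<in> borel_measurable borel"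
      using shiftm Qm by (rule borel_measurable_times_ennreal)
    then have "(\<lambda>(z, w). indicator E (z + w) * indicator (?Q j) w :: ennreal) \<in> borel_measurable (lborel \<Otimes>\<^sub>M lborel)"
      by (simp add: lborel_prod case_prod_beta)
    from lborel.borel_measurable_nn_integral_fst[OF this]
    have [measurable]: "(\<lambda>z. \<integral>\<^sup>+w. indicator E (z + w) * indicator (?Q j) w \<partial>lborel) \<in> borel_measurable borel" by simp
    show ?thesis unfolding h_def[abs_def] by measurable
  qed
  have hE: "h j z = emeasure lborel (E \<inter> cyl s p \<theta> (r j) z) / ennreal (c j)" for j z
  proof -
    have "emeasure lborel (E \<inter> cyl s p \<theta> (r j) z) = (\<integral>\<^sup>+w. indicator (E \<inter> cyl s p \<theta> (r j) z) w \<partial>lborel)"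
      by simp
    also have "\<dots> = (\<integral>\<^sup>+w. indicator (E \<inter> cyl s p \<theta> (r j) z) (z + w) \<partial>lborel)"
      by (rule nn_integral_lborel_translation[symmetric]) measurable
    also have "\<dots> = (\<integral>\<^sup>+w. indicator E (z + w) * indicator (?Q j) w \<partial>lborel)"
      by (intro nn_integral_cong) (auto simp: indicator_def cyl_translate)
    finally show ?thesis by (simp add: h_def)
  qed
  have cc: "x / ennreal (c j) * ennreal (c j) = x" for x :: ennreal and j
    using c[of j] by (simp add: ennreal_divide_times)
  \<comment> \<open>After the integrals are exchanged, the inner one measures the points outside E
    that the shift w moves into E; this is at most e once the cylinder is small.\<close>
  have small: "\<forall>\<^sub>F j in sequentially. (\<integral>\<^sup>+z. indicator (- E) z * h j z \<partial>lborel) \<le> ennreal e" if e: "0 < e" for e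
  proof -
    obtain \<delta> where \<delta>: "0 < \<delta>" "\<And>w. norm w < \<delta> \<Longrightarrow> emeasure lborel {z. z \<notin> E \<and> z + w \<in> E} \<le> ennreal e"
      using emeasure_shift_difference[OF E bE e] by blast
    obtain \<rho> where \<rho>: "0 < \<rho>" "\<And>r z. 0 < r \<Longrightarrow> r < \<rho> \<Longrightarrow> cyl s p \<theta> r (z :: 'a \<times> real) \<subseteq> ball z \<delta>"
      using cyl_subset_ball[OF \<delta>(1) ps \<theta>, where 'a = 'a] by blast
    obtain n where n: "1 / real (Suc n) < \<rho>" using nat_approx_posE[OF \<rho>(1)] by auto
    show ?thesis
      unfolding eventually_sequentially
    proof (intro exI allI impI)
      fix j assume "n \<le> j"
      then have "r j \<le> 1 / real (Suc n)" by (simp add: r_def frac_le)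
      with n have "r j < \<rho>" by linarith
      then have sub: "?Q j \<subseteq> ball 0 \<delta>" by (rule \<rho>(2)[OF r])
      let ?J = "\<integral>\<^sup>+z. \<integral>\<^sup>+w. indicator (- E) z * (indicator E (z + w) * indicator (?Q j) w) \<partial>lborel \<partial>lborel"
      have "(\<integral>\<^sup>+z. indicator (- E) z * h j z \<partial>lborel) = (\<integral>\<^sup>+z. (\<integral>\<^sup>+w. indicator (- E) z * (indicator E (z + w) * indicator (?Q j) w) \<partial>lborel) / ennreal (c j) \<partial>lborel)"
        by (intro nn_integral_cong) (auto simp: h_def indicator_def)
      also have "\<dots> = ?J / ennreal (c j)"
      proof (rule nn_integral_divide)
        have "(\<lambda>z. \<integral>\<^sup>+w. indicator (- E) z * (indicator E (z + w) * indicator (?Q j) w) \<partial>lborel) = (\<lambda>z. indicator (- E) z * (h j z * ennreal (c j)))"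
          unfolding h_def cc by (auto simp: indicator_def fun_eq_iff)
        also have "\<dots> \<in> borel_measurable lborel" by measurable
        finally show "(\<lambda>z. \<integral>\<^sup>+w. indicator (- E) z * (indicator E (z + w) * indicator (?Q j) w) \<partial>lborel) \<in> borel_measurable lborel" .
      qed
      also have "?J = (\<integral>\<^sup>+w. \<integral>\<^sup>+z. indicator (- E) z * (indicator E (z + w) * indicator (?Q j) w) \<partial>lborel \<partial>lborel)"
      proof (rule lborel_pair.Fubini')
        have Qm: "(\<lambda>w :: ('a \<times> real) \<times> ('a \<times> real). indicator (?Q j) (fst w) :: ennreal) \<in> borel_measurable borel"
          by (rule measurable_compose[OF borel_measurable_fst_snd(1)]) measurable
        have Em: "(\<lambda>w :: ('a \<times> real) \<times> ('a \<times> real). indicator (- E) (snd w) :: ennreal) \<in> borel_measurable borel"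
          by (rule measurable_compose[OF borel_measurable_fst_snd(2)]) measurable
        have shiftm': "(\<lambda>w :: ('a \<times> real) \<times> ('a \<times> real). indicator E (snd w + fst w) :: ennreal) \<in> borel_measurable borel"
          using shiftm by (simp add: add.commute)
        have "(\<lambda>w. indicator (- E) (snd w) * (indicator E (snd w + fst w) * indicator (?Q j) (fst w)) :: ennreal) \<in> borel_measurable borel"
          by (rule borel_measurable_times_ennreal[OF Em borel_measurable_times_ennreal[OF shiftm' Qm]])
        then show "(\<lambda>(w, z). indicator (- E) z * (indicator E (z + w) * indicator (?Q j) w) :: ennreal) \<in> borel_measurable (lborel \<Otimes>\<^sub>M lborel)"
          by (simp add: lborel_prod case_prod_beta)
      qed
      also have "\<dots> \<le> (\<integral>\<^sup>+w. ennreal e * indicator (?Q j) w \<partial>lborel)"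
      proof (rule nn_integral_mono)
        fix w :: "'a \<times> real"
        show "(\<integral>\<^sup>+z. indicator (- E) z * (indicator E (z + w) * indicator (?Q j) w) \<partial>lborel) \<le> ennreal e * indicator (?Q j) w"
        proof (cases "w \<in> ?Q j")
          case True
          then have "norm w < \<delta>" using sub by auto
          have m: "{z. z \<notin> E \<and> z + w \<in> E} \<in> sets borel"
          proof -
            have "{z. z \<notin> E \<and> z + w \<in> E} = - E \<inter> {z. z + w \<in> E}" by auto
            then show ?thesis using emeasure_lborel_shift(2)[OF E] by simp
          qed
          have "(\<integral>\<^sup>+z. indicator (- E) z * (indicator E (z + w) * indicator (?Q j) w) \<partial>lborel) = (\<integral>\<^sup>+z. indicator {z. z \<notin> E \<and> z + w \<in> E} z \<partial>lborel)"
            using True by (intro nn_integral_cong) (auto simp: indicator_def)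
          also have "\<dots> \<le> ennreal e" using m \<delta>(2)[OF \<open>norm w < \<delta>\<close>] by simp
          finally show ?thesis using True by simp
        qed simp
      qed
      also have "\<dots> = ennreal e * ennreal (c j)" by (simp add: nn_integral_cmult_indicator cQ)
      also have "\<dots> / ennreal (c j) = ennreal e" using c[of j] e by (simp add: ennreal_mult_divide_eq)
      finally show "(\<integral>\<^sup>+z. indicator (- E) z * h j z \<partial>lborel) \<le> ennreal e"
        by (simp add: divide_right_mono_ennreal)
    qed
  qed
  have "(\<integral>\<^sup>+z. liminf (\<lambda>j. indicator (- E) z * h j z) \<partial>lborel) \<le> liminf (\<lambda>j. \<integral>\<^sup>+z. indicator (- E) z * h j z \<partial>lborel)"
    by (rule nn_integral_liminf) measurable
  also have "\<dots> \<le> 0"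
  proof (rule ennreal_le_epsilon)
    fix e :: real assume "0 < e"
    from Liminf_le[OF _ small[OF this]] show "liminf (\<lambda>j. \<integral>\<^sup>+z. indicator (- E) z * h j z \<partial>lborel) \<le> 0 + ennreal e"
      by simp
  qed
  finally have "AE z in lborel. liminf (\<lambda>j. indicator (- E) z * h j z) = 0"
    by (subst (asm) le_zero_eq, subst (asm) nn_integral_0_iff_AE) auto
  then show ?thesis
  proof (eventually_elim, intro impI allI)
    fix z and \<nu> r0 :: real
    assume lim: "liminf (\<lambda>j. indicator (- E) z * h j z) = 0" and z: "z \<notin> E" and pos: "0 < \<nu>" "0 < r0"
    define k where "k = 2 * \<theta> * unit_ball_vol (real DIM('a))"
    have k: "0 < k" using \<theta> by (simp add: k_def)
    \<comment> \<open>A vanishing liminf makes the density small at infinitely many scales, hence at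
      one below r0.\<close>
    have "liminf (\<lambda>j. h j z) < ennreal (\<nu> / k)" using lim z pos k by simp
    then have "\<exists>\<^sub>F j in sequentially. h j z < ennreal (\<nu> / k)"
      using le_Liminf_iff[of "ennreal (\<nu> / k)" sequentially "\<lambda>j. h j z"]
      by (auto simp: frequently_def not_less not_le elim!: eventually_mono dest: leD Liminf_bounded)
    moreover obtain n where n: "1 / real (Suc n) < r0" using nat_approx_posE[OF pos(2)] by auto
    ultimately obtain j where j: "n \<le> j" "h j z < ennreal (\<nu> / k)"
      unfolding frequently_sequentially by blast
    have "1 / real (Suc j) \<le> 1 / real (Suc n)" using j by (simp add: frac_le)
    with n have "r j < r0" by (simp add: r_def)
    have "emeasure lborel (E \<inter> cyl s p \<theta> (r j) z) = h j z * ennreal (c j)"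
      unfolding hE cc ..
    also have "\<dots> \<le> ennreal (\<nu> / k) * ennreal (c j)" using j by (intro mult_right_mono) auto
    also have "\<dots> = ennreal (\<nu> * r j powr ?\<alpha>)"
      using pos k by (subst ennreal_mult[symmetric]) (auto simp: c_def k_def[symmetric])
    finally show "\<exists>r. 0 < r \<and> r < r0 \<and> emeasure lborel (E \<inter> cyl s p \<theta> r z) \<le> ennreal (\<nu> * r powr ?\<alpha>)"
      using r \<open>r j < r0\<close> by blast
  qed
qed

section \<open>The regularization: semicontinuity and comparison with u\<close>

lemma AE_lebesgue_on_iff:
  fixes P :: "'d::euclidean_space \<Rightarrow> bool"
  assumes "A \<in> sets borel"
  shows "(AE w in lebesgue_on A. P w) \<longleftrightarrow> (AE w in lborel. w \<in> A \<longrightarrow> P w)"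
proof -
  have "A \<inter> space lebesgue \<in> sets lebesgue" using assms by simp
  from AE_restrict_space_iff[OF this] show ?thesis by (simp only: AE_completion_iff)
qed

text \<open>The essential infimum increases as r decreases, so the limit is the supremum over all
  radii. The first fact accepts lower bounds on any open neighbourhood, which makes the shape of the
  cylinders immaterial.\<close>

lemma
  fixes z :: "'a::euclidean_space \<times> real"
  assumes ps: "0 < p * s" and \<theta>: "0 < \<theta>"
  shows lsc_regularization_ge:
      "\<And>c N. \<lbrakk>open N; z \<in> N; AE w in lborel. w \<in> N \<longrightarrow> c \<le> ereal (u w)\<rbrakk> \<Longrightarrow> c \<le> lsc_regularization s p \<theta> u z"
    and less_lsc_regularizationD:
      "\<And>c. c < lsc_regularization s p \<theta> u z \<Longrightarrow> \<exists>r>0. AE w in lborel. w \<in> cyl s p \<theta> r z \<longrightarrow> c < ereal (u w)"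
proof -
  define \<phi> where "\<phi> r = essinf (lebesgue_on (cyl s p \<theta> r z)) (\<lambda>w. ereal (u w))" for r
  have ge: "c \<le> \<phi> r" if "AE w in lborel. w \<in> cyl s p \<theta> r z \<longrightarrow> c \<le> ereal (u w)" for c r
    using that unfolding \<phi>_def essinf_def
    by (intro Liminf_bounded) (simp add: AE_lebesgue_on_iff[OF cyl_measurable])
  have lessD: "AE w in lborel. w \<in> cyl s p \<theta> r z \<longrightarrow> c < ereal (u w)" if "c < \<phi> r" for c r
    using less_LiminfD[OF that[unfolded \<phi>_def essinf_def]]
    by (simp add: AE_lebesgue_on_iff[OF cyl_measurable])
  have mono: "\<phi> r2 \<le> \<phi> r1" if "0 < r1" "r1 \<le> r2" for r1 r2
  proof (rule dense_le)
    fix c assume "c < \<phi> r2"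
    have "r1 powr (s * p) \<le> r2 powr (s * p)" using that ps by (intro powr_mono2) (auto simp: mult.commute)
    then have "\<theta> * r1 powr (s * p) \<le> \<theta> * r2 powr (s * p)" using \<theta> by simp
    then have "cyl s p \<theta> r1 z \<subseteq> cyl s p \<theta> r2 z"
      unfolding cyl_def using that by (intro Sigma_mono) auto
    with lessD[OF \<open>c < \<phi> r2\<close>] show "c \<le> \<phi> r1"
      by (intro ge) (auto elim!: eventually_mono)
  qed
  have "(\<phi> \<longlongrightarrow> (SUP r\<in>{0<..}. \<phi> r)) (at_right 0)"
  proof (rule order_tendstoI)
    fix c assume "c < (SUP r\<in>{0<..}. \<phi> r)"
    then obtain r where r: "0 < r" "c < \<phi> r" by (auto simp: less_SUP_iff)
    show "\<forall>\<^sub>F x in at_right 0. c < \<phi> x"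
      unfolding eventually_at_right_field
      using r mono by (intro exI[of _ r]) (auto intro: less_le_trans)
  next
    fix c assume "(SUP r\<in>{0<..}. \<phi> r) < c"
    then show "\<forall>\<^sub>F x in at_right 0. \<phi> x < c"
      unfolding eventually_at_right_field
      by (intro exI[of _ 1]) (auto intro: le_less_trans[OF SUP_upper])
  qed
  then have lsc: "lsc_regularization s p \<theta> u z = (SUP r\<in>{0<..}. \<phi> r)"
    unfolding lsc_regularization_def \<phi>_def[symmetric] by (intro tendsto_Lim) auto
  show "c \<le> lsc_regularization s p \<theta> u z"
    if N: "open N" "z \<in> N" "AE w in lborel. w \<in> N \<longrightarrow> c \<le> ereal (u w)" for c N
  proof -
    obtain \<delta> where \<delta>: "0 < \<delta>" "ball z \<delta> \<subseteq> N" using N open_contains_ball by blast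
    obtain \<rho> where \<rho>: "0 < \<rho>" "\<And>r z. 0 < r \<Longrightarrow> r < \<rho> \<Longrightarrow> cyl s p \<theta> r (z :: 'a \<times> real) \<subseteq> ball z \<delta>"
      using cyl_subset_ball[OF \<delta>(1) ps \<theta>, where 'a = 'a] by blast
    have "cyl s p \<theta> (\<rho> / 2) z \<subseteq> N" using \<rho>(2)[of "\<rho> / 2" z] \<rho>(1) \<delta>(2) by auto
    with N(3) have "c \<le> \<phi> (\<rho> / 2)"
      by (intro ge) (auto elim!: eventually_mono)
    also have "\<dots> \<le> (SUP r\<in>{0<..}. \<phi> r)" using \<rho>(1) by (intro SUP_upper) simp
    finally show ?thesis by (simp add: lsc)
  qed
  show "\<exists>r>0. AE w in lborel. w \<in> cyl s p \<theta> r z \<longrightarrow> c < ereal (u w)"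
    if "c < lsc_regularization s p \<theta> u z" for c
    using that lessD unfolding lsc by (auto simp: less_SUP_iff)
qed

lemma mem_cyl_center: "0 < r \<Longrightarrow> 0 < \<theta> \<Longrightarrow> z \<in> cyl s p \<theta> r z"
  by (cases z) (simp add: cyl_def)

text \<open>A cylinder on which u > c almost everywhere is a neighbourhood of each of its points, so
  c bounds the regularization from below on all of it.\<close>

lemma lsc_regularization_lower_semicontinuous:
  fixes S :: "('a::euclidean_space \<times> real) set"
  assumes ps: "0 < p * s" and \<theta>: "0 < \<theta>"
  shows "lower_semicontinuous_on S (lsc_regularization s p \<theta> u)"
  unfolding lower_semicontinuous_on_def
proof
  fix z assume "z \<in> S"
  show "lsc_regularization s p \<theta> u z \<le> Liminf (at z within S) (lsc_regularization s p \<theta> u)"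
    unfolding le_Liminf_iff
  proof (intro allI impI)
    fix y assume "y < lsc_regularization s p \<theta> u z"
    then obtain c where c: "y < c" "c < lsc_regularization s p \<theta> u z" using dense by blast
    from less_lsc_regularizationD[OF ps \<theta> c(2)] obtain r where r: "0 < r"
      and ae: "AE w in lborel. w \<in> cyl s p \<theta> r z \<longrightarrow> c < ereal (u w)" by blast
    have "y < lsc_regularization s p \<theta> u w" if "w \<in> cyl s p \<theta> r z" for w
    proof -
      have "AE w in lborel. w \<in> cyl s p \<theta> r z \<longrightarrow> c \<le> ereal (u w)" using ae by eventually_elim auto
      from lsc_regularization_ge[OF ps \<theta> open_cyl that this] c(1) show ?thesis by simp
    qed
    moreover have "\<forall>\<^sub>F w in at z within S. w \<in> cyl s p \<theta> r z"
      by (rule eventually_at_topological[THEN iffD2], rule exI[of _ "cyl s p \<theta> r z"])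
         (simp add: open_cyl mem_cyl_center[OF r \<theta>])
    ultimately show "\<forall>\<^sub>F w in at z within S. y < lsc_regularization s p \<theta> u w"
      by (auto elim!: eventually_mono)
  qed
qed

text \<open>The points with regularization above c are covered by open sets on which u \<ge> c
  almost everywhere. By Lindeloef's theorem countably many suffice, so u \<ge> c at almost all of
  these points. Rational c then separate the two functions.\<close>

lemma lsc_regularization_le_AE:
  fixes u :: "'a::euclidean_space \<times> real \<Rightarrow> real"
  assumes ps: "0 < p * s" and \<theta>: "0 < \<theta>"
  shows "AE z in lborel. lsc_regularization s p \<theta> u z \<le> ereal (u z)"
proof -
  have "AE z in lborel. ereal c < lsc_regularization s p \<theta> u z \<longrightarrow> c \<le> u z" for c
  proof -
    define F where "F = {N. open N \<and> (AE w in lborel. w \<in> N \<longrightarrow> c \<le> u w)}"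
    obtain F' where F': "F' \<subseteq> F" "countable F'" "\<Union>F' = \<Union>F"
      using Lindelof[of F] by (auto simp: F_def)
    have "AE w in lborel. \<forall>N\<in>F'. w \<in> N \<longrightarrow> c \<le> u w"
      using F' by (intro AE_ball_countable') (auto simp: F_def)
    then show ?thesis
    proof eventually_elim
      case (elim z)
      show ?case
      proof
        assume "ereal c < lsc_regularization s p \<theta> u z"
        from less_lsc_regularizationD[OF ps \<theta> this] obtain r where r: "0 < r"
          and ae: "AE w in lborel. w \<in> cyl s p \<theta> r z \<longrightarrow> ereal c < ereal (u w)" by blast
        have "cyl s p \<theta> r z \<in> F"
        proof -
          have "AE w in lborel. w \<in> cyl s p \<theta> r z \<longrightarrow> c \<le> u w" using ae by eventually_elim auto
          then show ?thesis by (simp add: F_def open_cyl)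
        qed
        then have "z \<in> \<Union>F'" using mem_cyl_center[OF r \<theta>] F'(3) by blast
        with elim show "c \<le> u z" by blast
      qed
    qed
  qed
  then have "AE z in lborel. \<forall>c\<in>\<rat>. ereal c < lsc_regularization s p \<theta> u z \<longrightarrow> c \<le> u z"
    by (intro AE_ball_countable' countable_rat)
  then show ?thesis
  proof eventually_elim
    case (elim z)
    show ?case
    proof (rule ccontr)
      assume "\<not> ?thesis"
      then have "ereal (u z) < lsc_regularization s p \<theta> u z" by (simp add: not_le)
      from ereal_dense2[OF this] obtain c1 where c1: "ereal (u z) < ereal c1" "ereal c1 < lsc_regularization s p \<theta> u z"
        by blast
      then obtain c where c: "c \<in> \<rat>" "u z < c" "c < c1" using Rats_dense_in_real[of "u z" c1] by auto
      have "ereal c < ereal c1" using c by simp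
      also note c1(2)
      finally have "ereal c < lsc_regularization s p \<theta> u z" .
      with elim c show False by auto
    qed
  qed
qed

text \<open>The shapes \<theta> of the regularization and \<theta>' of the Lebesgue points are
  independent of each other. Equality almost everywhere is not deduced from Lebesgue points but from
  the lower density of sublevel sets at rational levels, combined with
  \<open>lsc_regularization_le_AE\<close>.\<close>

theorem theorem2p12:
  fixes \<Omega> :: "'a::euclidean_space set"
    and K :: "'a \<Rightarrow> 'a \<Rightarrow> real \<Rightarrow> real"
    and u :: "'a \<times> real \<Rightarrow> real"
    and T p q s \<Lambda> \<theta> \<theta>' :: real
  assumes "open \<Omega>" "connected \<Omega>" "\<Omega> \<noteq> {}" "bounded \<Omega>"
    and "T > 0" "1 < p" "q > 0" "0 < s" "s < 1" "\<Lambda> \<ge> 1"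
    and "admissible_kernel s p \<Lambda> T K"
    and "weak_supersolution s p q K \<Omega> T u"
    and "\<theta> > 0" "\<theta>' > 0"
  shows "(\<forall>z \<in> \<Omega> \<times> {0<..<T}. lebesgue_point s p \<theta>' u z \<longrightarrow>
            lsc_regularization s p \<theta> u z = ereal (u z)) \<and>
         lower_semicontinuous_on (\<Omega> \<times> {0<..<T}) (lsc_regularization s p \<theta> u) \<and>
         (AE z in lebesgue_on (\<Omega> \<times> {0<..<T}). lsc_regularization s p \<theta> u z = ereal (u z))"
proof (intro conjI ballI impI)
  have ps: "0 < p * s" using assms by simp
  note \<theta> = \<open>\<theta> > 0\<close> and \<theta>' = \<open>\<theta>' > 0\<close>
  let ?\<alpha> = "real DIM('a) + p * s"
  let ?S = "\<Omega> \<times> {0<..<T}"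
  have oS: "open ?S" using assms by (intro open_Times) auto
  \<comment> \<open>Common core of both claims. The shape \<theta>1 of the cylinders with small
    sublevel sets is left free: it is \<theta>' at Lebesgue points and \<theta> in the statement
    almost everywhere.\<close>
  have lower: "ereal c \<le> lsc_regularization s p \<theta> u z"
    if z: "z \<in> ?S" and \<theta>1: "0 < \<theta>1"
      and small: "\<And>\<nu> r0. \<lbrakk>0 < \<nu>; 0 < r0\<rbrakk> \<Longrightarrow> \<exists>r. 0 < r \<and> r < r0 \<and>
        emeasure lebesgue {w \<in> cyl s p \<theta>1 r z. u w < c} \<le> ennreal (\<nu> * r powr ?\<alpha>)" for z c \<theta>1
  proof (rule ereal_le_epsilon2)
    fix e :: real assume e: "0 < e"
    have zz: "fst z \<in> \<Omega>" "0 < snd z" "snd z < T" using z by auto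
    obtain N where N: "open N" "z \<in> N" "AE w in lborel. w \<in> N \<longrightarrow> c - e \<le> u w"
      using supersolution_lower_bound[OF assms(1,6,7,8,9,10,11,12) zz \<theta>1 e, of c] small by auto
    have "AE w in lborel. w \<in> N \<longrightarrow> ereal (c - e) \<le> ereal (u w)" using N(3) by eventually_elim simp
    from lsc_regularization_ge[OF ps \<theta> N(1,2) this]
    show "ereal c \<le> lsc_regularization s p \<theta> u z + ereal e"
      using ereal_minus_le[of "ereal e" "ereal c"] by simp
  qed
  {
    fix z assume z: "z \<in> ?S" and lp: "lebesgue_point s p \<theta>' u z"
    define X where "X r = (\<integral>\<^sup>+w\<in>cyl s p \<theta>' r z. ennreal \<bar>u z - u w\<bar> \<partial>lebesgue)" for r
    define k where "k = 2 * \<theta>' * unit_ball_vol (real DIM('a))"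
    have k: "0 < k" using \<theta>' by (simp add: k_def)
    have em: "emeasure lebesgue (cyl s p \<theta>' r z) = ennreal (k * r powr ?\<alpha>)" if "0 < r" for r
      using emeasure_cyl[OF that \<theta>', of s p z] by (simp add: k_def cyl_measurable)
    have ev: "\<forall>\<^sub>F r in at_right 0. X r / emeasure lebesgue (cyl s p \<theta>' r z) < ennreal \<eta>" if "0 < \<eta>" for \<eta>
      using order_tendstoD(2)[OF lp[unfolded lebesgue_point_def], of "ennreal \<eta>"] that by (simp add: X_def)
    have X_less: "X r \<le> ennreal (\<eta> * (k * r powr ?\<alpha>))"
      if "0 < r" "0 < \<eta>" "X r / emeasure lebesgue (cyl s p \<theta>' r z) < ennreal \<eta>" for r \<eta>
    proof -
      have kr: "0 < k * r powr ?\<alpha>" using that k by simp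
      have "X r = X r / ennreal (k * r powr ?\<alpha>) * ennreal (k * r powr ?\<alpha>)"
      proof -
        have "x / ennreal y * ennreal y = x" if "0 < y" for x :: ennreal and y :: real
          using that by (simp add: ennreal_divide_times)
        from this[OF kr] show ?thesis ..
      qed
      also have "\<dots> \<le> ennreal \<eta> * ennreal (k * r powr ?\<alpha>)"
        using that em[OF that(1)] by (intro mult_right_mono) auto
      also have "\<dots> = ennreal (\<eta> * (k * r powr ?\<alpha>))"
        using that kr by (subst ennreal_mult) auto
      finally show ?thesis .
    qed
    have "ereal (u z) \<le> lsc_regularization s p \<theta> u z"
    proof (rule ereal_le_epsilon2)
      fix e :: real assume e: "0 < e"
      have "ereal (u z - e) \<le> lsc_regularization s p \<theta> u z"
      proof (rule lower[OF z \<theta>'])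
        fix \<nu> r0 :: real assume pos: "0 < \<nu>" "0 < r0"
        have "0 < e * \<nu> / k" using e pos k by simp
        from ev[OF this] obtain b where b: "0 < b" "\<And>r. \<lbrakk>0 < r; r < b\<rbrakk> \<Longrightarrow> X r / emeasure lebesgue (cyl s p \<theta>' r z) < ennreal (e * \<nu> / k)"
          unfolding eventually_at_right_field by auto
        define r where "r = min b r0 / 2"
        have r: "0 < r" "r < b" "r < r0" using b pos by (auto simp: r_def)
        let ?A = "{w \<in> cyl s p \<theta>' r z. u w < u z - e}"
        have "emeasure lebesgue ?A \<le> ennreal (\<nu> * r powr ?\<alpha>)"
        \<comment> \<open>\<open>emeasure\<close> is 0 on sets outside the sigma-algebra, so that
          case is trivial.\<close>
        proof (cases "?A \<in> sets lebesgue")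
          case True
          have "ennreal e * emeasure lebesgue ?A = (\<integral>\<^sup>+w. ennreal e * indicator ?A w \<partial>lebesgue)"
            by (rule nn_integral_cmult_indicator[symmetric, OF True])
          \<comment> \<open>Chebyshev's inequality: |u z - u w| exceeds e on
            \<open>?A\<close>.\<close>
          also have "\<dots> \<le> X r"
            unfolding X_def by (intro nn_integral_mono) (auto simp: indicator_def intro!: ennreal_leI)
          also have "\<dots> \<le> ennreal (e * \<nu> / k * (k * r powr ?\<alpha>))"
            using r b e pos k by (intro X_less) auto
          also have "\<dots> = ennreal e * ennreal (\<nu> * r powr ?\<alpha>)"
            using e pos k by (subst ennreal_mult[symmetric]) auto
          finally show ?thesis using e by (subst (asm) ennreal_mult_le_mult_iff) auto
        qed (simp add: emeasure_notin_sets)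
        with r show "\<exists>r. 0 < r \<and> r < r0 \<and> emeasure lebesgue {w \<in> cyl s p \<theta>' r z. u w < u z - e} \<le> ennreal (\<nu> * r powr ?\<alpha>)"
          by blast
      qed
      then show "ereal (u z) \<le> lsc_regularization s p \<theta> u z + ereal e"
        using ereal_minus_le[of "ereal e" "ereal (u z)"] by simp
    qed
    \<comment> \<open>Pure measure theory: if u > c > u z almost everywhere near z, the averages of
      |u z - u w| stay at or above c - u z = 2 \<eta>, whereas at a Lebesgue point they fall below
      \<eta>.\<close>
    moreover have "lsc_regularization s p \<theta> u z \<le> ereal (u z)"
    proof (rule ccontr)
      assume "\<not> ?thesis"
      then have "ereal (u z) < lsc_regularization s p \<theta> u z" by (simp add: not_le)
      from ereal_dense2[OF this] obtain c where c: "ereal (u z) < ereal c" "ereal c < lsc_regularization s p \<theta> u z"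
        by blast
      from less_lsc_regularizationD[OF ps \<theta> c(2)] obtain r1 where r1: "0 < r1"
        and ae: "AE w in lborel. w \<in> cyl s p \<theta> r1 z \<longrightarrow> ereal c < ereal (u w)" by blast
      obtain \<delta> where \<delta>: "0 < \<delta>" "ball z \<delta> \<subseteq> cyl s p \<theta> r1 z"
        using open_contains_ball_eq[OF open_cyl] mem_cyl_center[OF r1 \<theta>] by blast
      obtain \<rho> where \<rho>: "0 < \<rho>" "\<And>r z. 0 < r \<Longrightarrow> r < \<rho> \<Longrightarrow> cyl s p \<theta>' r (z :: 'a \<times> real) \<subseteq> ball z \<delta>"
        using cyl_subset_ball[OF \<delta>(1) ps \<theta>', where 'a = 'a] by blast
      define \<eta> where "\<eta> = (c - u z) / 2"
      have \<eta>: "0 < \<eta>" using c by (simp add: \<eta>_def)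
      from ev[OF this] obtain b where b: "0 < b" "\<And>r. \<lbrakk>0 < r; r < b\<rbrakk> \<Longrightarrow> X r / emeasure lebesgue (cyl s p \<theta>' r z) < ennreal \<eta>"
        unfolding eventually_at_right_field by auto
      define r where "r = min b \<rho> / 2"
      have r: "0 < r" "r < b" "r < \<rho>" using b \<rho> by (auto simp: r_def)
      have kr: "0 < k * r powr ?\<alpha>" using k r by simp
      have "ennreal (2 * \<eta> * (k * r powr ?\<alpha>)) = ennreal (2 * \<eta>) * emeasure lebesgue (cyl s p \<theta>' r z)"
        using \<eta> kr by (subst em[OF r(1)]) (simp add: ennreal_mult)
      also have "\<dots> = (\<integral>\<^sup>+w. ennreal (2 * \<eta>) * indicator (cyl s p \<theta>' r z) w \<partial>lebesgue)"
        by (rule nn_integral_cmult_indicator[symmetric]) (simp add: cyl_measurable)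
      also have "\<dots> \<le> X r"
        unfolding X_def
      proof (rule nn_integral_mono_AE)
        have "AE w in lebesgue. w \<in> cyl s p \<theta> r1 z \<longrightarrow> ereal c < ereal (u w)" using ae by (simp only: AE_completion_iff)
        then show "AE w in lebesgue. ennreal (2 * \<eta>) * indicator (cyl s p \<theta>' r z) w \<le> ennreal \<bar>u z - u w\<bar> * indicator (cyl s p \<theta>' r z) w"
        proof eventually_elim
          case (elim w)
          show ?case
          proof (cases "w \<in> cyl s p \<theta>' r z")
            case True
            then have "c < u w" using elim \<rho>(2)[OF r(1,3), of z] \<delta>(2) by auto
            then have "2 * \<eta> \<le> \<bar>u z - u w\<bar>" unfolding \<eta>_def by (simp add: abs_if)
            then show ?thesis using True by (simp add: ennreal_leI)
          qed simp
        qed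
      qed
      also have "\<dots> \<le> ennreal (\<eta> * (k * r powr ?\<alpha>))" using r b \<eta> by (intro X_less) auto
      finally have "2 * (\<eta> * (k * r powr ?\<alpha>)) \<le> \<eta> * (k * r powr ?\<alpha>)"
        using \<eta> kr by (subst (asm) ennreal_le_iff) (auto simp: mult.assoc)
      moreover have "0 < \<eta> * (k * r powr ?\<alpha>)" using \<eta> kr by simp
      ultimately show False by linarith
    qed
    ultimately show "lsc_regularization s p \<theta> u z = ereal (u z)" by (intro antisym)
  }
  show "lower_semicontinuous_on ?S (lsc_regularization s p \<theta> u)"
    by (rule lsc_regularization_lower_semicontinuous[OF ps \<theta>])
  have uL: "u \<in> Linf_Linf T" using assms(12) by (simp add: weak_supersolution_def)
  obtain V where V[measurable]: "V \<in> borel_measurable borel"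
    and eq: "AE w in lborel. snd w \<in> {0<..<T} \<longrightarrow> u w = V w"
    by (rule Linf_borel_version[OF uL, of 0])
  \<comment> \<open>Sublevel sets of the Borel version, bounded because \<Omega> is, as
    \<open>AE_lower_density_zero\<close> demands.\<close>
  define E where "E c = {w \<in> ?S. V w < c}" for c
  have E: "E c \<in> sets borel" "bounded (E c)" for c
  proof -
    have "E c = ?S \<inter> (V -` {..<c} \<inter> space borel)" by (auto simp: E_def)
    also have "\<dots> \<in> sets borel" using oS by (intro sets.Int measurable_sets[OF V]) auto
    finally show "E c \<in> sets borel" .
    have "bounded ?S" using assms by (intro bounded_Times) auto
    then show "bounded (E c)" by (rule bounded_subset) (auto simp: E_def)
  qed
  have "AE z in lborel. \<forall>c\<in>\<rat>. z \<notin> E c \<longrightarrow> (\<forall>\<nu>>0. \<forall>r0>0. \<exists>r. 0 < r \<and> r < r0 \<and>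
    emeasure lborel (E c \<inter> cyl s p \<theta> r z) \<le> ennreal (\<nu> * r powr ?\<alpha>))"
    by (intro AE_ball_countable' countable_rat AE_lower_density_zero[OF E ps \<theta>])
  with eq lsc_regularization_le_AE[OF ps \<theta>, of u]
  have "AE z in lborel. z \<in> ?S \<longrightarrow> lsc_regularization s p \<theta> u z = ereal (u z)"
  proof eventually_elim
    case (elim z)
    show ?case
    proof
      assume z: "z \<in> ?S"
      \<comment> \<open>A level c \<le> u z puts z outside E c, where the lower density of E c
        vanishes. Taking c rational leaves one null set for all levels.\<close>
      have le: "ereal c \<le> lsc_regularization s p \<theta> u z" if c: "c \<in> \<rat>" "c \<le> u z" for c
      proof (rule lower[OF z \<theta>])
        fix \<nu> r0 :: real assume pos: "0 < \<nu>" "0 < r0"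
        obtain \<delta> where \<delta>: "0 < \<delta>" "ball z \<delta> \<subseteq> ?S" using open_contains_ball_eq[OF oS] z by blast
        obtain \<rho> where \<rho>: "0 < \<rho>" "\<And>r z. 0 < r \<Longrightarrow> r < \<rho> \<Longrightarrow> cyl s p \<theta> r (z :: 'a \<times> real) \<subseteq> ball z \<delta>"
          using cyl_subset_ball[OF \<delta>(1) ps \<theta>, where 'a = 'a] by blast
        have zE: "z \<notin> E c" using elim(1) z c by (auto simp: E_def)
        have m: "0 < min r0 \<rho>" using pos \<rho> by simp
        from elim(3)[THEN bspec, OF c(1), rule_format, OF zE pos(1) m] obtain r where r: "0 < r" "r < min r0 \<rho>"
          and le: "emeasure lborel (E c \<inter> cyl s p \<theta> r z) \<le> ennreal (\<nu> * r powr ?\<alpha>)"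
          by (elim exE conjE)
        have sub: "cyl s p \<theta> r z \<subseteq> ?S" using \<rho>(2)[of r z] r \<delta>(2) by auto
        let ?A = "{w \<in> cyl s p \<theta> r z. u w < c}"
        have "emeasure lebesgue ?A \<le> ennreal (\<nu> * r powr ?\<alpha>)"
        proof (cases "?A \<in> sets lebesgue")
          case True
          have "AE w in lborel. w \<in> ?A \<longrightarrow> w \<in> E c \<inter> cyl s p \<theta> r z"
            using eq by eventually_elim (use sub in \<open>auto simp: E_def\<close>)
          then have "AE w in lebesgue. w \<in> ?A \<longrightarrow> w \<in> E c \<inter> cyl s p \<theta> r z" by (simp only: AE_completion_iff)
          then have "emeasure lebesgue ?A \<le> emeasure lebesgue (E c \<inter> cyl s p \<theta> r z)"
            using E(1)[of c] cyl_measurable[of s p \<theta> r z] by (intro emeasure_mono_AE) auto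
          also have "\<dots> = emeasure lborel (E c \<inter> cyl s p \<theta> r z)"
            using E(1)[of c] cyl_measurable[of s p \<theta> r z] by simp
          finally show ?thesis using le by simp
        qed (simp add: emeasure_notin_sets)
        with r show "\<exists>r. 0 < r \<and> r < r0 \<and> emeasure lebesgue {w \<in> cyl s p \<theta> r z. u w < c} \<le> ennreal (\<nu> * r powr ?\<alpha>)"
          by auto
      qed
      have "ereal (u z) \<le> lsc_regularization s p \<theta> u z"
      proof (rule ccontr)
        assume "\<not> ?thesis"
        then have "lsc_regularization s p \<theta> u z < ereal (u z)" by (simp add: not_le)
        from ereal_dense2[OF this] obtain c1 where c1: "lsc_regularization s p \<theta> u z < ereal c1" "ereal c1 < ereal (u z)"
          by blast
        then obtain c where c: "c \<in> \<rat>" "c1 < c" "c < u z" using Rats_dense_in_real[of c1 "u z"] by auto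
        have "ereal c \<le> lsc_regularization s p \<theta> u z" using le c by simp
        also note c1(1)
        finally show False using c by simp
      qed
      with elim(2) show "lsc_regularization s p \<theta> u z = ereal (u z)" by (rule antisym)
    qed
  qed
  then show "AE z in lebesgue_on ?S. lsc_regularization s p \<theta> u z = ereal (u z)"
    using oS by (subst AE_lebesgue_on_iff) auto
qed

end
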